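(* Let $g$ be a four-dimensional Walker metric that is Einstein, i.e. $R_{ab}=\lambda g_{ab}$ with $\lambda$ constant, and suppose that the self-dual part of its Weyl tensor vanishes, i.e. $\Psi_0=\Psi_1=\Psi_2=\Psi_3=\Psi_4=0$. Then $g$ is universal.
   Context: Walker metric: a neutral-signature metric on an open set of $\mathbb{R}^4$ with coordinates $(u,v,U,V)$ of the form $\mathrm{d}s^2 = 2\,\mathrm{d}u(\mathrm{d}v + A\,\mathrm{d}u + C\,\mathrm{d}U) + 2\,\mathrm{d}U(\mathrm{d}V + B\,\mathrm{d}U)$, with $A,B,C$ smooth functions of $(u,v,U,V)$ (local canonical form of a four-dimensional metric with a parallel field of null 2-planes, spanned by $\partial_v,\partial_V$). Associated null frame: $\ell=\partial_v$, $n=\partial_u-A\partial_v-\frac12 C\partial_V$, $\tilde m=\partial_V$, $m=-\partial_U+B\partial_V+\frac12 C\partial_v$; it satisfies $\ell_an^a=1$, $m_a\tilde m^a=-1$, all other inner products zero. With $C_{abcd}$ the Weyl tensor, the self-dual Weyl components are $\Psi_0=C_{abcd}\ell^am^b\ell^cm^d$, $\Psi_1=C_{abcd}\ell^am^b\ell^cn^d$, $\Psi_2=C_{abcd}\ell^am^b\tilde m^cn^d$, $\Psi_3=C_{abcd}\ell^an^b\tilde m^cn^d$, $\Psi_4=C_{abcd}n^a\tilde m^bn^c\tilde m^d$. The anti-self-dual components $\tilde\Psi_i$ are obtained by interchanging $m$ and $\tilde m$. The self-dual part of the Weyl tensor is the part determined by the $\Psi_i$ (so, with this choice of frame, its vanishing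 means that all $\Psi_i=0$). Universality: a metric is $k$-universal if every conserved ($\nabla^bT_{ab}=0$) symmetric rank-2 tensor $T_{ab}$ constructed from the metric, the Riemann tensor and its covariant derivatives up to order $k$ is a (constant) multiple of the metric. Here "constructed from" means polynomially: finite linear combinations, with constant coefficients, of contractions (using the metric) of tensor products of these tensors. The metric is universal if it is $k$-universal for all $k\ge 0$. *)

theory Defs
  imports "HOL-Analysis.Analysis" "HOL-Combinatorics.Permutations"
begin

definition pd :: "'n::finite \<Rightarrow> (real^'n \<Rightarrow> real) \<Rightarrow> real^'n \<Rightarrow> real" where
  "pd i f x = deriv (\<lambda>t. f (x + t *\<^sub>R axis i 1)) 0"

primrec Ck_on :: "nat \<Rightarrow> (real^'n) set \<Rightarrow> (real^'n \<Rightarrow> real) \<Rightarrow> bool" where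
  "Ck_on 0 S f \<longleftrightarrow> continuous_on S f"
| "Ck_on (Suc k) S f \<longleftrightarrow> f differentiable_on S \<and> (\<forall>i. Ck_on k S (pd i f))"

text \<open>Meant for open \<open>S\<close>, where differentiability within \<open>S\<close> is ordinary differentiability.\<close>

definition smooth_on :: "(real^'n) set \<Rightarrow> (real^'n \<Rightarrow> real) \<Rightarrow> bool" where
  "smooth_on S f \<longleftrightarrow> (\<forall>k. Ck_on k S f)"

text \<open>A covariant tensor field of rank \<open>r\<close> is given by its coordinate components: its value at a
  point and at a list of \<open>r\<close> indices. The values at lists of any other length carry no meaning.
  All fields are total functions, but are only ever looked at on an open set, where they depend on
  the values of the metric in that set alone.\<close>

type_synonym 'n metric = "real^'n \<Rightarrow> real^'n^'n"
type_synonym 'n tensor = "real^'n \<Rightarrow> 'n list \<Rightarrow> real"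

definition metric_tensor :: "'n::finite metric \<Rightarrow> 'n tensor" where
  "metric_tensor g x is = g x $ (is ! 0) $ (is ! 1)"

definition ginv :: "'n::finite metric \<Rightarrow> real^'n \<Rightarrow> 'n \<Rightarrow> 'n \<Rightarrow> real" where
  "ginv g x a b = matrix_inv (g x) $ a $ b"

text \<open>\<open>christoffel g x a b c\<close> is \<open>\<Gamma>\<^sup>a\<^bsub>bc\<^esub>\<close> at \<open>x\<close>.\<close>

definition christoffel :: "'n::finite metric \<Rightarrow> real^'n \<Rightarrow> 'n \<Rightarrow> 'n \<Rightarrow> 'n \<Rightarrow> real" where
  "christoffel g x a b c =
     (\<Sum>d\<in>UNIV. ginv g x a d *
        (pd b (\<lambda>y. g y $ d $ c) x + pd c (\<lambda>y. g y $ d $ b) x - pd d (\<lambda>y. g y $ b $ c) x)) / 2"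

text \<open>\<open>nabla g T\<close> has components \<open>\<nabla>\<^sub>c T\<^bsub>a\<dots>b\<^esub>\<close>: the index of differentiation comes first.\<close>

definition nabla :: "'n::finite metric \<Rightarrow> 'n tensor \<Rightarrow> 'n tensor" where
  "nabla g T x js = (let c = hd js; is = tl js in
     pd c (\<lambda>y. T y is) x -
     (\<Sum>j<length is. \<Sum>e\<in>UNIV. christoffel g x e c (is ! j) * T x (is[j := e])))"

text \<open>\<open>R\<^sup>a\<^bsub>bcd\<^esub>\<close>, with the sign convention
  \<open>\<nabla>\<^sub>c \<nabla>\<^sub>d X\<^sup>a - \<nabla>\<^sub>d \<nabla>\<^sub>c X\<^sup>a = R\<^sup>a\<^bsub>bcd\<^esub> X\<^sup>b\<close>.\<close>

definition riemann_up :: "'n::finite metric \<Rightarrow> real^'n \<Rightarrow> 'n \<Rightarrow> 'n \<Rightarrow> 'n \<Rightarrow> 'n \<Rightarrow> real" where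
  "riemann_up g x a b c d =
     pd c (\<lambda>y. christoffel g y a d b) x - pd d (\<lambda>y. christoffel g y a c b) x
     + (\<Sum>e\<in>UNIV. christoffel g x a c e * christoffel g x e d b
                  - christoffel g x a d e * christoffel g x e c b)"

definition riemann :: "'n::finite metric \<Rightarrow> real^'n \<Rightarrow> 'n \<Rightarrow> 'n \<Rightarrow> 'n \<Rightarrow> 'n \<Rightarrow> real" where
  "riemann g x a b c d = (\<Sum>e\<in>UNIV. g x $ a $ e * riemann_up g x e b c d)"

definition riemann_tensor :: "'n::finite metric \<Rightarrow> 'n tensor" where
  "riemann_tensor g x is = riemann g x (is ! 0) (is ! 1) (is ! 2) (is ! 3)"

definition ricci :: "'n::finite metric \<Rightarrow> real^'n \<Rightarrow> 'n \<Rightarrow> 'n \<Rightarrow> real" where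
  "ricci g x a b = (\<Sum>c\<in>UNIV. riemann_up g x c a c b)"

definition scalar_curvature :: "'n::finite metric \<Rightarrow> real^'n \<Rightarrow> real" where
  "scalar_curvature g x = (\<Sum>a\<in>UNIV. \<Sum>b\<in>UNIV. ginv g x a b * ricci g x a b)"

definition weyl :: "'n::finite metric \<Rightarrow> real^'n \<Rightarrow> 'n \<Rightarrow> 'n \<Rightarrow> 'n \<Rightarrow> 'n \<Rightarrow> real" where
  "weyl g x a b c d = (let n = real CARD('n) in
     riemann g x a b c d
     - (g x $ a $ c * ricci g x b d - g x $ a $ d * ricci g x b c
        - g x $ b $ c * ricci g x a d + g x $ b $ d * ricci g x a c) / (n - 2)
     + scalar_curvature g x * (g x $ a $ c * g x $ b $ d - g x $ a $ d * g x $ b $ c)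
         / ((n - 1) * (n - 2)))"

definition weyl_at ::
  "'n::finite metric \<Rightarrow> real^'n \<Rightarrow> real^'n \<Rightarrow> real^'n \<Rightarrow> real^'n \<Rightarrow> real^'n \<Rightarrow> real" where
  "weyl_at g x X Y Z W =
     (\<Sum>a\<in>UNIV. \<Sum>b\<in>UNIV. \<Sum>c\<in>UNIV. \<Sum>d\<in>UNIV. weyl g x a b c d * X $ a * Y $ b * Z $ c * W $ d)"

definition einstein_on :: "(real^'n::finite) set \<Rightarrow> 'n metric \<Rightarrow> real \<Rightarrow> bool" where
  "einstein_on S g lam \<longleftrightarrow> (\<forall>x\<in>S. \<forall>a b. ricci g x a b = lam * g x $ a $ b)"

text \<open>\<open>curv_monomial g k r T\<close>: \<open>T\<close> is a rank \<open>r\<close> tensor obtained by contracting, with the metric,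
  a tensor product of copies of the metric, the Riemann tensor, and its covariant derivatives of
  order at most \<open>k\<close>. Arbitrary pairs of indices can be contracted because indices may be permuted
  first.\<close>

inductive curv_monomial :: "'n::finite metric \<Rightarrow> nat \<Rightarrow> nat \<Rightarrow> 'n tensor \<Rightarrow> bool"
  for g k where
  metric: "curv_monomial g k 2 (metric_tensor g)"
| curvature: "p \<le> k \<Longrightarrow> curv_monomial g k (p + 4) ((nabla g ^^ p) (riemann_tensor g))"
| product: "curv_monomial g k r T \<Longrightarrow> curv_monomial g k s U \<Longrightarrow>
    curv_monomial g k (r + s) (\<lambda>x is. T x (take r is) * U x (drop r is))"
| permute: "curv_monomial g k r T \<Longrightarrow> \<pi> permutes {..<r} \<Longrightarrow>
    curv_monomial g k r (\<lambda>x is. T x (permute_list \<pi> is))"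
| contract: "curv_monomial g k (r + 2) T \<Longrightarrow>
    curv_monomial g k r (\<lambda>x is. \<Sum>a\<in>UNIV. \<Sum>b\<in>UNIV. ginv g x a b * T x (a # b # is))"

definition constructed_from_curvature :: "'n::finite metric \<Rightarrow> nat \<Rightarrow> nat \<Rightarrow> 'n tensor \<Rightarrow> bool" where
  "constructed_from_curvature g k r T \<longleftrightarrow>
     (\<exists>(N::nat) c M. (\<forall>i<N. curv_monomial g k r (M i)) \<and> T = (\<lambda>x is. \<Sum>i<N. c i * M i x is))"

definition symmetric_on :: "(real^'n) set \<Rightarrow> 'n::finite tensor \<Rightarrow> bool" where
  "symmetric_on S T \<longleftrightarrow> (\<forall>x\<in>S. \<forall>a b. T x [a, b] = T x [b, a])"

definition conserved_on :: "(real^'n) set \<Rightarrow> 'n::finite metric \<Rightarrow> 'n tensor \<Rightarrow> bool" where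
  "conserved_on S g T \<longleftrightarrow>
     (\<forall>x\<in>S. \<forall>a. (\<Sum>b\<in>UNIV. \<Sum>c\<in>UNIV. ginv g x b c * nabla g T x [c, a, b]) = 0)"

definition k_universal_on :: "nat \<Rightarrow> (real^'n) set \<Rightarrow> 'n::finite metric \<Rightarrow> bool" where
  "k_universal_on k S g \<longleftrightarrow>
     (\<forall>T. constructed_from_curvature g k 2 T \<and> symmetric_on S T \<and> conserved_on S g T \<longrightarrow>
        (\<exists>c. \<forall>x\<in>S. \<forall>a b. T x [a, b] = c * g x $ a $ b))"

definition universal_on :: "(real^'n) set \<Rightarrow> 'n::finite metric \<Rightarrow> bool" where
  "universal_on S g \<longleftrightarrow> (\<forall>k. k_universal_on k S g)"

text \<open>The coordinates \<open>(u, v, U, V)\<close> are the components 1, 2, 3, 4 of \<^typ>\<open>real^4\<close>. The metric is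
  \<open>2 du (dv + A du + C dU) + 2 dU (dV + B dU)\<close>.\<close>

definition walker_metric ::
  "(real^4 \<Rightarrow> real) \<Rightarrow> (real^4 \<Rightarrow> real) \<Rightarrow> (real^4 \<Rightarrow> real) \<Rightarrow> 4 metric" where
  "walker_metric A B C x = vector
     [vector [2 * A x, 1, C x,     0],
      vector [1,       0, 0,       0],
      vector [C x,     0, 2 * B x, 1],
      vector [0,       0, 1,       0]]"

text \<open>The null frame \<open>\<ell> = \<partial>\<^sub>v\<close>, \<open>n = \<partial>\<^sub>u - A \<partial>\<^sub>v - C/2 \<partial>\<^sub>V\<close>, \<open>m = -\<partial>\<^sub>U + B \<partial>\<^sub>V + C/2 \<partial>\<^sub>v\<close>,
  \<open>mt = \<partial>\<^sub>V\<close>.\<close>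

definition frame_l :: "real^4" where
  "frame_l = vector [0, 1, 0, 0]"

definition frame_n :: "(real^4 \<Rightarrow> real) \<Rightarrow> (real^4 \<Rightarrow> real) \<Rightarrow> real^4 \<Rightarrow> real^4" where
  "frame_n A C x = vector [1, - A x, 0, - C x / 2]"

definition frame_m :: "(real^4 \<Rightarrow> real) \<Rightarrow> (real^4 \<Rightarrow> real) \<Rightarrow> real^4 \<Rightarrow> real^4" where
  "frame_m B C x = vector [0, C x / 2, -1, B x]"

definition frame_mt :: "real^4" where
  "frame_mt = vector [0, 0, 0, 1]"

lemma vector_4_nth:
  "(vector [a, b, c, d] :: 'a::zero^4) $ 1 = a"
  "(vector [a, b, c, d] :: 'a::zero^4) $ 2 = b"
  "(vector [a, b, c, d] :: 'a::zero^4) $ 3 = c"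
  "(vector [a, b, c, d] :: 'a::zero^4) $ 4 = d"
  by (simp_all add: vector_def)

text \<open>The existence of such a frame shows that the metric is nondegenerate of neutral signature,
  whatever \<open>A\<close>, \<open>B\<close>, \<open>C\<close> are.\<close>

lemma frame_inner_products:
  fixes A B C :: "real^4 \<Rightarrow> real" and x :: "real^4"
  defines "G \<equiv> walker_metric A B C x"
    and "l \<equiv> frame_l" and "n \<equiv> frame_n A C x" and "m \<equiv> frame_m B C x" and "mt \<equiv> frame_mt"
  shows "l \<bullet> (G *v n) = 1" "m \<bullet> (G *v mt) = -1"
    "l \<bullet> (G *v l) = 0" "n \<bullet> (G *v n) = 0" "m \<bullet> (G *v m) = 0" "mt \<bullet> (G *v mt) = 0"
    "l \<bullet> (G *v m) = 0" "l \<bullet> (G *v mt) = 0" "n \<bullet> (G *v m) = 0" "n \<bullet> (G *v mt) = 0"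
  by (simp_all add: assms walker_metric_def frame_l_def frame_n_def frame_m_def frame_mt_def
      inner_vec_def matrix_vector_mult_def sum_4 vector_4_nth)

definition Psi0 where
  "Psi0 A B C x =
     weyl_at (walker_metric A B C) x frame_l (frame_m B C x) frame_l (frame_m B C x)"

definition Psi1 where
  "Psi1 A B C x =
     weyl_at (walker_metric A B C) x frame_l (frame_m B C x) frame_l (frame_n A C x)"

definition Psi2 where
  "Psi2 A B C x =
     weyl_at (walker_metric A B C) x frame_l (frame_m B C x) frame_mt (frame_n A C x)"

definition Psi3 where
  "Psi3 A B C x =
     weyl_at (walker_metric A B C) x frame_l (frame_n A C x) frame_mt (frame_n A C x)"

definition Psi4 where
  "Psi4 A B C x =
     weyl_at (walker_metric A B C) x (frame_n A C x) frame_mt (frame_n A C x) frame_mt"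

definition self_dual_weyl_vanishes_on ::
  "(real^4) set \<Rightarrow> (real^4 \<Rightarrow> real) \<Rightarrow> (real^4 \<Rightarrow> real) \<Rightarrow> (real^4 \<Rightarrow> real) \<Rightarrow> bool" where
  "self_dual_weyl_vanishes_on S A B C \<longleftrightarrow>
     (\<forall>x\<in>S. Psi0 A B C x = 0 \<and> Psi1 A B C x = 0 \<and> Psi2 A B C x = 0 \<and>
            Psi3 A B C x = 0 \<and> Psi4 A B C x = 0)"

end

theory Submission
  imports Defs
begin

text \<open>Call a frame \<open>e\<close> adapted if \<open>e 2\<close>, \<open>e 4\<close> span the parallel null plane and \<open>e 1\<close>, \<open>e 3\<close> are null
  vectors dual to them, and grade frame components by the boost weight of \<open>e 2\<close> (index 1 counts
  \<open>+1\<close>, index 2 counts \<open>-1\<close>). The curvature conditions say that, in every adapted frame, the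
  components of the Riemann tensor of negative weight vanish and those of weight 0 are constants,
  the same at all points and in all adapted frames; what is left free are the components
  \<open>\<Psi>\<close>-tilde 3 and 4, of weights 1 and 2. For the covariant derivatives of the Riemann tensor,
  all components of weight at most 0 vanish. Indeed, derivative indices may be permuted up
  to products of lower derivatives, by the Ricci identity; differentiating along anything but \<open>e 2\<close>
  does not lower the weight, so only components with all derivative indices equal to 2 remain, and
  the second Bianchi identity trades one of them for another index.

  Vanishing in negative weight and constancy in weight 0 are inherited by products and contractions,
  hence by every tensor constructed from the curvature. A symmetric rank 2 tensor with this property
  is a constant multiple of the metric, because the components must be unchanged by permuting,
  rescaling and mixing the vectors of an adapted frame.\<close>

text \<open>Frame components are treated as functions on the bundle of adapted frames. A component
  with one value on the whole bundle has vanishing derivative along every curve in it, and because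
  the null plane is parallel, the curves can be chosen parallel to first order. So a derivative
  component vanishes as soon as the indices behind the outermost derivative index have weight at
  most 0; no connection coefficients of a frame are computed. The obstacle is the reordering of
  derivative indices. The commutator of two derivatives of the i-th derivative of the curvature is a
  sum of contractions of the Riemann tensor with that i-th derivative. For i > 0 the second factor
  vanishes in weight at most 0, hence so does the product. For i = 0 both factors have constants in
  weight 0, and counting weights leaves a quadratic expression in them; it is removed by exchanging
  and rescaling the two null pairs of a frame. When the exchanged indices are not the outermost
  ones, the commutator is differentiated again, so the induction follows chains of derivatives
  instead of single components.\<close>

subsection \<open>Smooth functions\<close>

lemma pd_has_derivative:
  assumes "(f has_real_derivative D) (at 0)" "\<And>t. f t = h (x + t *\<^sub>R axis i 1)"
  shows "pd i h x = D"
  using assms by (simp add: pd_def DERIV_imp_deriv flip: assms(2))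

lemma line_has_derivative:
  fixes f :: "real^'n \<Rightarrow> real"
  assumes "(f has_derivative f') (at (x + s *\<^sub>R X))"
  shows "((\<lambda>t. f (x + t *\<^sub>R X)) has_real_derivative f' X) (at s)"
proof -
  have lin: "linear f'"
    using assms has_derivative_linear by blast
  have "((\<lambda>t. x + t *\<^sub>R X) has_derivative (\<lambda>t. t *\<^sub>R X)) (at s)"
    by (auto intro!: derivative_eq_intros)
  then have "((\<lambda>t. f (x + t *\<^sub>R X)) has_derivative (\<lambda>t. f' (t *\<^sub>R X))) (at s)"
    using diff_chain_at[of "\<lambda>t. x + t *\<^sub>R X" _ s f f'] assms by (simp add: o_def)
  moreover have "(\<lambda>t. f' (t *\<^sub>R X)) = (*) (f' X)"
    using lin by (auto simp: linear_cmul)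
  ultimately show ?thesis
    by (simp add: has_field_derivative_def)
qed

lemma pd_eq_derivative:
  fixes f :: "real^'n \<Rightarrow> real"
  assumes "(f has_derivative f') (at x)"
  shows "pd i f x = f' (axis i 1)"
  using line_has_derivative[of f f' x 0 "axis i 1"] assms by (intro pd_has_derivative) auto

lemma line_has_real_derivative:
  fixes f :: "real^'n \<Rightarrow> real"
  assumes "f differentiable (at (x + s *\<^sub>R X))"
  shows "((\<lambda>t. f (x + t *\<^sub>R X)) has_real_derivative (\<Sum>i\<in>UNIV. X $ i * pd i f (x + s *\<^sub>R X))) (at s)"
proof -
  obtain f' where f': "(f has_derivative f') (at (x + s *\<^sub>R X))"
    using assms by (auto simp: differentiable_def)
  then have lin: "linear f'"
    using has_derivative_linear by blast
  have "f' X = f' (\<Sum>i\<in>UNIV. X $ i *\<^sub>R axis i 1)"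
    by (simp add: basis_expansion flip: scalar_mult_eq_scaleR)
  also have "\<dots> = (\<Sum>i\<in>UNIV. X $ i * f' (axis i 1))"
    using lin by (simp add: linear_sum linear_cmul)
  finally have "f' X = (\<Sum>i\<in>UNIV. X $ i * f' (axis i 1))" .
  then show ?thesis
    using line_has_derivative[OF f'] by (simp add: pd_eq_derivative[OF f'])
qed

lemma line_in_open:
  fixes x :: "'a::real_normed_vector"
  assumes "open S" "x \<in> S"
  shows "eventually (\<lambda>t::real. x + t *\<^sub>R X \<in> S) (nhds 0)"
proof -
  have "isCont (\<lambda>t::real. x + t *\<^sub>R X) 0"
    by (intro continuous_intros)
  then have "((\<lambda>t::real. x + t *\<^sub>R X) \<longlongrightarrow> x) (nhds 0)"
    using tendsto_at_iff_tendsto_nhds[of "\<lambda>t. x + t *\<^sub>R X" 0] by (simp add: isCont_def)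
  then show ?thesis
    using assms by (simp add: tendsto_def)
qed

lemma pd_cong:
  assumes "open S" "x \<in> S" "\<And>y. y \<in> S \<Longrightarrow> f y = g y"
  shows "pd i f x = pd i g x"
  unfolding pd_def
  by (intro deriv_cong_ev refl eventually_mono[OF line_in_open[OF assms(1,2)]]) (rule assms(3))

lemma Ck_on_cong:
  assumes "open S"
  shows "(\<And>y. y \<in> S \<Longrightarrow> f y = g y) \<Longrightarrow> Ck_on k S f \<Longrightarrow> Ck_on k S g"
proof (induction k arbitrary: f g)
  case 0
  then show ?case by (simp cong: continuous_on_cong)
next
  case (Suc k)
  have "f differentiable_on S \<longleftrightarrow> g differentiable_on S"
    using Suc.prems(1) by (auto simp: differentiable_on_def intro: differentiable_transform_within[OF _ zero_less_one])
  moreover have "Ck_on k S (pd i g)" for i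
    using Suc.IH[of "pd i f" "pd i g"] Suc.prems pd_cong[OF assms, of _ f g] by auto
  ultimately show ?case using Suc.prems(2) by simp
qed

lemma smooth_on_imp_continuous: "smooth_on S f \<Longrightarrow> continuous_on S f"
  unfolding smooth_on_def by (drule spec[of _ 0]) simp

lemma smooth_on_imp_differentiable_on: "smooth_on S f \<Longrightarrow> f differentiable_on S"
  unfolding smooth_on_def by (drule spec[of _ "Suc 0"]) simp

lemma smooth_on_imp_differentiable: "open S \<Longrightarrow> smooth_on S f \<Longrightarrow> x \<in> S \<Longrightarrow> f differentiable (at x)"
  using smooth_on_imp_differentiable_on differentiable_on_eq_differentiable_at by blast

lemma smooth_on_pd: "smooth_on S f \<Longrightarrow> smooth_on S (pd i f)"
  unfolding smooth_on_def
proof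
  fix k assume "\<forall>k. Ck_on k S f"
  then have "Ck_on (Suc k) S f" ..
  then show "Ck_on k S (pd i f)" by simp
qed

lemma pd_const [simp]: "pd i (\<lambda>x. c) x = 0"
  by (simp add: pd_def)

lemma pd_add:
  assumes "f differentiable (at x)" "g differentiable (at x)"
  shows "pd i (\<lambda>x. f x + g x) x = pd i f x + pd i g x"
proof -
  obtain f' g' where "(f has_derivative f') (at x)" "(g has_derivative g') (at x)"
    using assms by (auto simp: differentiable_def)
  then show ?thesis
    using pd_eq_derivative[OF has_derivative_add] by (simp add: pd_eq_derivative)
qed

lemma pd_mult:
  assumes "f differentiable (at x)" "g differentiable (at x)"
  shows "pd i (\<lambda>x. f x * g x) x = pd i f x * g x + f x * pd i g x"
proof -
  obtain f' g' where "(f has_derivative f') (at x)" "(g has_derivative g') (at x)"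
    using assms by (auto simp: differentiable_def)
  then show ?thesis
    using pd_eq_derivative[OF has_derivative_mult] by (simp add: pd_eq_derivative algebra_simps)
qed

lemma Ck_on_const: "Ck_on k S (\<lambda>x. c)"
  by (induction k arbitrary: c) (auto simp: pd_def[abs_def])

lemma smooth_on_const [intro, simp]: "smooth_on S (\<lambda>x. c)"
  by (simp add: smooth_on_def Ck_on_const)

lemma Ck_on_add:
  assumes "open S"
  shows "Ck_on k S f \<Longrightarrow> Ck_on k S g \<Longrightarrow> Ck_on k S (\<lambda>x. f x + g x)"
proof (induction k arbitrary: f g)
  case 0
  then show ?case by (auto intro: continuous_intros)
next
  case (Suc k)
  have "Ck_on k S (pd i (\<lambda>x. f x + g x))" for i
    by (rule Ck_on_cong[OF assms _ Suc.IH[of "pd i f" "pd i g"]])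
      (use Suc.prems assms pd_add[of f _ g i] in \<open>auto simp: differentiable_on_eq_differentiable_at\<close>)
  with Suc.prems show ?case by (simp add: differentiable_on_add)
qed

lemma smooth_on_add [intro]:
  "open S \<Longrightarrow> smooth_on S f \<Longrightarrow> smooth_on S g \<Longrightarrow> smooth_on S (\<lambda>x. f x + g x)"
  by (simp add: smooth_on_def Ck_on_add)

text \<open>The product rule brings back the undifferentiated factors, so an induction on the order
  alone would need \<open>Ck_on\<close> to be monotone in it. Assuming smoothness of both factors
  throughout avoids this.\<close>

lemma smooth_on_mult [intro]:
  assumes "open S" "smooth_on S f" "smooth_on S g"
  shows "smooth_on S (\<lambda>x. f x * g x)"
proof -
  have "smooth_on S f \<Longrightarrow> smooth_on S g \<Longrightarrow> Ck_on k S (\<lambda>x. f x * g x)" for k and f g :: "real^'a \<Rightarrow> real"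
  proof (induction k arbitrary: f g)
    case 0
    then show ?case by (simp add: continuous_on_mult smooth_on_imp_continuous)
  next
    case (Suc k)
    have "Ck_on k S (pd i (\<lambda>x. f x * g x))" for i
      by (rule Ck_on_cong[OF assms(1) _ Ck_on_add[OF assms(1) Suc.IH[of "pd i f" g] Suc.IH[of f "pd i g"]]])
        (use Suc.prems assms(1) smooth_on_pd in \<open>auto intro: pd_mult[symmetric] smooth_on_imp_differentiable\<close>)
    with Suc.prems show ?case
      by (simp add: differentiable_on_mult smooth_on_imp_differentiable_on)
  qed
  with assms show ?thesis by (simp add: smooth_on_def)
qed

lemma smooth_on_minus [intro]: "open S \<Longrightarrow> smooth_on S f \<Longrightarrow> smooth_on S (\<lambda>x. - f x)"
  using smooth_on_mult[of S "\<lambda>_. -1" f] by simp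

lemma smooth_on_diff [intro]:
  "open S \<Longrightarrow> smooth_on S f \<Longrightarrow> smooth_on S g \<Longrightarrow> smooth_on S (\<lambda>x. f x - g x)"
  using smooth_on_add[of S f "\<lambda>x. - g x"] by auto

lemma smooth_on_divide [intro]: "open S \<Longrightarrow> smooth_on S f \<Longrightarrow> smooth_on S (\<lambda>x. f x / c)"
  using smooth_on_mult[of S f "\<lambda>_. 1 / c"] by simp

lemma smooth_on_sum [intro]:
  "open S \<Longrightarrow> (\<And>i. i \<in> I \<Longrightarrow> smooth_on S (f i)) \<Longrightarrow> smooth_on S (\<lambda>x. \<Sum>i\<in>I. f i x)"
  by (induction I rule: infinite_finite_induct) auto

lemma pd_minus: "f differentiable (at x) \<Longrightarrow> pd i (\<lambda>x. - f x) x = - pd i f x"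
  using pd_mult[of "\<lambda>_. -1" x f i] by simp

lemma pd_diff:
  "f differentiable (at x) \<Longrightarrow> g differentiable (at x) \<Longrightarrow> pd i (\<lambda>x. f x - g x) x = pd i f x - pd i g x"
  using pd_add[of f x "\<lambda>x. - g x" i] by (simp add: pd_minus)

lemma pd_sum:
  assumes "\<And>j. j \<in> J \<Longrightarrow> f j differentiable (at x)"
  shows "pd i (\<lambda>x. \<Sum>j\<in>J. f j x) x = (\<Sum>j\<in>J. pd i (f j) x)"
  using assms
proof (induction J rule: infinite_finite_induct)
  case (insert j J)
  have "(\<lambda>x. \<Sum>j\<in>J. f j x) differentiable (at x)"
    by (intro differentiable_sum) (use insert in auto)
  with insert show ?case by (simp add: pd_add)
qed auto

section \<open>Symmetry of second partial derivatives\<close>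

lemma mixed_difference_mean_value:
  fixes f :: "real^'n \<Rightarrow> real"
  assumes "0 < h" and S: "\<And>s t. 0 \<le> s \<Longrightarrow> s \<le> h \<Longrightarrow> 0 \<le> t \<Longrightarrow> t \<le> h \<Longrightarrow> x + s *\<^sub>R axis i 1 + t *\<^sub>R axis j 1 \<in> S"
    and f: "\<And>y. y \<in> S \<Longrightarrow> f differentiable (at y)" "\<And>y. y \<in> S \<Longrightarrow> pd i f differentiable (at y)"
  shows "\<exists>s t. 0 < s \<and> s < h \<and> 0 < t \<and> t < h \<and>
    f (x + h *\<^sub>R axis i 1 + h *\<^sub>R axis j 1) - f (x + h *\<^sub>R axis i 1) - f (x + h *\<^sub>R axis j 1) + f x
      = h * h * pd j (pd i f) (x + s *\<^sub>R axis i 1 + t *\<^sub>R axis j 1)"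
proof -
  let ?a = "axis i 1 :: real^'n" and ?b = "axis j 1 :: real^'n"
  have line: "((\<lambda>t. g (y + t *\<^sub>R axis k 1)) has_real_derivative pd k g (y + s *\<^sub>R axis k 1)) (at s)"
    if "g differentiable (at (y + s *\<^sub>R axis k 1))" for g :: "real^'n \<Rightarrow> real" and y s k
    using line_has_real_derivative[OF that] by (simp add: axis_def if_distrib[where f="\<lambda>x. x * _"] cong: if_cong)
  have "\<exists>s. 0 < s \<and> s < h \<and> (f (x + h *\<^sub>R ?b + h *\<^sub>R ?a) - f (x + h *\<^sub>R ?a)) - (f (x + h *\<^sub>R ?b + 0 *\<^sub>R ?a) - f (x + 0 *\<^sub>R ?a))
      = (h - 0) * (pd i f (x + h *\<^sub>R ?b + s *\<^sub>R ?a) - pd i f (x + s *\<^sub>R ?a))"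
  proof (rule MVT2[OF assms(1)])
    fix s :: real assume s: "0 \<le> s" "s \<le> h"
    show "((\<lambda>s. f (x + h *\<^sub>R ?b + s *\<^sub>R ?a) - f (x + s *\<^sub>R ?a)) has_real_derivative
       pd i f (x + h *\<^sub>R ?b + s *\<^sub>R ?a) - pd i f (x + s *\<^sub>R ?a)) (at s)"
      by (intro DERIV_diff line f(1)) (use S[of s h] S[of s 0] s assms(1) in \<open>auto simp: add.commute add.left_commute\<close>)
  qed
  then obtain s where s: "0 < s" "s < h" "f (x + h *\<^sub>R ?b + h *\<^sub>R ?a) - f (x + h *\<^sub>R ?a) - f (x + h *\<^sub>R ?b) + f x
      = h * (pd i f (x + h *\<^sub>R ?b + s *\<^sub>R ?a) - pd i f (x + s *\<^sub>R ?a))"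
    by auto
  have "\<exists>t. 0 < t \<and> t < h \<and> pd i f (x + s *\<^sub>R ?a + h *\<^sub>R ?b) - pd i f (x + s *\<^sub>R ?a + 0 *\<^sub>R ?b)
      = (h - 0) * pd j (pd i f) (x + s *\<^sub>R ?a + t *\<^sub>R ?b)"
    by (rule MVT2[OF assms(1)], rule line, rule f(2)) (use S s in auto)
  then obtain t where "0 < t" "t < h" "pd i f (x + s *\<^sub>R ?a + h *\<^sub>R ?b) - pd i f (x + s *\<^sub>R ?a)
      = h * pd j (pd i f) (x + s *\<^sub>R ?a + t *\<^sub>R ?b)"
    by auto
  with s show ?thesis
    by (intro exI[of _ s] exI[of _ t]) (auto simp: add.commute add.left_commute)
qed

text \<open>The second difference over a square of side h is symmetric in i and j, and by two mean
  value steps it is the square of h times either mixed derivative at some point of the square. If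
  the two differed at x, continuity would keep them apart on a small square.\<close>

lemma pd_commute:
  fixes f :: "real^'n \<Rightarrow> real"
  assumes S: "open S" and x: "x \<in> S" and f: "smooth_on S f"
  shows "pd i (pd j f) x = pd j (pd i f) x"
proof (rule ccontr)
  let ?p = "pd i (pd j f)" and ?q = "pd j (pd i f)"
  let ?e = "\<bar>?p x - ?q x\<bar> / 2"
  assume "?p x \<noteq> ?q x"
  then have e: "?e > 0" by simp
  have "continuous_on S ?p" "continuous_on S ?q"
    by (intro smooth_on_imp_continuous smooth_on_pd f)+
  then have "isCont ?p x" "isCont ?q x"
    using x by (simp_all add: continuous_on_eq_continuous_at[OF S])
  then obtain d1 d2 where d: "d1 > 0" "\<And>y. dist y x < d1 \<Longrightarrow> \<bar>?p y - ?p x\<bar> < ?e"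
      "d2 > 0" "\<And>y. dist y x < d2 \<Longrightarrow> \<bar>?q y - ?q x\<bar> < ?e"
    using e unfolding continuous_at_eps_delta dist_real_def by metis
  obtain d3 where d3: "d3 > 0" "ball x d3 \<subseteq> S"
    using S x open_contains_ball by blast
  \<comment> \<open>Points of the square lie within 2 h of x; the factor 3 makes the bound
    strict.\<close>
  define h where "h = min d1 (min d2 d3) / 3"
  have h: "h > 0" "3 * h \<le> d1" "3 * h \<le> d2" "3 * h \<le> d3"
    using d d3 by (auto simp: h_def)
  have near: "dist (x + s *\<^sub>R axis a 1 + t *\<^sub>R axis b 1) x < 3 * h"
    if "0 \<le> s" "s \<le> h" "0 \<le> t" "t \<le> h" for s t and a b :: 'n
  proof -
    have "dist (x + s *\<^sub>R axis a 1 + t *\<^sub>R axis b 1) x = norm (s *\<^sub>R axis a 1 + t *\<^sub>R axis b 1 :: real^'n)"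
      by (simp add: dist_norm add.assoc)
    also have "\<dots> \<le> s + t"
      using norm_triangle_ineq[of "s *\<^sub>R axis a 1 :: real^'n" "t *\<^sub>R axis b 1"] that by simp
    finally show ?thesis using that h by simp
  qed
  have inS: "x + s *\<^sub>R axis a 1 + t *\<^sub>R axis b 1 \<in> S"
    if "0 \<le> s" "s \<le> h" "0 \<le> t" "t \<le> h" for s t and a b :: 'n
    using near[OF that, of a b] h d3 by (auto simp: dist_commute)
  have diff: "y \<in> S \<Longrightarrow> f differentiable (at y)" "y \<in> S \<Longrightarrow> pd k f differentiable (at y)" for y k
    using smooth_on_imp_differentiable[OF S] smooth_on_pd f by blast+
  obtain s t where st: "0 < s" "s < h" "0 < t" "t < h" 
    "f (x + h *\<^sub>R axis i 1 + h *\<^sub>R axis j 1) - f (x + h *\<^sub>R axis i 1) - f (x + h *\<^sub>R axis j 1) + f x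
      = h * h * ?q (x + s *\<^sub>R axis i 1 + t *\<^sub>R axis j 1)"
    using mixed_difference_mean_value[of h x i j S f] h(1) inS diff by blast
  obtain s' t' where st': "0 < s'" "s' < h" "0 < t'" "t' < h" 
    "f (x + h *\<^sub>R axis j 1 + h *\<^sub>R axis i 1) - f (x + h *\<^sub>R axis j 1) - f (x + h *\<^sub>R axis i 1) + f x
      = h * h * ?p (x + s' *\<^sub>R axis j 1 + t' *\<^sub>R axis i 1)"
    using mixed_difference_mean_value[of h x j i S f] h(1) inS diff by blast
  let ?y = "x + s *\<^sub>R axis i 1 + t *\<^sub>R axis j 1" and ?z = "x + s' *\<^sub>R axis j 1 + t' *\<^sub>R axis i 1"
  have "x + h *\<^sub>R axis j 1 + h *\<^sub>R axis i 1 = x + h *\<^sub>R axis i 1 + h *\<^sub>R axis j 1"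
    by (simp add: add.commute add.left_commute)
  then have "h * h * ?q ?y = h * h * ?p ?z"
    using st(5) st'(5) by (simp only:)
  then have "?q ?y = ?p ?z"
    using h by simp
  moreover have "\<bar>?p ?z - ?p x\<bar> < ?e" "\<bar>?q ?y - ?q x\<bar> < ?e"
    using d(2,4) near[of s' t' j i] near[of s t i j] st st' h by auto
  ultimately show False
    by (auto simp: abs_if split: if_splits)
qed

subsection \<open>Components and covariant derivatives\<close>

text \<open>Evaluation of a component array, read as a multilinear form, on a list of
  vectors.\<close>

primrec mev :: "('n::finite list \<Rightarrow> real) \<Rightarrow> (real^'n) list \<Rightarrow> real" where
  "mev \<phi> [] = \<phi> []"
| "mev \<phi> (v # vs) = (\<Sum>a\<in>UNIV. v $ a * mev (\<lambda>is. \<phi> (a # is)) vs)"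

text \<open>Derivation action of an endomorphism on a covariant tensor. Up to sign it is the
  correction term of the covariant derivative when \<open>M\<close> consists of Christoffel symbols,
  and the right-hand side of the Ricci identity when \<open>M\<close> is the curvature.\<close>

definition act :: "('n::finite \<Rightarrow> 'n \<Rightarrow> real) \<Rightarrow> ('n list \<Rightarrow> real) \<Rightarrow> 'n list \<Rightarrow> real" where
  "act M \<phi> is = (\<Sum>j<length is. \<Sum>e\<in>UNIV. M e (is ! j) * \<phi> (is[j := e]))"

lemma act_Nil [simp]: "act M \<phi> [] = 0"
  by (simp add: act_def)

lemma act_Cons: "act M \<phi> (a # is) = (\<Sum>e\<in>UNIV. M e a * \<phi> (e # is)) + act M (\<lambda>is. \<phi> (a # is)) is"
  by (simp add: act_def sum.lessThan_Suc_shift del: sum.lessThan_Suc)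

lemma mev_zero [simp]: "mev (\<lambda>is. 0) vs = 0"
  by (induction vs) auto

lemma mev_add: "mev (\<lambda>is. \<phi> is + \<psi> is) vs = mev \<phi> vs + mev \<psi> vs"
  by (induction vs arbitrary: \<phi> \<psi>) (auto simp: algebra_simps sum.distrib)

lemma mev_scale: "mev (\<lambda>is. c * \<phi> is) vs = c * mev \<phi> vs"
  by (induction vs arbitrary: \<phi>) (auto simp: sum_distrib_left mult.left_commute)

lemma mev_diff: "mev (\<lambda>is. \<phi> is - \<psi> is) vs = mev \<phi> vs - mev \<psi> vs"
  using mev_add[of \<phi> "\<lambda>is. - 1 * \<psi> is"] by (simp only: mev_scale) simp

lemma mev_sum: "mev (\<lambda>is. \<Sum>i\<in>I. \<phi> i is) vs = (\<Sum>i\<in>I. mev (\<phi> i) vs)"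
  by (induction I rule: infinite_finite_induct) (auto simp: mev_add)

lemma mev_cong: "(\<And>is. length is = length vs \<Longrightarrow> \<phi> is = \<psi> is) \<Longrightarrow> mev \<phi> vs = mev \<psi> vs"
proof (induction vs arbitrary: \<phi> \<psi>)
  case (Cons v vs)
  have "mev (\<lambda>is. \<phi> (a # is)) vs = mev (\<lambda>is. \<psi> (a # is)) vs" for a
    by (rule Cons.IH) (simp add: Cons.prems)
  then show ?case by simp
qed simp

text \<open>The endomorphism moves from the components to the vectors, one slot at a time; in this
  way connection and curvature terms become changes of frame vectors.\<close>

lemma mev_act:
  "mev (act M \<phi>) vs = (\<Sum>j<length vs. mev \<phi> (vs[j := (\<chi> e. \<Sum>a\<in>UNIV. M e a * (vs ! j) $ a)]))"
proof (induction vs arbitrary: \<phi>)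
  case (Cons v vs)
  let ?w = "\<lambda>v. \<chi> e. \<Sum>a\<in>UNIV. M e a * v $ a"
  have "mev (act M \<phi>) (v # vs) =
      (\<Sum>a\<in>UNIV. v $ a * (\<Sum>e\<in>UNIV. M e a * mev (\<lambda>is. \<phi> (e # is)) vs))
      + (\<Sum>a\<in>UNIV. v $ a * mev (act M (\<lambda>is. \<phi> (a # is))) vs)"
    by (simp add: act_Cons mev_add mev_sum mev_scale algebra_simps sum.distrib)
  also have "(\<Sum>a\<in>UNIV. v $ a * (\<Sum>e\<in>UNIV. M e a * mev (\<lambda>is. \<phi> (e # is)) vs)) = mev \<phi> (?w v # vs)"
    by (simp add: sum_distrib_left sum_distrib_right mult.assoc mult.left_commute)
      (subst sum.swap, simp add: mult.left_commute)
  also have "(\<Sum>a\<in>UNIV. v $ a * mev (act M (\<lambda>is. \<phi> (a # is))) vs)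
      = (\<Sum>j<length vs. mev \<phi> (v # vs[j := ?w (vs ! j)]))"
    unfolding Cons.IH by (simp add: sum_distrib_left) (rule sum.swap)
  finally show ?case
    by (simp add: sum.lessThan_Suc_shift del: mev.simps sum.lessThan_Suc)
qed simp

lemma mev_map_scale:
  "mev \<phi> (map (\<lambda>i. s i *\<^sub>R e i) I) = prod_list (map s I) * mev \<phi> (map e I)"
  by (induction I arbitrary: \<phi>) (auto simp: sum_distrib_left mult_ac)

lemma mev_append:
  "mev (\<lambda>is. \<phi> (take (length us) is) * \<psi> (drop (length us) is)) (us @ vs) = mev \<phi> us * mev \<psi> vs"
proof (induction us arbitrary: \<phi>)
  case Nil
  then show ?case by (simp add: mev_scale)
next
  case (Cons u us)
  from Cons[of "\<lambda>is. \<phi> (_ # is)"] show ?case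
    by (simp add: sum_distrib_right mult.assoc)
qed

lemma mev_has_derivative:
  assumes "\<And>is. ((\<lambda>t. \<Phi> t is) has_real_derivative \<Phi>' is) (at 0)"
    and E: "\<And>i a. ((\<lambda>t. E t i $ a) has_real_derivative E' i $ a) (at 0)"
  shows "((\<lambda>t. mev (\<Phi> t) (map (E t) I)) has_real_derivative
     mev \<Phi>' (map (E 0) I) + (\<Sum>j<length I. mev (\<Phi> 0) ((map (E 0) I)[j := E' (I ! j)]))) (at 0)"
  using assms(1)
proof (induction I arbitrary: \<Phi> \<Phi>')
  case (Cons i I)
  have "((\<lambda>t. mev (\<lambda>is. \<Phi> t (a # is)) (map (E t) I)) has_real_derivative
     mev (\<lambda>is. \<Phi>' (a # is)) (map (E 0) I)
     + (\<Sum>j<length I. mev (\<lambda>is. \<Phi> 0 (a # is)) ((map (E 0) I)[j := E' (I ! j)]))) (at 0)" for a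
    by (rule Cons.IH) (rule Cons.prems)
  then have "((\<lambda>t. mev (\<Phi> t) (map (E t) (i # I))) has_real_derivative
     (\<Sum>a\<in>UNIV. E' i $ a * mev (\<lambda>is. \<Phi> 0 (a # is)) (map (E 0) I) +
       (mev (\<lambda>is. \<Phi>' (a # is)) (map (E 0) I)
     + (\<Sum>j<length I. mev (\<lambda>is. \<Phi> 0 (a # is)) ((map (E 0) I)[j := E' (I ! j)]))) * E 0 i $ a)) (at 0)"
    unfolding list.map mev.simps by (intro DERIV_sum DERIV_mult E)
  moreover have "(\<Sum>a\<in>UNIV. (\<Sum>j<length I. mev (\<lambda>is. \<Phi> 0 (a # is)) ((map (E 0) I)[j := E' (I ! j)])) * E 0 i $ a)
     = (\<Sum>j<length I. \<Sum>a\<in>UNIV. E 0 i $ a * mev (\<lambda>is. \<Phi> 0 (a # is)) ((map (E 0) I)[j := E' (I ! j)]))"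
    by (simp add: sum_distrib_left mult.commute) (rule sum.swap)
  ultimately show ?case
    by (simp add: sum.lessThan_Suc_shift algebra_simps sum.distrib del: sum.lessThan_Suc)
qed (use assms in auto)

text \<open>Every function on index lists is allowed as a component function, of no fixed rank; this makes
  the recursion \<open>cov_Cons\<close>, which peels off one tensor index, available.\<close>

definition cov :: "'n::finite metric \<Rightarrow> 'n \<Rightarrow> 'n tensor \<Rightarrow> 'n tensor" where
  "cov g c T x is = pd c (\<lambda>y. T y is) x - act (\<lambda>e a. christoffel g x e c a) (T x) is"

lemma nabla_Cons: "nabla g T x (c # is) = cov g c T x is"
  by (simp add: nabla_def cov_def act_def Let_def)

lemma cov_Cons:
  "cov g c T x (a # is) = cov g c (\<lambda>x is. T x (a # is)) x is - (\<Sum>e\<in>UNIV. christoffel g x e c a * T x (e # is))"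
  by (simp add: cov_def act_Cons)

text \<open>The inverse metric enters with its smoothness and inverse property as assumptions, which
  an explicit inverse discharges directly, without determinants.\<close>

locale smooth_metric =
  fixes S :: "(real^'n::finite) set" and g :: "'n metric"
  assumes open_S: "open S"
    and g_smooth: "smooth_on S (\<lambda>x. g x $ a $ b)"
    and ginv_smooth: "smooth_on S (\<lambda>x. ginv g x a b)"
    and g_sym: "x \<in> S \<Longrightarrow> g x $ a $ b = g x $ b $ a"
    and ginv_sym: "x \<in> S \<Longrightarrow> ginv g x a b = ginv g x b a"
    and ginv_g: "x \<in> S \<Longrightarrow> (\<Sum>e\<in>UNIV. ginv g x a e * g x $ e $ b) = (if a = b then 1 else 0)"
begin

lemma g_ginv: "x \<in> S \<Longrightarrow> (\<Sum>e\<in>UNIV. g x $ a $ e * ginv g x e b) = (if a = b then 1 else 0)"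
  using ginv_g[of x b a] by (simp add: g_sym[of x a] ginv_sym[of x b] mult.commute)

definition smooth_tensor :: "'n tensor \<Rightarrow> bool" where
  "smooth_tensor T \<longleftrightarrow> (\<forall>is. smooth_on S (\<lambda>x. T x is))"

lemma diff_S: "smooth_on S f \<Longrightarrow> x \<in> S \<Longrightarrow> f differentiable (at x)"
  using smooth_on_imp_differentiable open_S by blast

lemma christoffel_smooth: "smooth_on S (\<lambda>x. christoffel g x a b c)"
  unfolding christoffel_def
  by (intro smooth_on_divide smooth_on_sum smooth_on_mult smooth_on_add smooth_on_diff open_S ginv_smooth
      smooth_on_pd g_smooth)

lemma pd_g_sym: "x \<in> S \<Longrightarrow> pd c (\<lambda>y. g y $ a $ b) x = pd c (\<lambda>y. g y $ b $ a) x"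
  by (rule pd_cong[OF open_S]) (auto simp: g_sym)

lemma christoffel_sym: "x \<in> S \<Longrightarrow> christoffel g x a b c = christoffel g x a c b"
  by (simp add: christoffel_def add.commute pd_g_sym[of x _ b c])

lemma pd_christoffel_sym:
  "x \<in> S \<Longrightarrow> pd d (\<lambda>y. christoffel g y a b c) x = pd d (\<lambda>y. christoffel g y a c b) x"
  by (rule pd_cong[OF open_S]) (auto simp: christoffel_sym)

lemma g_christoffel:
  assumes "x \<in> S"
  shows "(\<Sum>a\<in>UNIV. g x $ d $ a * christoffel g x a b c) =
    (pd b (\<lambda>y. g y $ d $ c) x + pd c (\<lambda>y. g y $ d $ b) x - pd d (\<lambda>y. g y $ b $ c) x) / 2"
proof -
  let ?h = "\<lambda>f. pd b (\<lambda>y. g y $ f $ c) x + pd c (\<lambda>y. g y $ f $ b) x - pd f (\<lambda>y. g y $ b $ c) x"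
  have "(\<Sum>a\<in>UNIV. g x $ d $ a * christoffel g x a b c)
      = (\<Sum>f\<in>UNIV. \<Sum>a\<in>UNIV. g x $ d $ a * ginv g x a f * ?h f) / 2"
    unfolding christoffel_def
    by (subst sum.swap) (simp add: sum_distrib_left sum_divide_distrib mult.assoc)
  also have "\<dots> = (\<Sum>f\<in>UNIV. (if d = f then 1 else 0) * ?h f) / 2"
    by (simp only: g_ginv[OF assms, symmetric] sum_distrib_right)
  finally show ?thesis
    by (simp add: if_distrib[of "\<lambda>t. t * _"] cong: if_cong)
qed

lemma pd_g:
  assumes "x \<in> S"
  shows "pd c (\<lambda>y. g y $ a $ b) x =
    (\<Sum>e\<in>UNIV. christoffel g x e c a * g x $ e $ b) + (\<Sum>e\<in>UNIV. christoffel g x e c b * g x $ a $ e)"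
proof -
  have "(\<Sum>e\<in>UNIV. christoffel g x e c a * g x $ e $ b) = (\<Sum>e\<in>UNIV. g x $ b $ e * christoffel g x e c a)"
    "(\<Sum>e\<in>UNIV. christoffel g x e c b * g x $ a $ e) = (\<Sum>e\<in>UNIV. g x $ a $ e * christoffel g x e c b)"
    using assms by (auto simp: g_sym[of x _ b] mult.commute)
  then show ?thesis
    using assms by (simp add: g_christoffel pd_g_sym[of x _ b a] pd_g_sym[of x _ c a] pd_g_sym[of x _ c b])
qed

lemma nabla_metric:
  assumes "x \<in> S"
  shows "nabla g (metric_tensor g) x [c, a, b] = 0"
  using pd_g[OF assms, of c a b] by (simp add: nabla_Cons cov_def act_Cons metric_tensor_def)

lemma smooth_cov: "smooth_tensor T \<Longrightarrow> smooth_tensor (cov g c T)"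
  unfolding smooth_tensor_def cov_def act_def
  by (intro allI smooth_on_diff smooth_on_pd smooth_on_sum smooth_on_mult christoffel_smooth open_S) auto

lemma smooth_nabla:
  assumes "smooth_tensor T"
  shows "smooth_tensor (nabla g T)"
proof -
  have "nabla g T x is = cov g (hd is) T x (tl is)" for x "is"
    by (simp add: nabla_def cov_def act_def Let_def)
  then show ?thesis
    using smooth_cov[OF assms] by (simp add: smooth_tensor_def)
qed

text \<open>Here \<open>d\<close> is a label and gets no Christoffel term. Under antisymmetrization
  in c and d the two sums with first covariant derivatives cancel each other, and the other sums
  combine to the curvature acting on the slot \<open>a\<close>.\<close>

lemma cov_cov_Cons:
  assumes T: "smooth_tensor T" and x: "x \<in> S"
  shows "cov g c (cov g d T) x (a # is) = cov g c (cov g d (\<lambda>x is. T x (a # is))) x is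
    - (\<Sum>e\<in>UNIV. pd c (\<lambda>y. christoffel g y e d a) x * T x (e # is))
    - (\<Sum>e\<in>UNIV. christoffel g x e d a * cov g c (\<lambda>x is. T x (e # is)) x is)
    - (\<Sum>e\<in>UNIV. christoffel g x e c a * cov g d (\<lambda>x is. T x (e # is)) x is)
    + (\<Sum>e\<in>UNIV. (\<Sum>f\<in>UNIV. christoffel g x e d f * christoffel g x f c a) * T x (e # is))"
proof -
  let ?T = "\<lambda>e x is. T x (e # is)" and ?G = "\<lambda>c x e a. christoffel g x e c a"
  have sm: "smooth_tensor (?T e)" for e
    using T by (simp add: smooth_tensor_def)
  have d: "(\<lambda>y. T y is) differentiable (at x)" "(\<lambda>y. christoffel g y e d f) differentiable (at x)"
    "(\<lambda>y. cov g d (?T e) y is) differentiable (at x)" for "is" e d f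
    using T smooth_cov[OF sm] christoffel_smooth x diff_S unfolding smooth_tensor_def by blast+
  have act_lin: "act M (\<lambda>is. \<phi> is - (\<Sum>e\<in>UNIV. k e * \<psi> e is)) is
      = act M \<phi> is - (\<Sum>e\<in>UNIV. k e * act M (\<psi> e) is)" for M \<phi> k and \<psi> :: "'n \<Rightarrow> 'n list \<Rightarrow> real" and "is"
    unfolding act_def
    by (simp add: algebra_simps sum_subtractf sum_distrib_left)
      (subst sum.swap, subst sum.swap[of _ "UNIV::'n set" "UNIV"], simp add: sum.swap[of _ "UNIV" "{..<_}"])
  have "cov g c (cov g d T) x (a # is) =
      pd c (\<lambda>y. cov g d (?T a) y is - (\<Sum>e\<in>UNIV. ?G d y e a * ?T e y is)) x
      - act (?G c x) (\<lambda>is. cov g d (?T a) x is - (\<Sum>e\<in>UNIV. ?G d x e a * ?T e x is)) is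
      - (\<Sum>f\<in>UNIV. ?G c x f a * (cov g d (?T f) x is - (\<Sum>e\<in>UNIV. ?G d x e f * ?T e x is)))"
    by (subst cov_Cons) (simp add: cov_def[of g c] cov_Cons)
  also have "pd c (\<lambda>y. cov g d (?T a) y is - (\<Sum>e\<in>UNIV. ?G d y e a * ?T e y is)) x
      = pd c (\<lambda>y. cov g d (?T a) y is) x - (\<Sum>e\<in>UNIV. pd c (\<lambda>y. ?G d y e a) x * ?T e x is + ?G d x e a * pd c (\<lambda>y. ?T e y is) x)"
    using d by (simp add: pd_diff pd_sum pd_mult differentiable_sum differentiable_mult)
  also have "(\<Sum>f\<in>UNIV. ?G c x f a * (cov g d (?T f) x is - (\<Sum>e\<in>UNIV. ?G d x e f * ?T e x is)))
      = (\<Sum>f\<in>UNIV. ?G c x f a * cov g d (?T f) x is)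
       - (\<Sum>e\<in>UNIV. (\<Sum>f\<in>UNIV. ?G d x e f * ?G c x f a) * ?T e x is)"
    by (simp add: right_diff_distrib sum_subtractf sum_distrib_left sum_distrib_right)
      (subst sum.swap, simp add: mult_ac)
  finally show ?thesis
    unfolding act_lin by (simp add: cov_def[of g c] algebra_simps sum.distrib sum_subtractf)
qed

lemma cov_commute:
  assumes "smooth_tensor T" and x: "x \<in> S"
  shows "cov g c (cov g d T) x is - cov g d (cov g c T) x is = - act (\<lambda>e a. riemann_up g x e a c d) (T x) is"
  using assms(1)
proof (induction "is" arbitrary: T)
  case Nil
  then show ?case
    using pd_commute[OF open_S x, of "\<lambda>x. T x []" c d] by (simp add: cov_def smooth_tensor_def)
next
  case (Cons a "is")
  have "smooth_tensor (\<lambda>x is. T x (a # is))"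
    using Cons.prems by (simp add: smooth_tensor_def)
  from Cons.IH[OF this] show ?case
    unfolding cov_cov_Cons[OF Cons.prems x] act_Cons riemann_up_def
    by (simp add: algebra_simps sum.distrib sum_subtractf sum_distrib_left sum_distrib_right)
qed

text \<open>The Christoffel term for the inner derivative index is symmetric in c and d by
  torsion-freeness, so that only the commutator of \<open>cov\<close> remains.\<close>

lemma ricci_identity:
  assumes T: "smooth_tensor T" and x: "x \<in> S"
  shows "nabla g (nabla g T) x (c # d # is) - nabla g (nabla g T) x (d # c # is)
    = - act (\<lambda>e a. riemann_up g x e a c d) (T x) is"
proof -
  have "nabla g (nabla g T) x (c # d # is)
      = cov g c (cov g d T) x is - (\<Sum>e\<in>UNIV. christoffel g x e c d * cov g e T x is)" for c d
    by (simp add: nabla_Cons cov_Cons)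
  then show ?thesis
    using cov_commute[OF assms, of c d "is"] x by (simp add: christoffel_sym[of x _ d c])
qed

section \<open>Algebraic symmetries of the Riemann tensor\<close>

lemma riemann_up_eq:
  assumes "x \<in> S"
  shows "riemann_up g x a b c d = (\<Sum>h\<in>UNIV. ginv g x a h * riemann g x h b c d)"
proof -
  have "(\<Sum>h\<in>UNIV. ginv g x a h * riemann g x h b c d)
      = (\<Sum>k\<in>UNIV. (\<Sum>h\<in>UNIV. ginv g x a h * g x $ h $ k) * riemann_up g x k b c d)"
    unfolding riemann_def sum_distrib_left sum_distrib_right by (subst sum.swap) (simp add: mult_ac)
  also have "\<dots> = riemann_up g x a b c d"
    by (simp add: ginv_g[OF assms] if_distrib[of "\<lambda>t. t * _"] cong: if_cong)
  finally show ?thesis ..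
qed

lemma riemann_smooth: "smooth_on S (\<lambda>x. riemann g x a b c d)"
  unfolding riemann_def riemann_up_def
  by (intro smooth_on_sum smooth_on_mult smooth_on_add smooth_on_diff open_S g_smooth
      smooth_on_pd christoffel_smooth)

lemma smooth_riemann: "smooth_tensor (riemann_tensor g)"
  by (simp add: smooth_tensor_def riemann_tensor_def riemann_smooth)

lemma smooth_metric_tensor: "smooth_tensor (metric_tensor g)"
  by (simp add: smooth_tensor_def metric_tensor_def g_smooth)

lemma riemann_antisym_right: "riemann g x a b d c = - riemann g x a b c d"
  by (simp add: riemann_def riemann_up_def sum_negf[symmetric] sum_subtractf algebra_simps)

lemma riemann_up_bianchi:
  "x \<in> S \<Longrightarrow> riemann_up g x a b c d + riemann_up g x a c d b + riemann_up g x a d b c = 0"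
  by (simp add: riemann_up_def sum_subtractf christoffel_sym[of x _ d b] christoffel_sym[of x _ c b]
      christoffel_sym[of x _ d c] pd_christoffel_sym[of x _ _ d b] pd_christoffel_sym[of x _ _ c b]
      pd_christoffel_sym[of x _ _ d c])

lemma riemann_bianchi:
  assumes "x \<in> S"
  shows "riemann g x a b c d + riemann g x a c d b + riemann g x a d b c = 0"
proof -
  have "riemann g x a b c d + riemann g x a c d b + riemann g x a d b c
      = (\<Sum>e\<in>UNIV. g x $ a $ e * (riemann_up g x e b c d + riemann_up g x e c d b + riemann_up g x e d b c))"
    by (simp add: riemann_def sum.distrib algebra_simps)
  then show ?thesis using assms by (simp add: riemann_up_bianchi)
qed

text \<open>The Ricci identity applied to the metric: its covariant derivatives vanish, so the
  curvature acts on it by zero.\<close>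

lemma riemann_antisym_left:
  assumes x: "x \<in> S"
  shows "riemann g x b a c d = - riemann g x a b c d"
proof -
  have "nabla g (nabla g (metric_tensor g)) x [c, d, a, b] = 0" for c d
    using pd_cong[OF open_S x, of "\<lambda>y. cov g d (metric_tensor g) y [a, b]" "\<lambda>_. 0" c] x
      nabla_metric[unfolded nabla_Cons]
    by (simp add: nabla_Cons cov_def[of g c] act_Cons)
  then have "act (\<lambda>e a. riemann_up g x e a c d) (metric_tensor g x) [a, b] = 0"
    using ricci_identity[OF smooth_metric_tensor x, of c d "[a, b]"] by simp
  then show ?thesis
    using x by (simp add: act_Cons metric_tensor_def riemann_def g_sym[of x _ b] mult.commute)
qed

text \<open>The classical combination of the cyclic identities with each of the four indices in
  front.\<close>

lemma riemann_pair_sym: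
  assumes "x \<in> S"
  shows "riemann g x c d a b = riemann g x a b c d"
  using riemann_bianchi[OF assms, of a b c d] riemann_bianchi[OF assms, of b c d a]
    riemann_bianchi[OF assms, of c d a b] riemann_bianchi[OF assms, of d a b c]
  by (simp add: riemann_antisym_left[OF assms, of b a] riemann_antisym_left[OF assms, of c b]
      riemann_antisym_left[OF assms, of c a] riemann_antisym_left[OF assms, of d a]
      riemann_antisym_left[OF assms, of d b] riemann_antisym_left[OF assms, of d c]
      riemann_antisym_right[of x _ _ b a] riemann_antisym_right[of x _ _ c a] riemann_antisym_right[of x _ _ c b]
      riemann_antisym_right[of x _ _ d a]
      riemann_antisym_right[of x _ _ d b] riemann_antisym_right[of x _ _ d c])

end

subsection \<open>Second Bianchi identity and change of frame\<close>

text \<open>Reordering the vectors does not fit the recursion of \<open>mev\<close>, but is a mere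
  reindexing of this sum.\<close>

lemma mev_eq_sum:
  "mev \<phi> vs = (\<Sum>is | length is = length vs. (\<Prod>j<length vs. (vs ! j) $ (is ! j)) * \<phi> is)"
proof (induction vs arbitrary: \<phi>)
  case (Cons v vs)
  have fin: "finite {is :: 'a list. length is = length vs}"
    using finite_lists_length_eq[of "UNIV :: 'a set" "length vs"] by simp
  have "{is :: 'a list. length is = length (v # vs)} = (\<lambda>(a, is). a # is) ` (UNIV \<times> {is. length is = length vs})"
    by (auto simp: length_Suc_conv image_iff)
  moreover have "inj_on (\<lambda>(a, is). a # is) (UNIV \<times> {is :: 'a list. length is = length vs})"
    by (auto simp: inj_on_def)
  ultimately show ?case
    using fin by (simp add: sum.reindex case_prod_beta' Cons.IH prod.lessThan_Suc_shift sum_distrib_left mult_ac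
        sum.cartesian_product' del: prod.lessThan_Suc)
qed simp

lemma mev_permute:
  assumes p: "\<pi> permutes {..<length vs}"
  shows "mev (\<lambda>is. \<phi> (permute_list \<pi> is)) vs = mev \<phi> (permute_list \<pi> vs)"
proof -
  let ?L = "{is :: 'a list. length is = length vs}"
  have inv: "permute_list \<pi> (permute_list (inv \<pi>) is) = is" "permute_list (inv \<pi>) (permute_list \<pi> is) = is"
    if "is \<in> ?L" for "is"
    using that p permute_list_compose[of \<pi> "is" "inv \<pi>"] permute_list_compose[of "inv \<pi>" "is" \<pi>]
    by (simp_all add: permutes_inv permutes_inv_o permute_list_id)
  have bij: "bij_betw (permute_list \<pi>) ?L ?L"
    by (rule bij_betw_byWitness[of _ "permute_list (inv \<pi>)"]) (auto simp: inv)
  have "(\<Prod>j<length vs. (permute_list \<pi> vs ! j) $ (permute_list \<pi> is ! j)) = (\<Prod>j<length vs. (vs ! j) $ (is ! j))"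
    if "is \<in> ?L" for "is"
  proof -
    have "(\<Prod>j<length vs. (permute_list \<pi> vs ! j) $ (permute_list \<pi> is ! j))
        = (\<Prod>j<length vs. (vs ! \<pi> j) $ (is ! \<pi> j))"
      using that p by (intro prod.cong) (auto simp: permute_list_nth)
    also have "\<dots> = (\<Prod>j<length vs. (vs ! j) $ (is ! j))"
      by (rule prod.permute[OF p, of "\<lambda>j. (vs ! j) $ (is ! j)", unfolded o_def, symmetric])
    finally show ?thesis .
  qed
  then have "mev (\<lambda>is. \<phi> (permute_list \<pi> is)) vs
      = (\<Sum>is\<in>?L. (\<Prod>j<length vs. (permute_list \<pi> vs ! j) $ (permute_list \<pi> is ! j)) * \<phi> (permute_list \<pi> is))"
    by (simp add: mev_eq_sum)
  also have "\<dots> = (\<Sum>is\<in>?L. (\<Prod>j<length vs. (permute_list \<pi> vs ! j) $ (is ! j)) * \<phi> is)"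
    by (rule sum.reindex_bij_betw[OF bij])
  finally show ?thesis by (simp add: mev_eq_sum)
qed

lemma mev_update_sum:
  assumes "j < length vs"
  shows "mev \<phi> (vs[j := (\<Sum>p\<in>P. c p *\<^sub>R w p)]) = (\<Sum>p\<in>P. c p * mev \<phi> (vs[j := w p]))"
  using assms
proof (induction vs arbitrary: j \<phi>)
  case (Cons v vs)
  show ?case
  proof (cases j)
    case 0
    then show ?thesis
      by (simp add: sum_distrib_left sum_distrib_right mult.assoc) (rule sum.swap)
  next
    case (Suc k)
    with Cons show ?thesis
      by (simp add: sum_distrib_left mult.left_commute) (rule sum.swap)
  qed
qed simp

context smooth_metric
begin

text \<open>\<open>K\<close> differentiates the curvature as an endomorphism-valued 2-form: only
  \<open>f\<close> and \<open>b\<close> get Christoffel terms. The cyclic sum is the exterior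
  covariant derivative of the curvature form. Terms cancel by type: second derivatives of
  Christoffel symbols (\<open>ddG\<close>), one derivative times a symbol (\<open>P\<close>,
  \<open>Q\<close>), and cubic terms (\<open>R\<close>).\<close>

lemma riemann_up_second_bianchi:
  assumes x: "x \<in> S"
  defines "K \<equiv> \<lambda>e f b c d. pd e (\<lambda>y. riemann_up g y f b c d) x
     + (\<Sum>h\<in>UNIV. christoffel g x f e h * riemann_up g x h b c d)
     - (\<Sum>h\<in>UNIV. christoffel g x h e b * riemann_up g x f h c d)"
  shows "K e f b c d + K c f b d e + K d f b e c = 0"
proof -
  define G where "G = christoffel g x"
  define dG where "dG e a c b = pd e (\<lambda>y. christoffel g y a c b) x" for e a c b
  define ddG where "ddG e c d = pd e (pd c (\<lambda>y. christoffel g y f d b)) x" for e c d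
  define P where "P e c d = (\<Sum>h\<in>UNIV. G f e h * dG c h d b)" for e c d
  define Q where "Q e c d = (\<Sum>h\<in>UNIV. dG c f d h * G h e b)" for e c d
  define R where "R e c d = (\<Sum>h\<in>UNIV. \<Sum>i\<in>UNIV. G f e h * (G h c i * G i d b))" for e c d
  have dd: "ddG e c d = ddG c e d" for e c d
    unfolding ddG_def by (rule pd_commute[OF open_S x christoffel_smooth])
  have d: "(\<lambda>y. christoffel g y a c b) differentiable (at x)"
    "(\<lambda>y. pd c (\<lambda>y. christoffel g y a d b) y) differentiable (at x)" for a b c d
    by (intro diff_S x smooth_on_pd christoffel_smooth)+
  have 1: "pd e (\<lambda>y. riemann_up g y f b c d) x = ddG e c d - ddG e d c + Q d e c + P c e d - Q c e d - P d e c" for e c d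
    unfolding riemann_up_def
    using d by (simp add: pd_add pd_diff pd_mult pd_sum differentiable_diff differentiable_add differentiable_sum
        differentiable_mult ddG_def P_def Q_def G_def dG_def sum.distrib sum_subtractf algebra_simps)
  have ru: "riemann_up g x a b c d = dG c a d b - dG d a c b + (\<Sum>i\<in>UNIV. G a c i * G i d b - G a d i * G i c b)" for a b c d
    by (simp add: riemann_up_def dG_def G_def)
  have 2: "(\<Sum>h\<in>UNIV. christoffel g x f e h * riemann_up g x h b c d) = P e c d - P e d c + R e c d - R e d c" for e c d
    by (simp add: ru G_def[symmetric] P_def R_def algebra_simps sum.distrib sum_subtractf sum_distrib_left)
  have R': "(\<Sum>h\<in>UNIV. \<Sum>i\<in>UNIV. G h e b * (G f c i * G i d h)) = R c d e" for e c d
    unfolding R_def by (subst sum.swap) (simp add: mult_ac)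
  have 3: "(\<Sum>h\<in>UNIV. christoffel g x h e b * riemann_up g x f h c d) = Q e c d - Q e d c + R c d e - R d c e" for e c d
    by (simp add: ru G_def[symmetric] Q_def R'[symmetric] algebra_simps sum.distrib sum_subtractf sum_distrib_left)
  show ?thesis
    unfolding K_def 1 2 3 using dd[of e c d] dd[of c d e] dd[of d e c] by simp
qed

text \<open>The derivative of the metric that arises from lowering the first index becomes, by
  metric compatibility, the Christoffel term of that index. The Christoffel terms of c, d, e cancel
  in the cyclic sum by torsion-freeness.\<close>

lemma nabla_riemann_bianchi:
  assumes x: "x \<in> S"
  shows "nabla g (riemann_tensor g) x [e, a, b, c, d] + nabla g (riemann_tensor g) x [c, a, b, d, e]
    + nabla g (riemann_tensor g) x [d, a, b, e, c] = 0"
proof -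
  let ?G = "christoffel g x" and ?R = "riemann g x" and ?U = "riemann_up g x"
  define K where "K = (\<lambda>e f b c d. pd e (\<lambda>y. riemann_up g y f b c d) x
     + (\<Sum>h\<in>UNIV. christoffel g x f e h * riemann_up g x h b c d)
     - (\<Sum>h\<in>UNIV. christoffel g x h e b * riemann_up g x f h c d))"
  have ru_smooth: "smooth_on S (\<lambda>x. riemann_up g x a b c d)" for a b c d
    unfolding riemann_up_def
    by (intro smooth_on_sum smooth_on_mult smooth_on_add smooth_on_diff open_S smooth_on_pd christoffel_smooth)
  have d: "(\<lambda>y. riemann_up g y a b c d) differentiable (at x)" "(\<lambda>y. g y $ a $ b) differentiable (at x)" for a b c d
    by (intro diff_S x ru_smooth g_smooth)+
  have n: "nabla g (riemann_tensor g) x [e, a, b, c, d] = (\<Sum>f\<in>UNIV. g x $ a $ f * K e f b c d)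
     - (\<Sum>h\<in>UNIV. ?G h e c * ?R a b h d) - (\<Sum>h\<in>UNIV. ?G h e d * ?R a b c h)" for e a b c d
  proof -
    have p: "pd e (\<lambda>y. riemann g y a b c d) x = (\<Sum>f\<in>UNIV. pd e (\<lambda>y. g y $ a $ f) x * ?U f b c d)
        + (\<Sum>f\<in>UNIV. g x $ a $ f * pd e (\<lambda>y. riemann_up g y f b c d) x)"
      unfolding riemann_def using d by (simp add: pd_sum pd_mult differentiable_mult sum.distrib)
    have q: "(\<Sum>f\<in>UNIV. pd e (\<lambda>y. g y $ a $ f) x * ?U f b c d)
        = (\<Sum>h\<in>UNIV. ?G h e a * ?R h b c d) + (\<Sum>f\<in>UNIV. g x $ a $ f * (\<Sum>h\<in>UNIV. ?G f e h * ?U h b c d))"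
      by (simp add: pd_g[OF x] riemann_def sum_distrib_left sum_distrib_right distrib_right sum.distrib)
        (subst (3) sum.swap, subst (1) sum.swap, simp add: mult_ac)
    have r: "(\<Sum>h\<in>UNIV. ?G h e b * ?R a h c d) = (\<Sum>f\<in>UNIV. g x $ a $ f * (\<Sum>h\<in>UNIV. ?G h e b * ?U f h c d))"
      unfolding riemann_def sum_distrib_left by (subst sum.swap) (simp add: mult_ac)
    have "nabla g (riemann_tensor g) x [e, a, b, c, d] = pd e (\<lambda>y. riemann g y a b c d) x
      - (\<Sum>h\<in>UNIV. ?G h e a * ?R h b c d) - (\<Sum>h\<in>UNIV. ?G h e b * ?R a h c d)
      - (\<Sum>h\<in>UNIV. ?G h e c * ?R a b h d) - (\<Sum>h\<in>UNIV. ?G h e d * ?R a b c h)"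
      by (simp add: nabla_Cons cov_def act_Cons riemann_tensor_def)
    then show ?thesis
      unfolding p q r by (simp add: K_def algebra_simps sum.distrib sum_subtractf)
  qed
  have "(\<Sum>f\<in>UNIV. g x $ a $ f * K e f b c d) + (\<Sum>f\<in>UNIV. g x $ a $ f * K c f b d e)
      + (\<Sum>f\<in>UNIV. g x $ a $ f * K d f b e c)
      = (\<Sum>f\<in>UNIV. g x $ a $ f * (K e f b c d + K c f b d e + K d f b e c))"
    by (simp add: algebra_simps sum.distrib)
  also have "\<dots> = 0"
    using riemann_up_second_bianchi[OF x] by (simp add: K_def)
  finally show ?thesis
    unfolding n
    using riemann_antisym_right[of x a b c] riemann_antisym_right[of x a b d] riemann_antisym_right[of x a b e]
      christoffel_sym[OF x]
    by (simp add: christoffel_sym[OF x, of _ d c] christoffel_sym[OF x, of _ e c] christoffel_sym[OF x, of _ e d]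
        riemann_antisym_right[of x a b _ c] riemann_antisym_right[of x a b _ d] riemann_antisym_right[of x a b _ e] sum_negf)
qed

end

lemma mev_minus: "mev (\<lambda>is. - \<phi> is) vs = - mev \<phi> vs"
  using mev_scale[of "- 1" \<phi> vs] by simp

lemma act_scale: "act (\<lambda>e a. c * M e a) \<phi> is = c * act M \<phi> is"
  by (simp add: act_def sum_distrib_left mult.assoc)

lemma act_sum: "act (\<lambda>e a. \<Sum>i\<in>I. M i e a) \<phi> is = (\<Sum>i\<in>I. act (M i) \<phi> is)"
proof (induction "is" arbitrary: \<phi>)
  case (Cons a "is")
  have "(\<Sum>e\<in>UNIV. (\<Sum>i\<in>I. M i e a) * \<phi> (e # is)) = (\<Sum>i\<in>I. \<Sum>e\<in>UNIV. M i e a * \<phi> (e # is))"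
    unfolding sum_distrib_right by (rule sum.swap)
  then show ?case by (simp add: act_Cons Cons.IH sum.distrib)
qed simp

lemma sum_mult_sum_swap:
  fixes k :: "'a \<Rightarrow> 'c::comm_semiring_0"
  shows "(\<Sum>h\<in>A. k h * (\<Sum>a\<in>B. f h a)) = (\<Sum>a\<in>B. \<Sum>h\<in>A. k h * f h a)"
  unfolding sum_distrib_left by (rule sum.swap)

section \<open>Parallel motion of frames and commutators in a frame\<close>

context smooth_metric
begin

text \<open>Right-hand side of the equation of parallel transport in direction \<open>X\<close>.
  Only the velocity at time 0 is ever used, so the equation itself is never solved.\<close>

definition parallel_velocity :: "real^'n \<Rightarrow> real^'n \<Rightarrow> real^'n \<Rightarrow> real^'n" where
  "parallel_velocity x X v = (\<chi> a. - (\<Sum>b\<in>UNIV. (\<Sum>c\<in>UNIV. X $ c * christoffel g x a c b) * v $ b))"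

text \<open>For vectors with this velocity, the terms that come from moving the arguments are
  exactly the Christoffel terms of the covariant derivative.\<close>

lemma parallel_frame_has_derivative:
  assumes T: "smooth_tensor T" and x: "x \<in> S"
    and E: "\<And>i a. ((\<lambda>t. E t i $ a) has_real_derivative parallel_velocity x X (E 0 i) $ a) (at 0)"
  shows "((\<lambda>t. mev (T (x + t *\<^sub>R X)) (map (E t) I)) has_real_derivative
     mev (nabla g T x) (X # map (E 0) I)) (at 0)"
proof -
  let ?M = "\<lambda>e a. \<Sum>c\<in>UNIV. X $ c * christoffel g x e c a"
  let ?w = "\<lambda>v. \<chi> e. \<Sum>a\<in>UNIV. ?M e a * v $ a"
  have 1: "((\<lambda>t. T (x + t *\<^sub>R X) is) has_real_derivative (\<Sum>c\<in>UNIV. X $ c * pd c (\<lambda>y. T y is) x)) (at 0)" for "is"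
    using line_has_real_derivative[of "\<lambda>y. T y is" x 0 X] diff_S[of "\<lambda>y. T y is" x] T x
    by (simp add: smooth_tensor_def)
  have "(\<Sum>j<length I. mev (T x) ((map (E 0) I)[j := parallel_velocity x X (E 0 (I ! j))]))
      = (\<Sum>j<length I. - mev (T x) ((map (E 0) I)[j := ?w (map (E 0) I ! j)]))"
  proof (rule sum.cong[OF refl])
    fix j assume "j \<in> {..<length I}"
    then have j: "j < length (map (E 0) I)" by simp
    \<comment> \<open>A sum with one term, so that \<open>mev_update_sum\<close> yields homogeneity
      in the slot j.\<close>
    have "parallel_velocity x X (E 0 (I ! j)) = (\<Sum>p\<in>{()}. (- 1) *\<^sub>R ?w (map (E 0) I ! j))"
      using j by (simp add: parallel_velocity_def vec_eq_iff)
    then show "mev (T x) ((map (E 0) I)[j := parallel_velocity x X (E 0 (I ! j))])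
        = - mev (T x) ((map (E 0) I)[j := ?w (map (E 0) I ! j)])"
      using mev_update_sum[OF j, of "T x" "\<lambda>_. - 1" "\<lambda>_. ?w (map (E 0) I ! j)" "{()}"] by simp
  qed
  also have "\<dots> = - mev (act ?M (T x)) (map (E 0) I)"
    by (simp add: mev_act sum_negf)
  finally have 2: "(\<Sum>j<length I. mev (T x) ((map (E 0) I)[j := parallel_velocity x X (E 0 (I ! j))]))
    = - mev (act ?M (T x)) (map (E 0) I)" .
  have "act ?M (T x) = (\<lambda>is. \<Sum>c\<in>UNIV. X $ c * act (\<lambda>e a. christoffel g x e c a) (T x) is)"
    by (rule ext) (simp add: act_sum act_scale)
  then have "mev (\<lambda>is. \<Sum>c\<in>UNIV. X $ c * pd c (\<lambda>y. T y is) x) (map (E 0) I) - mev (act ?M (T x)) (map (E 0) I)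
      = mev (nabla g T x) (X # map (E 0) I)"
    by (simp add: nabla_Cons cov_def mev_sum mev_scale mev_diff sum_subtractf right_diff_distrib)
  with mev_has_derivative[of "\<lambda>t is. T (x + t *\<^sub>R X) is" _ E "\<lambda>i. parallel_velocity x X (E 0 i)" I, OF 1 E]
  show ?thesis by (simp add: 2)
qed

text \<open>Phrased through \<open>mev\<close>, so that the inner product is a tensor evaluation
  like any other.\<close>

definition ip :: "real^'n \<Rightarrow> real^'n \<Rightarrow> real^'n \<Rightarrow> real" where
  "ip y v w = mev (metric_tensor g y) [v, w]"

lemma ip_eq: "ip y v w = (\<Sum>a\<in>UNIV. \<Sum>b\<in>UNIV. v $ a * w $ b * g y $ a $ b)"
  by (simp add: ip_def metric_tensor_def sum_distrib_left mult_ac)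

lemma ip_simps [simp]:
  "ip y (v + v') w = ip y v w + ip y v' w" "ip y (v - v') w = ip y v w - ip y v' w" "ip y (c *\<^sub>R v) w = c * ip y v w"
  "ip y v (w + w') = ip y v w + ip y v w'" "ip y v (w - w') = ip y v w - ip y v w'" "ip y v (c *\<^sub>R w) = c * ip y v w"
  by (simp_all add: ip_eq algebra_simps sum.distrib sum_subtractf sum_distrib_left)

lemma ip_sym: "y \<in> S \<Longrightarrow> ip y v w = ip y w v"
  unfolding ip_eq by (subst sum.swap) (simp add: g_sym[of y] mult.commute mult.left_commute)

lemma parallel_ip_has_derivative:
  assumes x: "x \<in> S"
    and E: "\<And>i a. ((\<lambda>t. E t i $ a) has_real_derivative parallel_velocity x X (E 0 i) $ a) (at 0)"
  shows "((\<lambda>t. ip (x + t *\<^sub>R X) (E t i) (E t j)) has_real_derivative 0) (at 0)"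
proof -
  have "mev (nabla g (metric_tensor g) x) (X # map (E 0) [i, j]) = mev (\<lambda>is. 0) (X # map (E 0) [i, j])"
    by (rule mev_cong) (auto simp: length_Suc_conv nabla_metric[OF x])
  then show ?thesis
    using parallel_frame_has_derivative[OF smooth_metric_tensor x, of E X "[i, j]"] E
    by (simp add: ip_def)
qed

text \<open>Expanding the curvature endomorphism in the frame by means of the inverse metric
  expresses the commutator through frame components alone, with one contracted pair p, q. In this
  form weights can be counted.\<close>

lemma ricci_identity_frame:
  assumes T: "smooth_tensor T" and x: "x \<in> S"
    and e: "\<And>a b. ginv g x a b = (\<Sum>p\<in>P. \<Sum>q\<in>P. \<eta> p q * e p $ a * e q $ b)"
  shows "mev (nabla g (nabla g T) x) (X # Y # map e I) - mev (nabla g (nabla g T) x) (Y # X # map e I)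
    = - (\<Sum>j<length I. \<Sum>p\<in>P. \<Sum>q\<in>P. \<eta> p q * mev (riemann_tensor g x) [e q, e (I ! j), X, Y] * mev (T x) (map e (I[j := p])))"
proof -
  let ?M = "\<lambda>f a. \<Sum>c\<in>UNIV. \<Sum>d\<in>UNIV. X $ c * Y $ d * riemann_up g x f a c d"
  let ?N = "nabla g (nabla g T) x"
  have "mev ?N (X # Y # map e I) - mev ?N (Y # X # map e I)
      = (\<Sum>c\<in>UNIV. \<Sum>d\<in>UNIV. X $ c * Y $ d * (mev (\<lambda>is. ?N (c # d # is)) (map e I) - mev (\<lambda>is. ?N (d # c # is)) (map e I)))"
    by (simp add: right_diff_distrib sum_subtractf sum_distrib_left mult.assoc)
      (subst (2) sum.swap, simp add: mult_ac)
  also have "\<dots> = (\<Sum>c\<in>UNIV. \<Sum>d\<in>UNIV. X $ c * Y $ d * mev (\<lambda>is. - act (\<lambda>e a. riemann_up g x e a c d) (T x) is) (map e I))"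
    by (simp add: mev_diff[symmetric] ricci_identity[OF T x])
  also have "\<dots> = - mev (act ?M (T x)) (map e I)"
  proof -
    have "act ?M (T x) = (\<lambda>is. \<Sum>c\<in>UNIV. \<Sum>d\<in>UNIV. X $ c * Y $ d * act (\<lambda>e a. riemann_up g x e a c d) (T x) is)"
      by (rule ext) (simp add: act_sum act_scale)
    then show ?thesis
      by (simp add: mev_sum mev_scale mev_minus sum_negf)
  qed
  also have "\<dots> = - (\<Sum>j<length I. mev (T x) ((map e I)[j := (\<chi> f. \<Sum>a\<in>UNIV. ?M f a * (map e I ! j) $ a)]))"
    by (simp add: mev_act)
  also have "\<dots> = - (\<Sum>j<length I. \<Sum>p\<in>P. \<Sum>q\<in>P. \<eta> p q * mev (riemann_tensor g x) [e q, e (I ! j), X, Y] * mev (T x) (map e (I[j := p])))"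
  proof (intro arg_cong[of _ _ uminus] sum.cong refl)
    fix j assume "j \<in> {..<length I}"
    then have j: "j < length (map e I)" by simp
    let ?v = "e (I ! j)"
    let ?c = "\<lambda>p. \<Sum>q\<in>P. \<eta> p q * mev (riemann_tensor g x) [e q, ?v, X, Y]"
    have "(\<chi> f. \<Sum>a\<in>UNIV. ?M f a * ?v $ a) = (\<Sum>p\<in>P. ?c p *\<^sub>R e p)"
    proof (rule vec_eq_iff[THEN iffD2], rule allI)
      fix f
      let ?r = "\<lambda>h. \<Sum>a\<in>UNIV. \<Sum>c\<in>UNIV. \<Sum>d\<in>UNIV. ?v $ a * (X $ c * (Y $ d * riemann g x h a c d))"
      have r: "mev (riemann_tensor g x) [w, ?v, X, Y] = (\<Sum>h\<in>UNIV. w $ h * ?r h)" for w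
        by (simp add: riemann_tensor_def sum_distrib_left)
      have "(\<Sum>a\<in>UNIV. ?M f a * ?v $ a) = (\<Sum>a\<in>UNIV. \<Sum>c\<in>UNIV. \<Sum>d\<in>UNIV. \<Sum>h\<in>UNIV.
          ginv g x f h * (?v $ a * (X $ c * (Y $ d * riemann g x h a c d))))"
        by (simp add: riemann_up_eq[OF x] sum_distrib_left sum_distrib_right mult_ac)
      also have "\<dots> = (\<Sum>h\<in>UNIV. ginv g x f h * ?r h)"
        by (simp only: sum_mult_sum_swap)
      also have "\<dots> = (\<Sum>h\<in>UNIV. \<Sum>p\<in>P. \<Sum>q\<in>P. \<eta> p q * e p $ f * (e q $ h * ?r h))"
        unfolding e by (simp add: sum_distrib_right mult_ac)
      also have "\<dots> = (\<Sum>p\<in>P. \<Sum>q\<in>P. \<Sum>h\<in>UNIV. \<eta> p q * e p $ f * (e q $ h * ?r h))"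
        by (subst sum.swap, rule sum.cong[OF refl], rule sum.swap)
      also have "\<dots> = (\<Sum>p\<in>P. ?c p * e p $ f)"
        unfolding r by (simp add: sum_distrib_left sum_distrib_right mult_ac)
      finally show "(\<chi> f. \<Sum>a\<in>UNIV. ?M f a * ?v $ a) $ f = (\<Sum>p\<in>P. ?c p *\<^sub>R e p) $ f"
        by simp
    qed
    then have "mev (T x) ((map e I)[j := (\<chi> f. \<Sum>a\<in>UNIV. ?M f a * (map e I ! j) $ a)])
        = (\<Sum>p\<in>P. ?c p * mev (T x) ((map e I)[j := e p]))"
      using j mev_update_sum[OF j, of "T x" ?c e P] by simp
    then show "mev (T x) ((map e I)[j := (\<chi> f. \<Sum>a\<in>UNIV. ?M f a * (map e I ! j) $ a)]) =
      (\<Sum>p\<in>P. \<Sum>q\<in>P. \<eta> p q * mev (riemann_tensor g x) [e q, e (I ! j), X, Y] * mev (T x) (map e (I[j := p])))"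
      by (simp add: sum_distrib_right map_update)
  qed
  finally show ?thesis .
qed

end

lemma matrix_inv_unique:
  fixes A B :: "'a::field^'n^'n"
  assumes "A ** B = mat 1"
  shows "matrix_inv A = B"
proof -
  have BA: "B ** A = mat 1"
    using assms matrix_left_right_inverse by blast
  then have "A ** matrix_inv A = mat 1 \<and> matrix_inv A ** A = mat 1"
    unfolding matrix_inv_def using assms
    by (intro someI[of "\<lambda>A'. A ** A' = mat 1 \<and> A' ** A = mat 1" B] conjI)
  then have "matrix_inv A = (B ** A) ** matrix_inv A"
    using BA by simp
  also have "\<dots> = B"
    using \<open>A ** matrix_inv A = mat 1 \<and> _\<close> unfolding matrix_mul_assoc[symmetric] by simp
  finally show ?thesis .
qed

subsection \<open>Adapted frames\<close>

definition eta :: "4 \<Rightarrow> 4 \<Rightarrow> real" where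
  "eta i j = (if (i, j) \<in> {(1, 2), (2, 1), (3, 4), (4, 3)} then 1 else 0)"

lemma eta_simps [simp]:
  "eta 1 1 = 0" "eta 1 2 = 1" "eta 1 3 = 0" "eta 1 4 = 0"
  "eta 2 1 = 1" "eta 2 2 = 0" "eta 2 3 = 0" "eta 2 4 = 0"
  "eta 3 1 = 0" "eta 3 2 = 0" "eta 3 3 = 0" "eta 3 4 = 1"
  "eta 4 1 = 0" "eta 4 2 = 0" "eta 4 3 = 1" "eta 4 4 = 0"
  by (simp_all add: eta_def)

text \<open>Span of \<open>\<partial>\<^sub>v\<close> and \<open>\<partial>\<^sub>V\<close> in the
  coordinates (u, v, U, V).\<close>

definition plane :: "(real^4) set" where
  "plane = {v. v $ 1 = 0 \<and> v $ 3 = 0}"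

lemma plane_scale: "v \<in> plane \<Longrightarrow> c *\<^sub>R v \<in> plane"
  and plane_add: "v \<in> plane \<Longrightarrow> w \<in> plane \<Longrightarrow> v + w \<in> plane"
  and plane_diff: "v \<in> plane \<Longrightarrow> w \<in> plane \<Longrightarrow> v - w \<in> plane"
  by (auto simp: plane_def)

locale null_plane_metric = smooth_metric S g for S and g :: "4 metric" +
  assumes plane_null: "x \<in> S \<Longrightarrow> v \<in> plane \<Longrightarrow> w \<in> plane \<Longrightarrow> ip x v w = 0"
    and plane_parallel: "x \<in> S \<Longrightarrow> v \<in> plane \<Longrightarrow> parallel_velocity x X v \<in> plane"
begin

text \<open>The basic example is \<open>e 1 = n\<close>, \<open>e 2 = \<ell>\<close>, \<open>e 3 = - m\<close>, \<open>e 4 = mt\<close>.\<close>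

definition adapted :: "real^4 \<Rightarrow> (4 \<Rightarrow> real^4) \<Rightarrow> bool" where
  "adapted x e \<longleftrightarrow> (\<forall>i j. ip x (e i) (e j) = eta i j) \<and> e 2 \<in> plane \<and> e 4 \<in> plane"

text \<open>The Gram relation \<open>E ** g x ** transpose E = H\<close>, with \<open>H\<close> its
  own inverse, exhibits \<open>transpose E ** H ** E\<close> as the inverse of the metric.\<close>

lemma adapted_ginv:
  assumes x: "x \<in> S" and e: "adapted x e"
  shows "ginv g x a b = (\<Sum>i\<in>UNIV. \<Sum>j\<in>UNIV. eta i j * e i $ a * e j $ b)"
proof -
  define E :: "real^4^4" where "E = (\<chi> i a. e i $ a)"
  define H :: "real^4^4" where "H = (\<chi> i j. eta i j)"
  have HH: "H ** H = mat 1"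
    by (simp add: H_def matrix_matrix_mult_def mat_def vec_eq_iff forall_4 sum_4)
  have "(E ** g x ** transpose E) $ i $ j = ip x (e i) (e j)" for i j
    unfolding ip_eq
    by (subst sum.swap) (simp add: E_def matrix_matrix_mult_def transpose_def sum_distrib_left sum_distrib_right mult_ac)
  then have "E ** g x ** transpose E = H"
    using e by (simp add: H_def vec_eq_iff adapted_def)
  then have "E ** (g x ** transpose E ** H) = mat 1"
    using HH by (metis matrix_mul_assoc)
  then have "(g x ** transpose E ** H) ** E = mat 1"
    using matrix_left_right_inverse by blast
  then have 1: "g x ** (transpose E ** H ** E) = mat 1"
    by (simp add: matrix_mul_assoc)
  have "ginv g x a b = (transpose E ** H ** E) $ a $ b"
    unfolding ginv_def matrix_inv_unique[OF 1] ..
  also have "\<dots> = (\<Sum>j\<in>UNIV. \<Sum>i\<in>UNIV. eta i j * e i $ a * e j $ b)"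
    by (simp add: E_def H_def matrix_matrix_mult_def transpose_def sum_distrib_right sum_distrib_left mult_ac)
  also have "\<dots> = (\<Sum>i\<in>UNIV. \<Sum>j\<in>UNIV. eta i j * e i $ a * e j $ b)"
    by (rule sum.swap)
  finally show ?thesis .
qed

text \<open>The curve is adapted for all small t but parallel only at t = 0, which suffices for
  first derivatives at 0.\<close>

definition parallel_adapted :: "real^4 \<Rightarrow> real^4 \<Rightarrow> (real \<Rightarrow> 4 \<Rightarrow> real^4) \<Rightarrow> bool" where
  "parallel_adapted x X E \<longleftrightarrow>
     (\<forall>i a. ((\<lambda>t. E t i $ a) has_real_derivative parallel_velocity x X (E 0 i) $ a) (at 0)) \<and>
     (\<forall>\<^sub>F t in nhds 0. x + t *\<^sub>R X \<in> S \<and> adapted (x + t *\<^sub>R X) (E t))"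

text \<open>Moving all four vectors linearly with the parallel velocity keeps \<open>e 2\<close>, \<open>e 4\<close> in the plane and
  preserves the inner products to first order. Correcting \<open>e 1\<close>, \<open>e 3\<close> by a Gram-Schmidt step then
  restores the inner products exactly and does not affect the first derivative.\<close>

lemma parallel_adapted_exists:
  assumes x: "x \<in> S" and e: "adapted x e"
  shows "\<exists>E. E 0 = e \<and> parallel_adapted x X E"
proof -
  define F where "F t i = e i + t *\<^sub>R parallel_velocity x X (e i)" for t i
  have F0 [simp]: "F 0 = e"
    by (simp add: F_def fun_eq_iff)
  have Fd: "((\<lambda>t. F t i $ a) has_real_derivative parallel_velocity x X (e i) $ a) (at 0)" for i a
    by (auto simp: F_def intro!: derivative_eq_intros)
  have Fplane: "F t 2 \<in> plane" "F t 4 \<in> plane" for t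
    using e plane_parallel[OF x] by (auto simp: F_def adapted_def intro!: plane_add plane_scale)
  define G where "G i j t = ip (x + t *\<^sub>R X) (F t i) (F t j)" for i j t
  have Gd [derivative_intros]: "(G i j has_real_derivative 0) (at 0)" for i j
    unfolding G_def using parallel_ip_has_derivative[OF x, of F X i j] Fd by simp
  have G0 [simp]: "G i j 0 = eta i j" for i j
    using e by (simp add: G_def adapted_def)
  \<comment> \<open>Determinant of the pairing of \<open>F t 1\<close>, \<open>F t 3\<close> with
    \<open>F t 2\<close>, \<open>F t 4\<close>. Up to sign, a, b, c, d are the entries of the
    inverse matrix, so that P and Q are dual to \<open>F t 2\<close> and
    \<open>F t 4\<close>.\<close>
  define D where "D t = G 1 2 t * G 3 4 t - G 1 4 t * G 3 2 t" for t
  have D0 [simp]: "D 0 = 1"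
    by (simp add: D_def)
  have Dd: "(D has_real_derivative 0) (at 0)"
    unfolding D_def by (auto intro!: derivative_eq_intros Gd)
  define a where "a t = G 3 4 t / D t" for t
  define b where "b t = G 1 4 t / D t" for t
  define c where "c t = G 1 2 t / D t" for t
  define d where "d t = G 3 2 t / D t" for t
  have abcd0 [simp]: "a 0 = 1" "b 0 = 0" "c 0 = 1" "d 0 = 0"
    by (simp_all add: a_def b_def c_def d_def)
  have abcd: "(a has_real_derivative 0) (at 0)" "(b has_real_derivative 0) (at 0)"
    "(c has_real_derivative 0) (at 0)" "(d has_real_derivative 0) (at 0)"
    unfolding a_def b_def c_def d_def by (auto intro!: derivative_eq_intros Gd Dd)
  define P where "P t = a t *\<^sub>R F t 1 - b t *\<^sub>R F t 3" for t
  define Q where "Q t = c t *\<^sub>R F t 3 - d t *\<^sub>R F t 1" for t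
  \<comment> \<open>Half the inner products of P and Q. Subtracting plane vectors with these
    coefficients cancels them and, the plane being null, does not disturb the pairing with the
    plane.\<close>
  define p where "p t = (a t * (a t * G 1 1 t - b t * G 1 3 t) - b t * (a t * G 3 1 t - b t * G 3 3 t)) / 2" for t
  define q where "q t = (c t * (c t * G 3 3 t - d t * G 3 1 t) - d t * (c t * G 1 3 t - d t * G 1 1 t)) / 2" for t
  define r where "r t = (a t * (c t * G 1 3 t - d t * G 1 1 t) - b t * (c t * G 3 3 t - d t * G 3 1 t)) / 2" for t
  have pqr0 [simp]: "p 0 = 0" "q 0 = 0" "r 0 = 0"
    by (simp_all add: p_def q_def r_def)
  have pqr: "(p has_real_derivative 0) (at 0)" "(q has_real_derivative 0) (at 0)" "(r has_real_derivative 0) (at 0)"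
    unfolding p_def q_def r_def by (auto intro!: derivative_eq_intros abcd Gd)
  define E where "E t i = (if i = 1 then P t - p t *\<^sub>R F t 2 - r t *\<^sub>R F t 4
     else if i = 3 then Q t - r t *\<^sub>R F t 2 - q t *\<^sub>R F t 4 else F t i)" for t i
  have E0: "E 0 = e"
    by (simp add: E_def P_def Q_def fun_eq_iff)
  have Ed: "((\<lambda>t. E t i $ k) has_real_derivative parallel_velocity x X (E 0 i) $ k) (at 0)" for i k
    unfolding E0 unfolding E_def P_def Q_def
    by (cases "i = 1"; cases "i = 3") (auto intro!: derivative_eq_intros Fd abcd pqr)
  have "isCont D 0"
    using Dd DERIV_isCont by blast
  then have "(D \<longlongrightarrow> 1) (nhds 0)"
    using tendsto_at_iff_tendsto_nhds[of D 0] by (simp add: isCont_def)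
  then have "\<forall>\<^sub>F t in nhds 0. D t \<noteq> 0"
    by (rule tendsto_imp_eventually_ne) simp
  moreover have "\<forall>\<^sub>F t in nhds 0. x + t *\<^sub>R X \<in> S"
    by (rule line_in_open[OF open_S x])
  ultimately have "\<forall>\<^sub>F t in nhds 0. x + t *\<^sub>R X \<in> S \<and> adapted (x + t *\<^sub>R X) (E t)"
  proof eventually_elim
    case (elim t)
    let ?y = "x + t *\<^sub>R X"
    have y: "?y \<in> S" and D: "D t \<noteq> 0" using elim by auto
    have G: "ip ?y (F t i) (F t j) = G i j t" for i j
      by (simp add: G_def)
    have Gs: "G j i t = G i j t" for i j
      unfolding G_def by (rule ip_sym[OF y])
    have Gp: "G 2 2 t = 0" "G 2 4 t = 0" "G 4 4 t = 0"
      unfolding G_def by (intro plane_null y Fplane)+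
    have Gp': "G 4 2 t = 0" using Gs[of 4 2] Gp by simp
    have PF: "ip ?y (P t) (F t 2) = 1" "ip ?y (P t) (F t 4) = 0" "ip ?y (Q t) (F t 2) = 0" "ip ?y (Q t) (F t 4) = 1"
      using D by (simp_all add: P_def Q_def G a_def b_def c_def d_def field_simps) (simp_all add: D_def)
    have FP: "ip ?y (F t 2) (P t) = 1" "ip ?y (F t 4) (P t) = 0" "ip ?y (F t 2) (Q t) = 0" "ip ?y (F t 4) (Q t) = 1"
      using PF by (simp_all add: ip_sym[OF y, of "F t _"])
    have PP: "ip ?y (P t) (P t) = 2 * p t" "ip ?y (Q t) (Q t) = 2 * q t" "ip ?y (P t) (Q t) = 2 * r t"
      by (simp_all add: P_def Q_def G p_def q_def r_def Gs[of 1 3] algebra_simps)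
    have QP: "ip ?y (Q t) (P t) = 2 * r t"
      using PP(3) by (simp add: ip_sym[OF y, of "Q t"])
    have "ip ?y (E t i) (E t j) = eta i j" for i j
      using exhaust_4[of i] exhaust_4[of j]
      by (elim disjE) (simp_all add: E_def PF FP PP QP G Gp Gp')
    then show ?case
      using y Fplane by (simp add: adapted_def E_def)
  qed
  with Ed E0 show ?thesis
    unfolding parallel_adapted_def by blast
qed

end

subsection \<open>Boost weights\<close>

type_synonym frame_fun = "real^4 \<Rightarrow> (4 \<Rightarrow> real^4) \<Rightarrow> 4 list \<Rightarrow> real"

definition index_weight :: "4 \<Rightarrow> int" where
  "index_weight i = (if i = 1 then 1 else if i = 2 then - 1 else 0)"

definition weight :: "4 list \<Rightarrow> int" where
  "weight I = sum_list (map index_weight I)"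

lemma weight_simps [simp]: "weight [] = 0" "weight (i # I) = index_weight i + weight I" "weight (I @ J) = weight I + weight J"
  by (simp_all add: weight_def)

lemma index_weight_simps [simp]: "index_weight 1 = 1" "index_weight 2 = - 1" "index_weight 3 = 0" "index_weight 4 = 0"
  by (simp_all add: index_weight_def)

lemma index_weight_nonneg_iff: "0 \<le> index_weight i \<longleftrightarrow> i \<noteq> 2"
  by (simp add: index_weight_def)

lemma weight_update: "j < length I \<Longrightarrow> weight (I[j := p]) = weight I - index_weight (I ! j) + index_weight p"
  by (induction I arbitrary: j) (auto split: nat.split)

definition swap_at :: "nat \<Rightarrow> 'a list \<Rightarrow> 'a list" where
  "swap_at j L = L[j := L ! Suc j, Suc j := L ! j]"

lemma length_swap_at [simp]: "length (swap_at j L) = length L"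
  by (simp add: swap_at_def)

lemma swap_at_Cons [simp]: "swap_at 0 (a # b # L) = b # a # L" "swap_at (Suc j) (a # L) = a # swap_at j L"
  by (simp_all add: swap_at_def)

lemma weight_swap_at: "Suc j < length L \<Longrightarrow> weight (swap_at j L) = weight L"
  by (simp add: swap_at_def weight_update nth_list_update)

context null_plane_metric
begin

definition frame_comp :: "4 tensor \<Rightarrow> frame_fun" where
  "frame_comp T x e I = mev (T x) (map e I)"

text \<open>In \<open>const_leading\<close> the constants \<open>c\<close> depend neither on the point nor on the frame. This is what
  makes the final multiple of the metric the same on all components of \<open>S\<close>.\<close>

definition no_leading :: "nat \<Rightarrow> frame_fun \<Rightarrow> bool" where
  "no_leading r \<phi> \<longleftrightarrow> (\<forall>x\<in>S. \<forall>e I. adapted x e \<longrightarrow> length I = r \<longrightarrow> weight I \<le> 0 \<longrightarrow> \<phi> x e I = 0)"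

definition const_leading :: "nat \<Rightarrow> frame_fun \<Rightarrow> bool" where
  "const_leading r \<phi> \<longleftrightarrow> (\<exists>c. \<forall>x\<in>S. \<forall>e I. adapted x e \<longrightarrow> length I = r \<longrightarrow>
     (weight I < 0 \<longrightarrow> \<phi> x e I = 0) \<and> (weight I = 0 \<longrightarrow> \<phi> x e I = c I))"

text \<open>\<open>\<psi>\<close> is the derivative of \<open>\<phi>\<close> along the horizontal vector fields of the bundle of adapted frames.
  For frame components of tensors this is the covariant derivative, but Leibniz' rule and the
  compatibility with contractions become trivial.\<close>

definition horizontal :: "nat \<Rightarrow> frame_fun \<Rightarrow> frame_fun \<Rightarrow> bool" where
  "horizontal r \<phi> \<psi> \<longleftrightarrow> (\<forall>x\<in>S. \<forall>E c I. adapted x (E 0) \<longrightarrow> parallel_adapted x (E 0 c) E \<longrightarrow> length I = r \<longrightarrow>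
     ((\<lambda>t. \<phi> (x + t *\<^sub>R E 0 c) (E t) I) has_real_derivative \<psi> x (E 0) (c # I)) (at 0))"

lemma horizontalI:
  assumes "\<And>x E c I. x \<in> S \<Longrightarrow> adapted x (E 0) \<Longrightarrow> parallel_adapted x (E 0 c) E \<Longrightarrow> length I = r \<Longrightarrow>
     ((\<lambda>t. \<phi> (x + t *\<^sub>R E 0 c) (E t) I) has_real_derivative \<psi> x (E 0) (c # I)) (at 0)"
  shows "horizontal r \<phi> \<psi>"
  using assms by (simp add: horizontal_def)

lemma horizontalD:
  assumes "horizontal r \<phi> \<psi>" "x \<in> S" "adapted x (E 0)" "parallel_adapted x (E 0 c) E" "length I = r"
  shows "((\<lambda>t. \<phi> (x + t *\<^sub>R E 0 c) (E t) I) has_real_derivative \<psi> x (E 0) (c # I)) (at 0)"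
  using assms by (simp add: horizontal_def)

lemma horizontal_nabla: "smooth_tensor T \<Longrightarrow> horizontal r (frame_comp T) (frame_comp (nabla g T))"
  by (rule horizontalI, unfold frame_comp_def list.map, rule parallel_frame_has_derivative)
    (simp_all add: parallel_adapted_def)

lemma parallel_adapted_eventually:
  "parallel_adapted x X E \<Longrightarrow> \<forall>\<^sub>F t in nhds 0. x + t *\<^sub>R X \<in> S \<and> adapted (x + t *\<^sub>R X) (E t)"
  by (simp add: parallel_adapted_def)

lemma horizontal_cong:
  assumes "horizontal r \<phi> \<psi>" "\<And>x e I. x \<in> S \<Longrightarrow> adapted x e \<Longrightarrow> length I = r \<Longrightarrow> \<phi> x e I = \<phi>' x e I"
  shows "horizontal r \<phi>' \<psi>"
proof (rule horizontalI)
  fix x E c I assume *: "x \<in> S" "adapted x (E 0)" "parallel_adapted x (E 0 c) E" "length (I :: 4 list) = r"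
  have "\<forall>\<^sub>F t in nhds 0. \<phi> (x + t *\<^sub>R E 0 c) (E t) I = \<phi>' (x + t *\<^sub>R E 0 c) (E t) I"
    by (rule eventually_mono[OF parallel_adapted_eventually[OF *(3)]]) (use assms(2) *(4) in blast)
  from DERIV_cong_ev[OF refl this refl] horizontalD[OF assms(1) *]
  show "((\<lambda>t. \<phi>' (x + t *\<^sub>R E 0 c) (E t) I) has_real_derivative \<psi> x (E 0) (c # I)) (at 0)"
    by (rule iffD1)
qed

text \<open>A parallel adapted curve starts at every adapted frame in every frame direction, so
  \<open>horizontal\<close> is not vacuous and fixes the derivative.\<close>

lemma horizontal_unique:
  assumes "horizontal r \<phi> \<psi>" "horizontal r \<phi> \<psi>'" "x \<in> S" "adapted x e" "length I = r"
  shows "\<psi> x e (c # I) = \<psi>' x e (c # I)"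
proof -
  obtain E where E: "E 0 = e" "parallel_adapted x (e c) E"
    using parallel_adapted_exists[OF assms(3,4)] by blast
  show ?thesis
    using DERIV_unique[OF horizontalD[OF assms(1,3), of E c I] horizontalD[OF assms(2,3), of E c I]] E assms by simp
qed

text \<open>The curve changes the point and the frame at once, so the component has to be the same
  in all adapted frames and not just at all points.\<close>

lemma horizontal_const:
  assumes "horizontal r \<phi> \<psi>" "x \<in> S" "adapted x e" "length I = r"
    and k: "\<And>x e. x \<in> S \<Longrightarrow> adapted x e \<Longrightarrow> \<phi> x e I = k"
  shows "\<psi> x e (c # I) = 0"
proof -
  obtain E where E: "E 0 = e" "parallel_adapted x (e c) E"
    using parallel_adapted_exists[OF assms(2,3)] by blast
  have "\<forall>\<^sub>F t in nhds 0. \<phi> (x + t *\<^sub>R E 0 c) (E t) I = k"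
    unfolding E(1) by (rule eventually_mono[OF parallel_adapted_eventually[OF E(2)]]) (use k in blast)
  from DERIV_cong_ev[OF refl this refl] have "((\<lambda>t. k) has_real_derivative \<psi> x e (c # I)) (at 0)"
    by (rule iffD1) (use horizontalD[OF assms(1,2), of E c I] E assms in simp)
  then show ?thesis
    using DERIV_unique[OF _ DERIV_const] by blast
qed

lemma horizontal_add:
  "horizontal r \<phi> \<phi>' \<Longrightarrow> horizontal r \<psi> \<psi>' \<Longrightarrow>
   horizontal r (\<lambda>x e I. \<phi> x e I + \<psi> x e I) (\<lambda>x e I. \<phi>' x e I + \<psi>' x e I)"
  unfolding horizontal_def by (auto intro!: derivative_intros)

lemma horizontal_scale:
  "horizontal r \<phi> \<phi>' \<Longrightarrow> horizontal r (\<lambda>x e I. k * \<phi> x e I) (\<lambda>x e I. k * \<phi>' x e I)"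
  unfolding horizontal_def by (auto intro!: DERIV_cmult)

text \<open>The indices of a product are distributed to the factors by \<open>f\<close> and \<open>h\<close>; they may also be contracted
  indices, not occurring in the product, as long as their weights cancel.\<close>

definition compatible_maps :: "nat \<Rightarrow> nat \<Rightarrow> nat \<Rightarrow> (4 list \<Rightarrow> 4 list) \<Rightarrow> (4 list \<Rightarrow> 4 list) \<Rightarrow> bool" where
  "compatible_maps m r s f h \<longleftrightarrow>
     (\<forall>I. length I = m \<longrightarrow> length (f I) = r \<and> length (h I) = s \<and> weight (f I) + weight (h I) = weight I)"

text \<open>The two Leibniz terms: the new derivative index, at the head of the list, goes to one
  factor or to the other.\<close>

lemma compatible_maps_Suc:
  assumes "compatible_maps m r s f h"
  shows "compatible_maps (Suc m) (Suc r) s (\<lambda>J. hd J # f (tl J)) (\<lambda>J. h (tl J))"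
    and "compatible_maps (Suc m) r (Suc s) (\<lambda>J. f (tl J)) (\<lambda>J. hd J # h (tl J))"
  using assms unfolding compatible_maps_def by (force simp: length_Suc_conv)+

lemma horizontal_mult:
  assumes "horizontal r \<phi> \<phi>'" "horizontal s \<psi> \<psi>'" "compatible_maps m r s f h"
  shows "horizontal m (\<lambda>x e I. \<phi> x e (f I) * \<psi> x e (h I))
    (\<lambda>x e J. \<phi>' x e (hd J # f (tl J)) * \<psi> x e (h (tl J)) + \<phi> x e (f (tl J)) * \<psi>' x e (hd J # h (tl J)))"
proof (rule horizontalI)
  fix x E c I assume *: "x \<in> S" "adapted x (E 0)" "parallel_adapted x (E 0 c) E" "length (I :: 4 list) = m"
  then have "length (f I) = r" "length (h I) = s"
    using assms(3) by (auto simp: compatible_maps_def)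
  then have "((\<lambda>t. \<phi> (x + t *\<^sub>R E 0 c) (E t) (f I) * \<psi> (x + t *\<^sub>R E 0 c) (E t) (h I)) has_real_derivative
     \<phi>' x (E 0) (c # f I) * \<psi> (x + 0 *\<^sub>R E 0 c) (E 0) (h I) + \<psi>' x (E 0) (c # h I) * \<phi> (x + 0 *\<^sub>R E 0 c) (E 0) (f I)) (at 0)"
    by (intro DERIV_mult horizontalD[OF assms(1) *(1-3)] horizontalD[OF assms(2) *(1-3)])
  then show "((\<lambda>t. \<phi> (x + t *\<^sub>R E 0 c) (E t) (f I) * \<psi> (x + t *\<^sub>R E 0 c) (E t) (h I)) has_real_derivative
     \<phi>' x (E 0) (hd (c # I) # f (tl (c # I))) * \<psi> x (E 0) (h (tl (c # I)))
     + \<phi> x (E 0) (f (tl (c # I))) * \<psi>' x (E 0) (hd (c # I) # h (tl (c # I)))) (at 0)"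
    by (simp add: mult.commute)
qed

text \<open>The first argument counts how many further derivatives are known to have no leading part.\<close>

primrec no_leading_upto :: "nat \<Rightarrow> nat \<Rightarrow> frame_fun \<Rightarrow> bool" where
  "no_leading_upto 0 r \<phi> \<longleftrightarrow> no_leading r \<phi>"
| "no_leading_upto (Suc k) r \<phi> \<longleftrightarrow> no_leading r \<phi> \<and> (\<exists>\<psi>. horizontal r \<phi> \<psi> \<and> no_leading_upto k (Suc r) \<psi>)"

text \<open>A constant leading part is allowed only at order 0, since differentiation removes
  it.\<close>

primrec const_leading_upto :: "nat \<Rightarrow> nat \<Rightarrow> frame_fun \<Rightarrow> bool" where
  "const_leading_upto 0 r \<phi> \<longleftrightarrow> const_leading r \<phi>"
| "const_leading_upto (Suc k) r \<phi> \<longleftrightarrow> const_leading r \<phi> \<and> (\<exists>\<psi>. horizontal r \<phi> \<psi> \<and> no_leading_upto k (Suc r) \<psi>)"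

lemma no_leading_imp_const_leading: "no_leading r \<phi> \<Longrightarrow> const_leading r \<phi>"
  by (force simp: no_leading_def const_leading_def intro: exI[of _ "\<lambda>_. 0"])

lemma no_leading_upto_imp_no_leading: "no_leading_upto k r \<phi> \<Longrightarrow> no_leading r \<phi>"
  by (cases k) auto

lemma const_leading_upto_imp_const_leading: "const_leading_upto k r \<phi> \<Longrightarrow> const_leading r \<phi>"
  by (cases k) auto

lemma no_leading_upto_imp_const_leading_upto: "no_leading_upto k r \<phi> \<Longrightarrow> const_leading_upto k r \<phi>"
  by (cases k) (auto intro: no_leading_imp_const_leading)

lemma const_leading_upto_imp_no_leading_upto: "const_leading_upto k r \<phi> \<Longrightarrow> no_leading r \<phi> \<Longrightarrow> no_leading_upto k r \<phi>"
  by (cases k) auto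

lemma no_leading_upto_SucD: "no_leading_upto (Suc k) r \<phi> \<Longrightarrow> no_leading_upto k r \<phi>"
proof (induction k arbitrary: r \<phi>)
  case (Suc k)
  then obtain \<psi> where "no_leading r \<phi>" "horizontal r \<phi> \<psi>" "no_leading_upto (Suc k) (Suc r) \<psi>"
    by (auto simp only: no_leading_upto.simps(2)[of "Suc k"])
  with Suc.IH show ?case by auto
qed auto

lemma const_leading_upto_SucD: "const_leading_upto (Suc k) r \<phi> \<Longrightarrow> const_leading_upto k r \<phi>"
  by (cases k) (use no_leading_upto_SucD in \<open>auto simp del: no_leading_upto.simps\<close>)

lemma no_leading_add: "no_leading r \<phi> \<Longrightarrow> no_leading r \<psi> \<Longrightarrow> no_leading r (\<lambda>x e I. \<phi> x e I + \<psi> x e I)"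
  and no_leading_scale: "no_leading r \<phi> \<Longrightarrow> no_leading r (\<lambda>x e I. k * \<phi> x e I)"
  by (auto simp: no_leading_def)

lemma const_leading_add: 
  assumes "const_leading r \<phi>" "const_leading r \<psi>"
  shows "const_leading r (\<lambda>x e I. \<phi> x e I + \<psi> x e I)"
proof -
  obtain c d where "\<forall>x\<in>S. \<forall>e I. adapted x e \<longrightarrow> length I = r \<longrightarrow>
     (weight I < 0 \<longrightarrow> \<phi> x e I = 0) \<and> (weight I = 0 \<longrightarrow> \<phi> x e I = c I)"
   "\<forall>x\<in>S. \<forall>e I. adapted x e \<longrightarrow> length I = r \<longrightarrow>
     (weight I < 0 \<longrightarrow> \<psi> x e I = 0) \<and> (weight I = 0 \<longrightarrow> \<psi> x e I = d I)"
    using assms unfolding const_leading_def by blast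
  then show ?thesis
    unfolding const_leading_def by (intro exI[of _ "\<lambda>I. c I + d I"]) simp
qed

lemma const_leading_scale: 
  assumes "const_leading r \<phi>"
  shows "const_leading r (\<lambda>x e I. k * \<phi> x e I)"
proof -
  obtain c where "\<forall>x\<in>S. \<forall>e I. adapted x e \<longrightarrow> length I = r \<longrightarrow>
     (weight I < 0 \<longrightarrow> \<phi> x e I = 0) \<and> (weight I = 0 \<longrightarrow> \<phi> x e I = c I)"
    using assms unfolding const_leading_def by blast
  then show ?thesis
    unfolding const_leading_def by (intro exI[of _ "\<lambda>I. k * c I"]) simp
qed

lemma no_leading_upto_add: "no_leading_upto k r \<phi> \<Longrightarrow> no_leading_upto k r \<psi> \<Longrightarrow> no_leading_upto k r (\<lambda>x e I. \<phi> x e I + \<psi> x e I)"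
proof (induction k arbitrary: r \<phi> \<psi>)
  case (Suc k)
  then show ?case
    by (auto intro: no_leading_add) (blast intro: horizontal_add)
qed (auto intro: no_leading_add)

lemma no_leading_upto_scale: "no_leading_upto k r \<phi> \<Longrightarrow> no_leading_upto k r (\<lambda>x e I. c * \<phi> x e I)"
proof (induction k arbitrary: r \<phi>)
  case (Suc k)
  then show ?case
    by (auto intro: no_leading_scale) (blast intro: horizontal_scale)
qed (auto intro: no_leading_scale)

lemma const_leading_upto_add: "const_leading_upto k r \<phi> \<Longrightarrow> const_leading_upto k r \<psi> \<Longrightarrow> const_leading_upto k r (\<lambda>x e I. \<phi> x e I + \<psi> x e I)"
  by (cases k) (auto intro: const_leading_add, blast intro: horizontal_add no_leading_upto_add)

lemma const_leading_upto_scale: "const_leading_upto k r \<phi> \<Longrightarrow> const_leading_upto k r (\<lambda>x e I. c * \<phi> x e I)"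
  by (cases k) (auto intro: const_leading_scale, blast intro: horizontal_scale no_leading_upto_scale)

lemma no_leading_upto_zero: "no_leading_upto k r (\<lambda>x e I. 0)"
proof (induction k arbitrary: r)
  case (Suc k)
  have "horizontal r (\<lambda>x e I. 0) (\<lambda>x e I. 0)"
    by (simp add: horizontal_def)
  with Suc show ?case by (auto simp: no_leading_def)
qed (auto simp: no_leading_def)

lemma no_leading_upto_sum: "(\<And>i. i \<in> A \<Longrightarrow> no_leading_upto k r (\<phi> i)) \<Longrightarrow> no_leading_upto k r (\<lambda>x e I. \<Sum>i\<in>A. \<phi> i x e I)"
  by (induction A rule: infinite_finite_induct) (auto simp: no_leading_upto_zero no_leading_upto_add)

lemma const_leading_upto_sum: "(\<And>i. i \<in> A \<Longrightarrow> const_leading_upto k r (\<phi> i)) \<Longrightarrow> const_leading_upto k r (\<lambda>x e I. \<Sum>i\<in>A. \<phi> i x e I)"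
  by (induction A rule: infinite_finite_induct) (auto simp: no_leading_upto_imp_const_leading_upto[OF no_leading_upto_zero] const_leading_upto_add)

lemma no_leading_upto_cong:
  assumes "\<And>x e I. x \<in> S \<Longrightarrow> adapted x e \<Longrightarrow> length I = r \<Longrightarrow> \<phi> x e I = \<phi>' x e I" "no_leading_upto k r \<phi>"
  shows "no_leading_upto k r \<phi>'"
proof -
  have "no_leading r \<phi> \<Longrightarrow> no_leading r \<phi>'"
    using assms(1) by (simp add: no_leading_def)
  moreover have "horizontal r \<phi> \<psi> \<Longrightarrow> horizontal r \<phi>' \<psi>" for \<psi>
    using assms(1) horizontal_cong by blast
  ultimately show ?thesis
    using assms(2) by (cases k) auto
qed

lemma const_leading_upto_cong:
  assumes "\<And>x e I. x \<in> S \<Longrightarrow> adapted x e \<Longrightarrow> length I = r \<Longrightarrow> \<phi> x e I = \<phi>' x e I" "const_leading_upto k r \<phi>"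
  shows "const_leading_upto k r \<phi>'"
proof -
  have "const_leading r \<phi> \<Longrightarrow> const_leading r \<phi>'"
    using assms(1) by (simp add: const_leading_def)
  moreover have "horizontal r \<phi> \<psi> \<Longrightarrow> horizontal r \<phi>' \<psi>" for \<psi>
    using assms(1) horizontal_cong by blast
  ultimately show ?thesis
    using assms(2) by (cases k) auto
qed

text \<open>If the weights add up to at most 0, either one factor has negative weight and vanishes,
  or both have weight 0 and are constant.\<close>

lemma const_leading_mult:
  assumes "const_leading r \<phi>" "const_leading s \<psi>" and fh: "compatible_maps m r s f h"
  shows "const_leading m (\<lambda>x e I. \<phi> x e (f I) * \<psi> x e (h I))"
proof -
  obtain c d where *: "\<forall>x\<in>S. \<forall>e I. adapted x e \<longrightarrow> length I = r \<longrightarrow>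
     (weight I < 0 \<longrightarrow> \<phi> x e I = 0) \<and> (weight I = 0 \<longrightarrow> \<phi> x e I = c I)"
   "\<forall>x\<in>S. \<forall>e I. adapted x e \<longrightarrow> length I = s \<longrightarrow>
     (weight I < 0 \<longrightarrow> \<psi> x e I = 0) \<and> (weight I = 0 \<longrightarrow> \<psi> x e I = d I)"
    using assms(1,2) unfolding const_leading_def by blast
  \<comment> \<open>In total weight 0, a nonzero weight of \<open>f I\<close> forces one of the two
    factors to have negative weight, hence the value 0.\<close>
  let ?k = "\<lambda>I. if weight (f I) = 0 then c (f I) * d (h I) else 0"
  have "(weight I < 0 \<longrightarrow> \<phi> x e (f I) * \<psi> x e (h I) = 0) \<and> (weight I = 0 \<longrightarrow> \<phi> x e (f I) * \<psi> x e (h I) = ?k I)"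
    if "x \<in> S" "adapted x e" "length I = m" for x e I
  proof -
    have "length (f I) = r" "length (h I) = s" and w: "weight (f I) + weight (h I) = weight I"
      using fh that by (auto simp: compatible_maps_def)
    then have \<phi>: "weight (f I) < 0 \<longrightarrow> \<phi> x e (f I) = 0" "weight (f I) = 0 \<longrightarrow> \<phi> x e (f I) = c (f I)"
      and \<psi>: "weight (h I) < 0 \<longrightarrow> \<psi> x e (h I) = 0" "weight (h I) = 0 \<longrightarrow> \<psi> x e (h I) = d (h I)"
      using * that by blast+
    consider "weight (f I) < 0" | "weight (f I) > 0" | "weight (f I) = 0" by linarith
    then show ?thesis
      by cases (use \<phi> \<psi> w in auto)
  qed
  then show ?thesis
    unfolding const_leading_def by (intro exI[of _ ?k]) blast
qed

lemma no_leading_mult: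
  assumes "const_leading r \<phi>" "no_leading s \<psi>" and fh: "compatible_maps m r s f h"
  shows "no_leading m (\<lambda>x e I. \<phi> x e (f I) * \<psi> x e (h I))"
  unfolding no_leading_def
proof (intro ballI allI impI)
  fix x e I assume I: "x \<in> S" "adapted x e" "length (I :: 4 list) = m" "weight I \<le> 0"
  have l: "length (f I) = r" "length (h I) = s" and w: "weight (f I) + weight (h I) = weight I"
    using fh I by (auto simp: compatible_maps_def)
  consider "weight (f I) < 0" | "weight (h I) \<le> 0" using w I(4) by linarith
  then show "\<phi> x e (f I) * \<psi> x e (h I) = 0"
    by cases (use assms(1,2) I l in \<open>auto simp: const_leading_def no_leading_def\<close>)
qed

lemma no_leading_upto_mult:
  "const_leading_upto k r \<phi> \<Longrightarrow> no_leading_upto k s \<psi> \<Longrightarrow> compatible_maps m r s f h \<Longrightarrow> no_leading_upto k m (\<lambda>x e I. \<phi> x e (f I) * \<psi> x e (h I))"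
proof (induction k arbitrary: r s m \<phi> \<psi> f h)
  case 0
  then show ?case by (auto intro: no_leading_mult)
next
  case (Suc k)
  obtain \<phi>' \<psi>' where *: "horizontal r \<phi> \<phi>'" "no_leading_upto k (Suc r) \<phi>'" "horizontal s \<psi> \<psi>'" "no_leading_upto k (Suc s) \<psi>'"
    using Suc.prems by auto
  have comm: "compatible_maps m r s f h \<Longrightarrow> compatible_maps m s r h f" for m r s f h
    by (auto simp: compatible_maps_def add.commute)
  note c = compatible_maps_Suc[OF Suc.prems(3)]
  \<comment> \<open>In this Leibniz term the factor \<phi>' has no leading part, so the induction
    hypothesis is used with the factors exchanged; \<psi> now serves as the one with constant
    leading part.\<close>
  have "no_leading_upto k (Suc m) (\<lambda>x e J. \<phi>' x e (hd J # f (tl J)) * \<psi> x e (h (tl J)))"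
    using Suc.IH[OF no_leading_upto_imp_const_leading_upto[OF no_leading_upto_SucD[OF Suc.prems(2)]] *(2) comm[OF c(1)]] by (simp add: mult.commute)
  moreover have "no_leading_upto k (Suc m) (\<lambda>x e J. \<phi> x e (f (tl J)) * \<psi>' x e (hd J # h (tl J)))"
    using Suc.IH[OF const_leading_upto_SucD[OF Suc.prems(1)] *(4) c(2)] .
  ultimately have "no_leading_upto k (Suc m) (\<lambda>x e J. \<phi>' x e (hd J # f (tl J)) * \<psi> x e (h (tl J)) + \<phi> x e (f (tl J)) * \<psi>' x e (hd J # h (tl J)))"
    by (rule no_leading_upto_add)
  moreover have "no_leading m (\<lambda>x e I. \<phi> x e (f I) * \<psi> x e (h I))"
    using no_leading_mult const_leading_upto_imp_const_leading no_leading_upto_imp_no_leading Suc.prems by blast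
  ultimately show ?case
    using horizontal_mult[OF *(1,3) Suc.prems(3)] by auto
qed

text \<open>Each Leibniz term contains a differentiated factor, which has no leading part, so
  constants survive only at order 0.\<close>

lemma const_leading_upto_mult:
  assumes "const_leading_upto k r \<phi>" "const_leading_upto k s \<psi>" "compatible_maps m r s f h"
  shows "const_leading_upto k m (\<lambda>x e I. \<phi> x e (f I) * \<psi> x e (h I))"
proof (cases k)
  case 0
  with assms show ?thesis by (auto intro: const_leading_mult)
next
  case (Suc k')
  obtain \<phi>' \<psi>' where *: "horizontal r \<phi> \<phi>'" "no_leading_upto k' (Suc r) \<phi>'" "horizontal s \<psi> \<psi>'" "no_leading_upto k' (Suc s) \<psi>'"
    using assms Suc by auto
  have comm: "compatible_maps m r s f h \<Longrightarrow> compatible_maps m s r h f" for m r s f h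
    by (auto simp: compatible_maps_def add.commute)
  note c = compatible_maps_Suc[OF assms(3)]
  have const_H: "const_leading_upto k' r \<phi>" "const_leading_upto k' s \<psi>"
    using assms Suc const_leading_upto_SucD by blast+
  have "no_leading_upto k' (Suc m) (\<lambda>x e J. \<phi>' x e (hd J # f (tl J)) * \<psi> x e (h (tl J)))"
    using no_leading_upto_mult[OF const_H(2) *(2) comm[OF c(1)]] by (simp add: mult.commute)
  from no_leading_upto_add[OF this no_leading_upto_mult[OF const_H(1) *(4) c(2)]]
  show ?thesis
    using horizontal_mult[OF *(1,3) assms(3)] const_leading_mult[OF _ _ assms(3)] assms const_leading_upto_imp_const_leading Suc by auto
qed

end

subsection \<open>Derivatives of the curvature\<close>

lemma length_eq_Cons2: "length J = n + 2 \<Longrightarrow> \<exists>c d I. J = c # d # I \<and> length I = n"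
  by (auto simp: length_Suc_conv numeral_2_eq_2)

lemma permute_list_explicit:
  "permute_list (Transposition.transpose 0 2 \<circ> Transposition.transpose 1 3) [a, b, c, d] = [c, d, a, b]"
  "permute_list (Transposition.transpose 0 3 \<circ> Transposition.transpose 3 4) [a, b, c, d, e] = [d, b, c, e, a]"
  "permute_list (Transposition.transpose 3 4 \<circ> Transposition.transpose 0 3) [a, b, c, d, e] = [e, b, c, a, d]"
  by (simp_all add: permute_list_def Transposition.transpose_def numeral_eq_Suc)

lemma transpose_permutes: "i < n \<Longrightarrow> j < n \<Longrightarrow> Transposition.transpose i j permutes {..<n}"
  for n :: nat by (simp add: permutes_swap_id)

context null_plane_metric
begin

abbreviation curv :: "nat \<Rightarrow> frame_fun" where
  "curv p \<equiv> frame_comp ((nabla g ^^ p) (riemann_tensor g))"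

lemma smooth_nabla_pow: "smooth_tensor ((nabla g ^^ p) (riemann_tensor g))"
  by (induction p) (auto simp: smooth_riemann smooth_nabla)

lemma horizontal_curv: "horizontal r (curv p) (curv (Suc p))"
  using horizontal_nabla[OF smooth_nabla_pow] by simp

lemma curv_pair_sym:
  assumes "x \<in> S"
  shows "curv 0 x e [a, b, c, d] = curv 0 x e [c, d, a, b]"
proof -
  let ?\<pi> = "Transposition.transpose 0 2 \<circ> Transposition.transpose 1 (3::nat)" and ?vs = "[e a, e b, e c, e d]"
  have \<pi>: "?\<pi> permutes {..<length ?vs}"
    by (intro permutes_compose transpose_permutes) auto
  have "mev (riemann_tensor g x) ?vs = mev (\<lambda>is. riemann_tensor g x (permute_list ?\<pi> is)) ?vs"
  proof (rule mev_cong)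
    fix "is" :: "4 list" assume "length is = length ?vs"
    then obtain a b c d where "is = [a, b, c, d]"
      by (auto simp: length_Suc_conv)
    then show "riemann_tensor g x is = riemann_tensor g x (permute_list ?\<pi> is)"
      using riemann_pair_sym[OF assms] by (simp only: permute_list_explicit) (simp add: riemann_tensor_def)
  qed
  then show ?thesis
    by (simp only: mev_permute[OF \<pi>] permute_list_explicit) (simp add: frame_comp_def del: mev.simps)
qed

lemma curv_second_bianchi:
  assumes x: "x \<in> S"
  shows "curv 1 x e [p, a, b, c, d] + curv 1 x e [c, a, b, d, p] + curv 1 x e [d, a, b, p, c] = 0"
proof -
  let ?\<pi> = "Transposition.transpose 0 3 \<circ> Transposition.transpose 3 (4::nat)" and ?\<rho> = "Transposition.transpose 3 4 \<circ> Transposition.transpose 0 (3::nat)"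
  let ?vs = "[e p, e a, e b, e c, e d]" and ?N = "nabla g (riemann_tensor g) x"
  have \<pi>: "?\<pi> permutes {..<length ?vs}" "?\<rho> permutes {..<length ?vs}"
    by (intro permutes_compose transpose_permutes; simp)+
  have "mev (\<lambda>is. ?N is + ?N (permute_list ?\<pi> is) + ?N (permute_list ?\<rho> is)) ?vs = mev (\<lambda>is. 0) ?vs"
  proof (rule mev_cong)
    fix "is" :: "4 list" assume "length is = length ?vs"
    then obtain p a b c d where "is = [p, a, b, c, d]"
      by (auto simp: length_Suc_conv)
    then show "?N is + ?N (permute_list ?\<pi> is) + ?N (permute_list ?\<rho> is) = 0"
      using nabla_riemann_bianchi[OF x] by (simp only: permute_list_explicit)
  qed
  then show ?thesis
    by (simp only: mev_add mev_permute[OF \<pi>(1)] mev_permute[OF \<pi>(2)] permute_list_explicit mev_zero)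
      (simp add: frame_comp_def del: mev.simps)
qed

text \<open>With the tensor indices frozen, a linear relation is the vanishing of a rank 0 function
  on all adapted frames. Differentiating it horizontally prepends one index to every term.\<close>

lemma curv_relation:
  assumes "\<And>x e. x \<in> S \<Longrightarrow> adapted x e \<Longrightarrow> (\<Sum>m<n. s m * curv p x e (f m)) = 0"
  shows "x \<in> S \<Longrightarrow> adapted x e \<Longrightarrow> (\<Sum>m<n. s m * curv (length bs + p) x e (bs @ f m)) = 0"
proof (induction bs arbitrary: x e)
  case (Cons c bs)
  let ?q = "length bs + p"
  have "horizontal 0 (\<lambda>x e I. \<Sum>m<n. s m * curv ?q x e (bs @ f m))
      (\<lambda>x e J. \<Sum>m<n. s m * curv (Suc ?q) x e (hd J # bs @ f m))"
    by (rule horizontalI) (auto intro!: DERIV_sum DERIV_cmult horizontalD[OF horizontal_curv] simp del: funpow.simps)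
  from horizontal_const[OF this Cons.prems, of "[]" 0 c] Cons.IH
  show ?case by simp
qed (use assms in simp)

lemma curv_pair_sym_append:
  assumes "x \<in> S" "adapted x e" "length bs = k"
  shows "curv k x e (bs @ [a, b, c, d]) = curv k x e (bs @ [c, d, a, b])"
proof -
  have "(\<Sum>m<Suc (Suc 0). (if m = 0 then 1 else - 1) * curv 0 x e (if m = 0 then [a, b, c, d] else [c, d, a, b])) = 0"
    if "x \<in> S" for x e
    using curv_pair_sym[OF that, of e a b c d] by simp
  from curv_relation[OF this assms(1,2), of bs] assms(3) show ?thesis
    by simp
qed

lemma curv_second_bianchi_append:
  assumes "x \<in> S" "adapted x e" "length bs = k"
  shows "curv (Suc k) x e (bs @ [p, a, b, c, d]) + curv (Suc k) x e (bs @ [c, a, b, d, p])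
    + curv (Suc k) x e (bs @ [d, a, b, p, c]) = 0"
proof -
  have "(\<Sum>m<Suc (Suc (Suc 0)). 1 * curv 1 x e (if m = 0 then [p, a, b, c, d] else if m = 1 then [c, a, b, d, p] else [d, a, b, p, c])) = 0"
    if "x \<in> S" for x e
    using curv_second_bianchi[OF that, of e p a b c d] by simp
  from curv_relation[OF this assms(1,2), of bs] assms(3) show ?thesis
    by simp
qed

lemma no_leading_upto_curv: "(\<And>i. i \<le> k \<Longrightarrow> no_leading (p + i + 4) (curv (p + i))) \<Longrightarrow> no_leading_upto k (p + 4) (curv p)"
proof (induction k arbitrary: p)
  case 0
  then show ?case by (metis no_leading_upto.simps(1) add.right_neutral le_refl)
next
  case (Suc k)
  have "no_leading_upto k (Suc p + 4) (curv (Suc p))"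
  proof (rule Suc.IH)
    fix i assume "i \<le> k"
    then show "no_leading (Suc p + i + 4) (curv (Suc p + i))"
      using Suc.prems[of "Suc i"] by simp
  qed
  moreover have "no_leading (p + 4) (curv p)"
    using Suc.prems[of 0] by simp
  ultimately show ?case
    using horizontal_curv[of "p + 4" p] by (auto simp del: funpow.simps)
qed

lemma const_leading_upto_curv:
  assumes "const_leading 4 (curv 0)" "\<And>i. 1 \<le> i \<Longrightarrow> i \<le> k \<Longrightarrow> no_leading (i + 4) (curv i)"
  shows "const_leading_upto k 4 (curv 0)"
proof (cases k)
  case 0
  with assms show ?thesis by simp
next
  case (Suc l)
  have "no_leading_upto l (1 + 4) (curv 1)"
    by (rule no_leading_upto_curv) (use assms(2)[of "Suc _"] Suc in simp)
  then show ?thesis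
    using assms(1) horizontal_curv[of 4 0] Suc by (auto simp del: funpow.simps)
qed

text \<open>Commutator of two covariant derivatives applied to the i-th derivative of the Riemann
  tensor.\<close>

definition curv_commutator :: "nat \<Rightarrow> frame_fun" where
  "curv_commutator i x e J = curv (i + 2) x e J - curv (i + 2) x e (swap_at 0 J)"

lemma curv_commutator_eq:
  assumes "x \<in> S" "adapted x e" "length J = i + 6"
  shows "curv_commutator i x e J = - (\<Sum>j<i + 4. \<Sum>p\<in>UNIV. \<Sum>q\<in>UNIV. eta p q *
      (curv 0 x e [q, J ! (j + 2), J ! 0, J ! 1] * curv i x e ((drop 2 J)[j := p])))"
proof -
  obtain c d I where J: "J = c # d # I" "length I = i + 4"
    using length_eq_Cons2[of J "i + 4"] assms by auto
  have "curv_commutator i x e J = - (\<Sum>j<length I. \<Sum>p\<in>UNIV. \<Sum>q\<in>UNIV. eta p q * mev (riemann_tensor g x) [e q, e (I ! j), e c, e d]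
       * mev ((nabla g ^^ i) (riemann_tensor g) x) (map e (I[j := p])))"
    using ricci_identity_frame[OF smooth_nabla_pow assms(1) adapted_ginv[OF assms(1,2)], of i "e c" "e d" I]
    by (simp add: curv_commutator_def frame_comp_def J del: mev.simps)
  then show ?thesis
    by (simp add: frame_comp_def J mult.assoc del: mev.simps)
qed

text \<open>The slot j hands its index to the curvature factor and receives p in exchange. Since
  \<open>eta\<close> pairs only indices of opposite weight, the two factors together still have the
  weight of \<open>J\<close>.\<close>

lemma curv_commutator_maps:
  assumes "eta p q \<noteq> 0" "j < i + 4"
  shows "compatible_maps (i + 6) 4 (i + 4) (\<lambda>J. [q, J ! (j + 2), J ! 0, J ! 1]) (\<lambda>J. (drop 2 J)[j := p])"
  unfolding compatible_maps_def
proof (intro allI impI)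
  fix J :: "4 list" assume "length J = i + 6"
  then obtain c d I where J: "J = c # d # I" "length I = i + 4"
    using length_eq_Cons2[of J "i + 4"] by auto
  have "index_weight p + index_weight q = 0"
    using assms(1) by (auto simp: eta_def split: if_splits)
  then show "length [q, J ! (j + 2), J ! 0, J ! 1] = 4 \<and> length ((drop 2 J)[j := p]) = i + 4 \<and>
      weight [q, J ! (j + 2), J ! 0, J ! 1] + weight ((drop 2 J)[j := p]) = weight J"
    using assms(2) J by (simp add: weight_update)
qed

lemma curv_commutator_no_leading_upto:
  assumes "const_leading_upto k 4 (curv 0)" "no_leading_upto k (i + 4) (curv i)"
  shows "no_leading_upto k (i + 6) (curv_commutator i)"
proof (rule no_leading_upto_cong)
  let ?t = "\<lambda>j p q x e J. curv 0 x e [q, J ! (j + 2), J ! 0, J ! 1] * curv i x e ((drop 2 J)[j := p])"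
  have t: "no_leading_upto k (i + 6) (\<lambda>x e J. eta p q * ?t j p q x e J)" if "j < i + 4" for j p q
  proof (cases "eta p q = 0")
    case False
    then show ?thesis
      by (intro no_leading_upto_scale no_leading_upto_mult[OF assms curv_commutator_maps]) (use that in auto)
  qed (simp add: no_leading_upto_zero)
  then show "no_leading_upto k (i + 6) (\<lambda>x e J. (- 1) * (\<Sum>j<i + 4. \<Sum>p\<in>UNIV. \<Sum>q\<in>UNIV. eta p q * ?t j p q x e J))"
    by (intro no_leading_upto_scale[where c = "- 1"] no_leading_upto_sum t) auto
qed (simp add: curv_commutator_eq)

lemma curv_commutator_const_leading_upto:
  assumes "const_leading_upto k 4 (curv 0)" "const_leading_upto k (i + 4) (curv i)"
  shows "const_leading_upto k (i + 6) (curv_commutator i)"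
proof (rule const_leading_upto_cong)
  let ?t = "\<lambda>j p q x e J. curv 0 x e [q, J ! (j + 2), J ! 0, J ! 1] * curv i x e ((drop 2 J)[j := p])"
  have t: "const_leading_upto k (i + 6) (\<lambda>x e J. eta p q * ?t j p q x e J)" if "j < i + 4" for j p q
  proof (cases "eta p q = 0")
    case False
    then show ?thesis
      by (intro const_leading_upto_scale const_leading_upto_mult[OF assms curv_commutator_maps]) (use that in auto)
  qed (simp add: no_leading_upto_imp_const_leading_upto[OF no_leading_upto_zero])
  then show "const_leading_upto k (i + 6) (\<lambda>x e J. (- 1) * (\<Sum>j<i + 4. \<Sum>p\<in>UNIV. \<Sum>q\<in>UNIV. eta p q * ?t j p q x e J))"
    by (intro const_leading_upto_scale[where c = "- 1"] const_leading_upto_sum t) auto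
qed (simp add: curv_commutator_eq)

lemma horizontal_swap:
  assumes "horizontal r \<phi> \<psi>"
  shows "horizontal r (\<lambda>x e L. \<phi> x e L - \<phi> x e (swap_at j L)) (\<lambda>x e L. \<psi> x e L - \<psi> x e (swap_at (Suc j) L))"
  by (rule horizontalI) (auto intro!: DERIV_diff horizontalD[OF assms])

text \<open>Differentiating the commutator j times gives the difference under exchange of the
  positions j and j + 1; each differentiation shifts the positions by one and uses up one order of
  \<open>no_leading_upto\<close>.\<close>

lemma no_leading_upto_swap:
  assumes "no_leading_upto (j + k) (i + 6) (curv_commutator i)"
  shows "no_leading_upto k (i + 6 + j) (\<lambda>x e L. curv (i + 2 + j) x e L - curv (i + 2 + j) x e (swap_at j L))"
  using assms
proof (induction j arbitrary: k)
  case 0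
  then show ?case by (simp add: curv_commutator_def[abs_def] del: funpow.simps)
next
  case (Suc j)
  let ?\<Delta> = "\<lambda>j x e L. curv (i + 2 + j) x e L - curv (i + 2 + j) x e (swap_at j L)"
  have "no_leading_upto (Suc k) (i + 6 + j) (?\<Delta> j)"
    using Suc.IH[of "Suc k"] Suc.prems by simp
  \<comment> \<open>This is only some horizontal derivative; \<open>horizontal_unique\<close>
    identifies it with the difference of components.\<close>
  then obtain \<psi> where \<psi>: "horizontal (i + 6 + j) (?\<Delta> j) \<psi>" "no_leading_upto k (Suc (i + 6 + j)) \<psi>"
    by auto
  have h: "horizontal (i + 6 + j) (?\<Delta> j) (?\<Delta> (Suc j))"
    using horizontal_swap[OF horizontal_curv[of "i + 6 + j" "i + 2 + j"]] by simp
  have "no_leading_upto k (Suc (i + 6 + j)) (?\<Delta> (Suc j))"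
  proof (rule no_leading_upto_cong[OF _ \<psi>(2)])
    fix x e and L :: "4 list" assume *: "x \<in> S" "adapted x e" "length L = Suc (i + 6 + j)"
    then obtain c I where "L = c # I" "length I = i + 6 + j"
      by (cases L) auto
    then show "\<psi> x e L = ?\<Delta> (Suc j) x e L"
      using horizontal_unique[OF \<psi>(1) h *(1,2)] by blast
  qed
  then show ?case by (simp del: funpow.simps)
qed

lemma curv_front:
  assumes x: "x \<in> S" "adapted x e" and "const_leading (k + 4) (curv k)"
    and "length L = k + 4" "weight L \<le> 0"
  shows "curv (Suc k) x e (c # L) = 0"
proof -
  obtain z where "\<And>x e. x \<in> S \<Longrightarrow> adapted x e \<Longrightarrow> curv k x e L = z"
  proof (cases "weight L < 0")
    case True
    then show ?thesis
      using assms that[of 0] unfolding const_leading_def by (auto simp del: funpow.simps)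
  next
    case False
    then obtain z where "\<And>x e. x \<in> S \<Longrightarrow> adapted x e \<Longrightarrow> curv k x e L = z L"
      using assms unfolding const_leading_def by (metis antisym_conv1 less_le_not_le linorder_not_less)
    then show ?thesis using that by blast
  qed
  from horizontal_const[OF horizontal_curv x assms(4) this] show ?thesis .
qed

end

section \<open>Changes of frame that exchange or rescale the null pairs\<close>

definition flip :: "4 \<Rightarrow> 4" where
  "flip i = (if i = 1 then 3 else if i = 2 then 4 else if i = 3 then 1 else 2)"

text \<open>A boost of the second null pair; any positive factor other than 1 would do in place of
  2.\<close>

definition stretch :: "4 \<Rightarrow> real" where
  "stretch i = (if i = 3 then 1 / 2 else if i = 4 then 2 else 1)"

lemma flip_simps [simp]: "flip 1 = 3" "flip 2 = 4" "flip 3 = 1" "flip 4 = 2"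
  by (simp_all add: flip_def)

lemma stretch_simps [simp]: "stretch 1 = 1" "stretch 2 = 1" "stretch 3 = 1 / 2" "stretch 4 = 2"
  by (simp_all add: stretch_def)

lemma flip_flip [simp]: "flip (flip i) = i"
  using exhaust_4[of i] by auto

lemma eta_flip: "eta (flip i) (flip j) = eta i j"
  using exhaust_4[of i] exhaust_4[of j] by (elim disjE) simp_all

lemma stretch_eta: "eta i j = 0 \<or> stretch j * stretch i = 1"
  using exhaust_4[of i] exhaust_4[of j] by (elim disjE) simp_all

text \<open>Flipping first makes \<open>weight\<close> count the boost of the second null pair:
  index 3 as +1, index 4 as -1.\<close>

lemma prod_stretch: "prod_list (map stretch I) = 2 powr (- real_of_int (weight (map flip I)))"
proof (induction I)
  case (Cons i I)
  have "stretch i = 2 powr (- real_of_int (index_weight (flip i)))"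
    using exhaust_4[of i] by (auto simp: powr_minus)
  then show ?case by (simp add: Cons.IH powr_add[symmetric])
qed simp

lemma nth_swap_at: "Suc j < length L \<Longrightarrow> swap_at j L ! j = L ! Suc j"
  by (simp add: swap_at_def)

context null_plane_metric
begin

lemma adapted_flip: "adapted x e \<Longrightarrow> adapted x (\<lambda>i. e (flip i))"
  by (simp add: adapted_def eta_flip)

lemma adapted_stretch: "adapted x e \<Longrightarrow> adapted x (\<lambda>i. stretch i *\<^sub>R e i)"
  by (simp add: adapted_def plane_scale stretch_eta)

lemma frame_comp_flip: "frame_comp T x (\<lambda>i. e (flip i)) I = frame_comp T x e (map flip I)"
  by (simp add: frame_comp_def o_def)

lemma frame_comp_stretch:
  "frame_comp T x (\<lambda>i. stretch i *\<^sub>R e i) I = 2 powr (- real_of_int (weight (map flip I))) * frame_comp T x e I"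
  by (simp add: frame_comp_def mev_map_scale prod_stretch)

end

section \<open>Vanishing of the curvature derivatives in weight at most 0\<close>

locale constant_leading_curvature = null_plane_metric +
  assumes riemann_const_leading: "const_leading 4 (frame_comp (riemann_tensor g))"
    and riemann_plane: "x \<in> S \<Longrightarrow> v \<in> plane \<Longrightarrow> w \<in> plane \<Longrightarrow> mev (riemann_tensor g x) [X, Y, v, w] = 0"
begin

lemma riemann_plane_indices:
  assumes "x \<in> S" "adapted x e" "(c, d) \<in> {(2, 4), (4, 2)}"
  shows "curv 0 x e [a, b, c, d] = 0"
  using riemann_plane[of x "e c" "e d" "e a" "e b"] assms
  by (auto simp: frame_comp_def adapted_def simp del: mev.simps)

text \<open>This expresses that the leading part of the curvature is that of a symmetric space. The components with neither
  derivative index 2 vanish by \<open>curv_front\<close>. Stretching \<open>e 4\<close> shows that in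
  weight 0 the indices 3 and 4 occur equally often, so exchanging the two null pairs of the frame
  gives weight 0 again and excludes all but the derivative indices \<open>{2, 4}\<close>, where the
  curvature vanishes on the plane.\<close>

lemma curv_commutator_0_no_leading:
  assumes "no_leading 5 (curv 1)"
  shows "no_leading 6 (curv_commutator 0)"
  unfolding no_leading_def
proof (intro ballI allI impI)
  fix x e J assume x: "x \<in> S" and e: "adapted x e" and J: "length (J :: 4 list) = 6" "weight J \<le> 0"
  obtain c d I where cdI: "J = c # d # I" "length I = 4"
    using length_eq_Cons2[of J 4] J by auto
  have front: "curv_commutator 0 x e (c # d # I) = 0"
    if "adapted x e" "weight (c # d # I) \<le> 0" "c \<noteq> 2" "d \<noteq> 2" "length I = 4" for e c d and I :: "4 list"
  proof -
    have index_weight: "0 \<le> index_weight c" "0 \<le> index_weight d"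
      using that by (simp_all add: index_weight_nonneg_iff)
    have "curv (Suc 1) x e (c # d # I) = 0" "curv (Suc 1) x e (d # c # I) = 0"
      by (rule curv_front[OF x that(1)]; use assms no_leading_imp_const_leading that index_weight in simp)+
    then show ?thesis by (simp add: curv_commutator_def numeral_2_eq_2)
  qed
  have "const_leading 6 (curv_commutator 0)"
    using curv_commutator_const_leading_upto[of 0 0] riemann_const_leading by simp
  then obtain k where k: "\<And>e J. adapted x e \<Longrightarrow> length J = 6 \<Longrightarrow>
     (weight J < 0 \<longrightarrow> curv_commutator 0 x e J = 0) \<and> (weight J = 0 \<longrightarrow> curv_commutator 0 x e J = k J)"
    using x unfolding const_leading_def by blast
  have flip: "curv_commutator 0 x e J = curv_commutator 0 x (\<lambda>i. e (flip i)) (map flip J)"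
    by (simp add: curv_commutator_def frame_comp_flip cdI o_def)
  show "curv_commutator 0 x e J = 0"
  proof (cases "weight J = 0")
    case False
    with k[OF e J(1)] J(2) show ?thesis by simp
  next
    case True
    show ?thesis
    proof (cases "weight (map flip J) = 0")
      case False
      have w: "weight (map flip (swap_at 0 J)) = weight (map flip J)"
        by (simp add: cdI)
      let ?r = "2 powr (- real_of_int (weight (map flip J)))"
      have "curv_commutator 0 x (\<lambda>i. stretch i *\<^sub>R e i) J = ?r * curv_commutator 0 x e J"
        by (simp only: curv_commutator_def frame_comp_stretch w right_diff_distrib)
      moreover have "curv_commutator 0 x (\<lambda>i. stretch i *\<^sub>R e i) J = curv_commutator 0 x e J"
        using k[OF e J(1)] k[OF adapted_stretch[OF e] J(1)] True by simp
      moreover have "?r \<noteq> 1"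
        using False powr_inj[of 2 "- real_of_int (weight (map flip J))" 0] by simp
      ultimately show ?thesis by simp
    next
      case w: True
      consider "c \<noteq> 2" "d \<noteq> 2" | "c \<noteq> 4" "d \<noteq> 4" | "(c, d) \<in> {(2, 4), (4, 2)}"
        using exhaust_4[of c] exhaust_4[of d] by (elim disjE) auto
      then show ?thesis
      proof cases
        case 1
        with front[OF e, of c d I] cdI J show ?thesis by simp
      next
        case 2
        then have "flip c \<noteq> 2" "flip d \<noteq> 2"
          using exhaust_4[of c] exhaust_4[of d] by auto
        with front[OF adapted_flip[OF e], of "flip c" "flip d" "map flip I"] cdI w flip show ?thesis
          by simp
      next
        case 3
        have "curv_commutator 0 x e J = - (\<Sum>j<0 + 4. \<Sum>p\<in>UNIV. \<Sum>q\<in>UNIV. eta p q *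
            (curv 0 x e [q, J ! (j + 2), J ! 0, J ! 1] * curv 0 x e ((drop 2 J)[j := p])))"
          by (rule curv_commutator_eq[OF x e]) (use J in simp)
        then show ?thesis
          using riemann_plane_indices[OF x e 3] by (simp add: cdI del: funpow.simps)
      qed
    qed
  qed
qed

text \<open>The induction is strong because exchanging two of the k + 1 derivative indices produces
  products of derivatives of several lower orders.\<close>

theorem curv_no_leading: "no_leading (Suc k + 4) (curv (Suc k))"
proof (induction k rule: less_induct)
  case (less k)
  have lead1: "no_leading (i + 4) (curv i)" if "1 \<le> i" "i \<le> k" for i
    using less[of "i - 1"] that by (simp del: funpow.simps)
  have lead0: "const_leading (k + 4) (curv k)"
  proof (cases "k = 0")
    case True
    then show ?thesis using riemann_const_leading by simp
  next
    case False
    then show ?thesis using lead1[of k] no_leading_imp_const_leading by simp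
  qed
  have const_H: "const_leading_upto l 4 (curv 0)" if "l \<le> k" for l
    using const_leading_upto_curv[of l] lead1 riemann_const_leading that by simp
  have swap: "no_leading (Suc k + 4) (\<lambda>x e L. curv (Suc k) x e L - curv (Suc k) x e (swap_at j L))"
    if "Suc j \<le> k" for j
  proof -
    \<comment> \<open>Of the k + 1 derivatives, j lie outside the exchanged pair and i
      inside.\<close>
    define i where "i = k - Suc j"
    have k: "k = i + Suc j"
      using that by (simp add: i_def)
    have "no_leading_upto j (i + 6) (curv_commutator i)"
    proof (cases "i = 0")
      case False
      show ?thesis
        by (rule curv_commutator_no_leading_upto[OF const_H no_leading_upto_curv]) (use k False in \<open>auto intro!: lead1 simp del: funpow.simps\<close>)
    next
      \<comment> \<open>The commutator acts on the curvature itself, where both factors have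
        constants in weight 0. Here k is at least 1, so the first derivative is covered by the
        induction hypothesis.\<close>
      case True
      have "const_leading_upto j (0 + 6) (curv_commutator 0)"
        using curv_commutator_const_leading_upto[of j 0] const_H[of j] k by simp
      moreover have "no_leading (0 + 6) (curv_commutator 0)"
        using curv_commutator_0_no_leading lead1[of 1] k by simp
      ultimately show ?thesis
        using const_leading_upto_imp_no_leading_upto True by simp
    qed
    then have "no_leading (i + 6 + j) (\<lambda>x e L. curv (i + 2 + j) x e L - curv (i + 2 + j) x e (swap_at j L))"
      using no_leading_upto_swap[of j 0] by (simp del: funpow.simps)
    moreover have "i + 6 + j = Suc k + 4" "i + 2 + j = Suc k"
      using k by simp_all
    ultimately show ?thesis by (simp only:)
  qed
  \<comment> \<open>An index other than 2 is exchanged step by step to the front. Dropping it there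
    leaves weight at most 0, as its own weight is nonnegative.\<close>
  have move: "curv (Suc k) x e L = 0"
    if "x \<in> S" "adapted x e" "length L = Suc k + 4" "weight L \<le> 0" "j \<le> k" "L ! j \<noteq> 2" for x e L j
    using that(3-)
  proof (induction j arbitrary: L)
    case 0
    then obtain c I where "L = c # I" by (cases L) auto
    then show ?case
      using 0 curv_front[OF that(1,2) lead0, of I c] by (simp add: index_weight_nonneg_iff[symmetric] del: funpow.simps)
  next
    case (Suc j)
    have "curv (Suc k) x e L = curv (Suc k) x e (swap_at j L)"
      using swap[of j] Suc.prems that unfolding no_leading_def by (simp del: funpow.simps)
    moreover have "curv (Suc k) x e (swap_at j L) = 0"
      by (rule Suc.IH) (use Suc.prems in \<open>auto simp: weight_swap_at nth_swap_at\<close>)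
    ultimately show ?case by simp
  qed
  show ?case
    unfolding no_leading_def
  proof (intro ballI allI impI)
    fix x e L assume x: "x \<in> S" and e: "adapted x e" and L: "length (L :: 4 list) = Suc k + 4" "weight L \<le> 0"
    show "curv (Suc k) x e L = 0"
    proof (cases "\<exists>j\<le>k. L ! j \<noteq> 2")
      case True
      with move[OF x e L] show ?thesis by blast
    next
      case False
      define bs where "bs = replicate k (2 :: 4)"
      have take: "take (Suc k) L = replicate (Suc k) 2"
        using False L by (intro nth_equalityI) (auto simp del: replicate.simps)
      have "length (drop (Suc k) L) = Suc (Suc (Suc (Suc 0)))"
        using L by simp
      then obtain a b c d where "drop (Suc k) L = [a, b, c, d]"
        unfolding length_Suc_conv length_0_conv by blast
      then have L_eq: "L = bs @ [2, a, b, c, d]"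
        using take append_take_drop_id[of "Suc k" L] by (simp add: bs_def replicate_append_same[symmetric])
      have bs: "length bs = k" "weight bs = - int k"
        by (simp_all add: bs_def weight_def sum_list_replicate)
      \<comment> \<open>The second Bianchi identity trades the innermost derivative index 2 for c or
        d, which then stands in position k and differs from 2.\<close>
      have bianchi: "curv (Suc k) x e (bs @ [2, a, b, c, d]) = 0"
        if "c \<noteq> 2" "d \<noteq> 2" "weight (bs @ [2, a, b, c, d]) \<le> 0" for a b c d
      proof -
        have "curv (Suc k) x e (bs @ [c, a, b, d, 2]) = 0" "curv (Suc k) x e (bs @ [d, a, b, 2, c]) = 0"
          by (rule move[OF x e, of _ k]; use that bs in \<open>simp add: nth_append\<close>)+
        then show ?thesis
          using curv_second_bianchi_append[OF x e bs(1), of 2 a b c d] by simp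
      qed
      consider "c \<noteq> 2" "d \<noteq> 2" | "a \<noteq> 2" "b \<noteq> 2" | "a = 2 \<or> b = 2" "c = 2 \<or> d = 2" by blast
      then show ?thesis
      proof cases
        case 1
        with bianchi L L_eq show ?thesis by simp
      next
        case 2
        then show ?thesis
          using curv_pair_sym_append[OF x e, of "bs @ [2]" "Suc k" a b c d]
            bianchi[where a = c and b = d and c = a and d = b] bs L by (simp add: L_eq del: funpow.simps)
      next
        case 3
        \<comment> \<open>Each pair contains a 2 and so has weight at most 0. Hence the indices
          behind the outermost derivative have weight at most 0, although that derivative is along
          \<open>e 2\<close>.\<close>
        have L2: "L = 2 # bs @ [a, b, c, d]"
          by (simp add: L_eq bs_def replicate_app_Cons_same)
        have "index_weight a + index_weight b \<le> 0" "index_weight c + index_weight d \<le> 0"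
          using 3 by (auto simp: index_weight_def)
        then show ?thesis
          using curv_front[OF x e lead0, of "bs @ [a, b, c, d]" 2] bs by (simp add: L2 del: funpow.simps)
      qed
    qed
  qed
qed

end

subsection \<open>Tensors constructed from the curvature\<close>

lemma sum_swap4:
  "(\<Sum>a\<in>A. \<Sum>b\<in>B. \<Sum>p\<in>P. \<Sum>q\<in>Q. f a b p q) = (\<Sum>p\<in>P. \<Sum>q\<in>Q. \<Sum>a\<in>A. \<Sum>b\<in>B. f a b p q)"
proof -
  have "(\<Sum>b\<in>B. \<Sum>p\<in>P. \<Sum>q\<in>Q. f a b p q) = (\<Sum>p\<in>P. \<Sum>q\<in>Q. \<Sum>b\<in>B. f a b p q)" for a
    by (subst sum.swap) (rule sum.cong[OF refl], rule sum.swap)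
  then have "(\<Sum>a\<in>A. \<Sum>b\<in>B. \<Sum>p\<in>P. \<Sum>q\<in>Q. f a b p q) = (\<Sum>a\<in>A. \<Sum>p\<in>P. \<Sum>q\<in>Q. \<Sum>b\<in>B. f a b p q)"
    by simp
  also have "\<dots> = (\<Sum>p\<in>P. \<Sum>q\<in>Q. \<Sum>a\<in>A. \<Sum>b\<in>B. f a b p q)"
    by (subst sum.swap) (rule sum.cong[OF refl], rule sum.swap)
  finally show ?thesis .
qed

context null_plane_metric
begin

lemma const_leading_map:
  assumes "const_leading s \<phi>" "\<And>I. length I = r \<Longrightarrow> length (f I) = s \<and> weight (f I) = weight I"
  shows "const_leading r (\<lambda>x e I. \<phi> x e (f I))"
proof -
  obtain c where "\<forall>x\<in>S. \<forall>e I. adapted x e \<longrightarrow> length I = s \<longrightarrow>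
     (weight I < 0 \<longrightarrow> \<phi> x e I = 0) \<and> (weight I = 0 \<longrightarrow> \<phi> x e I = c I)"
    using assms unfolding const_leading_def by blast
  then show ?thesis
    using assms(2) unfolding const_leading_def by (intro exI[of _ "\<lambda>I. c (f I)"]) auto
qed

lemma const_leading_cong:
  assumes "const_leading r \<phi>" "\<And>x e I. x \<in> S \<Longrightarrow> adapted x e \<Longrightarrow> length I = r \<Longrightarrow> \<phi>' x e I = \<phi> x e I"
  shows "const_leading r \<phi>'"
  using assms const_leading_upto_cong[of r \<phi> \<phi>' 0] by auto

lemma const_leading_sum:
  "(\<And>i. i \<in> A \<Longrightarrow> const_leading r (\<phi> i)) \<Longrightarrow> const_leading r (\<lambda>x e I. \<Sum>i\<in>A. \<phi> i x e I)"
  using const_leading_upto_sum[of A 0] by simp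

lemma frame_comp_metric: "adapted x e \<Longrightarrow> frame_comp (metric_tensor g) x e [i, j] = eta i j"
  unfolding adapted_def frame_comp_def ip_def by simp

lemma const_leading_metric: "const_leading 2 (frame_comp (metric_tensor g))"
  unfolding const_leading_def
proof (intro exI ballI allI impI)
  fix x e and I :: "4 list"
  assume *: "adapted x e" "length I = 2"
  then obtain i j where I: "I = [i, j]"
    by (auto simp: length_Suc_conv numeral_2_eq_2)
  have "index_weight i + index_weight j = 0" if "eta i j \<noteq> 0"
    using that by (auto simp: eta_def split: if_splits)
  then show "(weight I < 0 \<longrightarrow> frame_comp (metric_tensor g) x e I = 0)
    \<and> (weight I = 0 \<longrightarrow> frame_comp (metric_tensor g) x e I = eta (I ! 0) (I ! 1))"
    using * by (cases "eta i j = 0") (auto simp: I frame_comp_metric)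
qed

lemma frame_comp_product:
  assumes "length I = r + s"
  shows "frame_comp (\<lambda>x is. T x (take r is) * U x (drop r is)) x e I
    = frame_comp T x e (take r I) * frame_comp U x e (drop r I)"
proof -
  have "map e I = map e (take r I) @ map e (drop r I)"
    by (simp flip: map_append)
  then show ?thesis
    using assms mev_append[of "T x" "map e (take r I)" "U x" "map e (drop r I)"]
    by (simp add: frame_comp_def)
qed

lemma frame_comp_permute:
  assumes "\<pi> permutes {..<length I}"
  shows "frame_comp (\<lambda>x is. T x (permute_list \<pi> is)) x e I = frame_comp T x e (permute_list \<pi> I)"
  using mev_permute[of \<pi> "map e I" "T x"] assms by (simp add: frame_comp_def permute_list_map)

lemma frame_comp_contract:
  assumes "x \<in> S" "adapted x e"
  shows "frame_comp (\<lambda>x is. \<Sum>a\<in>UNIV. \<Sum>b\<in>UNIV. ginv g x a b * T x (a # b # is)) x e I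
    = (\<Sum>p\<in>UNIV. \<Sum>q\<in>UNIV. eta p q * frame_comp T x e (p # q # I))"
proof -
  let ?M = "\<lambda>a b. mev (\<lambda>is. T x (a # b # is)) (map e I)"
  have "frame_comp (\<lambda>x is. \<Sum>a\<in>UNIV. \<Sum>b\<in>UNIV. ginv g x a b * T x (a # b # is)) x e I
      = (\<Sum>a\<in>UNIV. \<Sum>b\<in>UNIV. ginv g x a b * ?M a b)"
    by (simp add: frame_comp_def mev_sum mev_scale)
  also have "\<dots> = (\<Sum>a\<in>UNIV. \<Sum>b\<in>UNIV. \<Sum>p\<in>UNIV. \<Sum>q\<in>UNIV. eta p q * (e p $ a * (e q $ b * ?M a b)))"
    by (simp add: adapted_ginv[OF assms] sum_distrib_right mult.assoc)
  also have "\<dots> = (\<Sum>p\<in>UNIV. \<Sum>q\<in>UNIV. \<Sum>a\<in>UNIV. \<Sum>b\<in>UNIV. eta p q * (e p $ a * (e q $ b * ?M a b)))"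
    by (rule sum_swap4)
  also have "\<dots> = (\<Sum>p\<in>UNIV. \<Sum>q\<in>UNIV. eta p q * frame_comp T x e (p # q # I))"
    by (simp add: frame_comp_def sum_distrib_left)
  finally show ?thesis .
qed

lemma weight_permute_list: "\<pi> permutes {..<length I} \<Longrightarrow> weight (permute_list \<pi> I) = weight I"
  unfolding weight_def by (metis mset_map mset_permute_list sum_mset_sum_list)

section \<open>Symmetric tensors of rank 2 with constant leading part\<close>

lemma mev_symmetric:
  assumes "\<And>a b. T [a, b] = T [b, a]"
  shows "mev T [v, w] = mev T [w, v]"
proof -
  have "mev T [v, w] = (\<Sum>a\<in>UNIV. \<Sum>b\<in>UNIV. v $ a * w $ b * T [b, a])"
    by (simp add: sum_distrib_left mult.assoc assms)
  also have "\<dots> = mev T [w, v]"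
    by (subst sum.swap) (simp add: sum_distrib_left mult_ac)
  finally show ?thesis .
qed

lemma adapted_spans:
  assumes x: "x \<in> S" and e: "adapted x e"
  shows "v = (\<Sum>i\<in>UNIV. (\<Sum>j\<in>UNIV. eta i j * ip x (e j) v) *\<^sub>R e i)"
proof (rule vec_eq_iff[THEN iffD2], rule allI)
  fix c
  define u where "u f = (\<Sum>h\<in>UNIV. g x $ f $ h * v $ h)" for f
  have ip: "ip x w v = (\<Sum>f\<in>UNIV. w $ f * u f)" for w
    by (simp add: ip_eq u_def sum_distrib_left mult_ac)
  have "v $ c = (\<Sum>h\<in>UNIV. (\<Sum>f\<in>UNIV. ginv g x c f * g x $ f $ h) * v $ h)"
    using ginv_g[OF x, of c] by (simp add: if_distrib[of "\<lambda>t. t * _"] cong: if_cong)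
  also have "\<dots> = (\<Sum>f\<in>UNIV. ginv g x c f * u f)"
    unfolding u_def sum_distrib_left sum_distrib_right by (subst sum.swap) (simp add: mult.assoc)
  also have "\<dots> = (\<Sum>i\<in>UNIV. (\<Sum>j\<in>UNIV. eta i j * (\<Sum>f\<in>UNIV. e j $ f * u f)) * e i $ c)"
    unfolding adapted_ginv[OF assms] by (simp add: sum_4 algebra_simps)
  finally show "v $ c = (\<Sum>i\<in>UNIV. (\<Sum>j\<in>UNIV. eta i j * ip x (e j) v) *\<^sub>R e i) $ c"
    by (simp add: ip)
qed

lemma tensor2_eqI:
  assumes x: "x \<in> S" and e: "adapted x e" and "\<And>i j. frame_comp T x e [i, j] = frame_comp U x e [i, j]"
  shows "T x [a, b] = U x [a, b]"
proof -
  have axis: "mev \<phi> [axis a 1, axis b 1] = \<phi> [a, b]" for \<phi> :: "4 list \<Rightarrow> real" and a b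
    by (simp add: axis_def if_distrib[of "\<lambda>t. t * _"] cong: if_cong)
  define k where "k a i = (\<Sum>j\<in>UNIV. eta i j * ip x (e j) (axis a 1))" for a i
  have ax: "(axis a 1 :: real^4) = (\<Sum>i\<in>UNIV. k a i *\<^sub>R e i)" for a
    unfolding k_def by (rule adapted_spans[OF x e])
  have "mev \<phi> [axis a 1, axis b 1] = (\<Sum>i\<in>UNIV. k a i * (\<Sum>j\<in>UNIV. k b j * mev \<phi> [e i, e j]))" for \<phi>
  proof -
    have "mev \<phi> [e i, axis b 1] = (\<Sum>j\<in>UNIV. k b j * mev \<phi> [e i, e j])" for i
      using mev_update_sum[of 1 "[e i, axis b 1]" \<phi> "k b" e UNIV] by (simp add: ax[of b] del: mev.simps)
    then show ?thesis
      using mev_update_sum[of 0 "[axis a 1, axis b 1]" \<phi> "k a" e UNIV] by (simp add: ax[of a] del: mev.simps)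
  qed
  from this[of "T x"] this[of "U x"] assms(3) show ?thesis
    unfolding axis by (simp add: frame_comp_def)
qed

lemma mev_pair_add: "mev \<phi> [v + w, v + w] = mev \<phi> [v, v] + mev \<phi> [v, w] + mev \<phi> [w, v] + mev \<phi> [w, w]"
  by (simp add: algebra_simps sum.distrib sum_distrib_left)

text \<open>A shear of the plane with the dual shear of \<open>e 1\<close>, \<open>e 3\<close>. It
  serves to reach the component 1 3, which has weight 1 even after exchanging the null
  pairs.\<close>

lemma adapted_mix:
  assumes x: "x \<in> S" and "adapted x e"
  shows "adapted x (e(2 := e 2 - e 4, 3 := e 1 + e 3))" (is "adapted x ?e")
proof -
  have "ip x (?e i) (?e j) = eta i j" for i j
    using assms exhaust_4[of i] exhaust_4[of j]
    by (elim disjE) (simp_all add: adapted_def)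
  then show ?thesis
    using assms by (simp add: adapted_def plane_diff)
qed

lemma const_leading_symmetric_imp_metric:
  assumes T: "const_leading 2 (frame_comp T)" and sym: "symmetric_on S T"
    and ex: "\<And>x. x \<in> S \<Longrightarrow> \<exists>e. adapted x e"
  shows "\<exists>c. \<forall>x\<in>S. \<forall>a b. T x [a, b] = c * g x $ a $ b"
proof -
  obtain k where k: "\<And>x e I. x \<in> S \<Longrightarrow> adapted x e \<Longrightarrow> length I = 2 \<Longrightarrow>
      (weight I < 0 \<longrightarrow> frame_comp T x e I = 0) \<and> (weight I = 0 \<longrightarrow> frame_comp T x e I = k I)"
    using T unfolding const_leading_def by blast
  define c where "c = k [2, 1]"
  have "T x [a, b] = c * g x $ a $ b" if x: "x \<in> S" for x a b
  proof -
    have s: "frame_comp T x e [i, j] = frame_comp T x e [j, i]" for e i j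
      using mev_symmetric[of "T x" "e i" "e j"] sym x by (simp add: frame_comp_def symmetric_on_def)
    have neg: "frame_comp T x e [2, 2] = 0" "frame_comp T x e [2, 3] = 0" "frame_comp T x e [2, 4] = 0"
        "frame_comp T x e [2, 1] = c" if "adapted x e" for e
      using k[OF x that, of "[2, _]"] by (simp_all add: c_def)
    \<comment> \<open>Weight 0 makes the component the same in the stretched frame, while stretching
      multiplies it by 1/4.\<close>
    have t33: "frame_comp T x e [3, 3] = 0" if e: "adapted x e" for e
    proof -
      have "frame_comp T x (\<lambda>i. stretch i *\<^sub>R e i) [3, 3] = frame_comp T x e [3, 3]"
        using k[OF x e, of "[3, 3]"] k[OF x adapted_stretch[OF e], of "[3, 3]"] by simp
      then show ?thesis
        by (simp add: frame_comp_stretch powr_minus powr_numeral)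
    qed
    have flip: "frame_comp T x e [flip i, flip j] = frame_comp T x (\<lambda>i. e (flip i)) [i, j]" for e i j
      by (simp add: frame_comp_flip)
    \<comment> \<open>Exchanging the null pairs carries over what is known for 2 2, 2 3, 2 1 and 3
      3. The component 4 3 gets the same c as 2 1, because c does not depend on the frame.\<close>
    have rest: "frame_comp T x e [4, 4] = 0" "frame_comp T x e [4, 1] = 0" "frame_comp T x e [4, 3] = c"
       "frame_comp T x e [1, 1] = 0" if "adapted x e" for e
      using flip[of e 2 2] flip[of e 2 3] flip[of e 2 1] flip[of e 3 3] neg[OF adapted_flip[OF that]]
        t33[OF adapted_flip[OF that]] by simp_all
    obtain e where e: "adapted x e"
      using ex[OF x] by blast
    \<comment> \<open>The component 3 3 in the mixed frame, to be polarized.\<close>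
    have "mev (T x) [e 1 + e 3, e 1 + e 3] = 0"
      using t33[OF adapted_mix[OF x e]] by (simp add: frame_comp_def)
    then have "frame_comp T x e [1, 3] + frame_comp T x e [3, 1] = 0"
      using t33[OF e] rest(4)[OF e] unfolding mev_pair_add by (simp add: frame_comp_def del: mev.simps)
    then have t13: "frame_comp T x e [1, 3] = 0" "frame_comp T x e [3, 1] = 0"
      using s[of e 3 1] by simp_all
    have "frame_comp T x e [i, j] = c * eta i j" for i j
      using exhaust_4[of i] exhaust_4[of j] neg[OF e] rest[OF e] t33[OF e] t13
        s[of e 3 2] s[of e 4 2] s[of e 1 2] s[of e 1 4] s[of e 3 4]
      by (elim disjE) simp_all
    then have "frame_comp T x e [i, j] = frame_comp (\<lambda>x is. c * metric_tensor g x is) x e [i, j]" for i j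
      using frame_comp_metric[OF e, of i j] mev_scale[of c "metric_tensor g x" "[e i, e j]"]
      by (simp add: frame_comp_def del: mev.simps)
    from tensor2_eqI[OF x e this, of a b] show ?thesis
      by (simp add: metric_tensor_def)
  qed
  then show ?thesis by blast
qed

end

context constant_leading_curvature
begin

lemma curv_monomial_const_leading: "curv_monomial g k r T \<Longrightarrow> const_leading r (frame_comp T)"
proof (induction rule: curv_monomial.induct)
  case metric
  show ?case by (rule const_leading_metric)
next
  case (curvature p)
  show ?case
  proof (cases p)
    case 0
    then show ?thesis using riemann_const_leading by simp
  next
    case (Suc q)
    then show ?thesis using no_leading_imp_const_leading[OF curv_no_leading[of q]] by simp
  qed
next
  case (product r T s U)
  show ?case
    by (rule const_leading_cong[OF const_leading_mult[OF product.IH, of "r + s" "take r" "drop r"]])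
      (auto simp: compatible_maps_def frame_comp_product simp flip: weight_simps(3))
next
  case (permute r T \<pi>)
  have "const_leading r (\<lambda>x e I. frame_comp T x e (permute_list \<pi> I))"
    by (rule const_leading_map[OF permute.IH]) (simp add: weight_permute_list permute.hyps)
  then show ?case
    by (rule const_leading_cong) (simp add: frame_comp_permute permute.hyps)
next
  case (contract r T)
  \<comment> \<open>Terms with \<open>eta p q = 0\<close> are split off, since for them prepending p
    and q may change the weight.\<close>
  have "const_leading r (\<lambda>x e I. eta p q * frame_comp T x e (p # q # I))" for p q
  proof (cases "eta p q = 0")
    case True
    then show ?thesis
      using no_leading_upto_imp_const_leading_upto[OF no_leading_upto_zero, of 0 r] by simp
  next
    case False
    then have "index_weight p + index_weight q = 0"
      by (auto simp: eta_def split: if_splits)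
    then show ?thesis
      by (intro const_leading_scale const_leading_map[OF contract.IH]) simp
  qed
  then have "const_leading r (\<lambda>x e I. \<Sum>p\<in>UNIV. \<Sum>q\<in>UNIV. eta p q * frame_comp T x e (p # q # I))"
    by (intro const_leading_sum)
  then show ?case
    by (rule const_leading_cong) (simp add: frame_comp_contract)
qed

theorem universal:
  assumes ex: "\<And>x. x \<in> S \<Longrightarrow> \<exists>e. adapted x e"
  shows "universal_on S g"
  unfolding universal_on_def k_universal_on_def
proof (intro allI impI, elim conjE)
  fix k T assume "constructed_from_curvature g k 2 T" and sym: "symmetric_on S T"
  then obtain N c M where M: "\<And>i. i < (N::nat) \<Longrightarrow> curv_monomial g k 2 (M i)"
    and T: "T = (\<lambda>x is. \<Sum>i<N. c i * M i x is)"
    unfolding constructed_from_curvature_def by blast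
  have "const_leading 2 (\<lambda>x e I. \<Sum>i<N. c i * frame_comp (M i) x e I)"
    by (intro const_leading_sum const_leading_scale curv_monomial_const_leading[OF M]) auto
  then have "const_leading 2 (frame_comp T)"
    by (rule const_leading_cong) (simp add: T frame_comp_def mev_sum mev_scale)
  then show "\<exists>c. \<forall>x\<in>S. \<forall>a b. T x [a, b] = c * g x $ a $ b"
    using sym ex by (rule const_leading_symmetric_imp_metric)
qed

end

subsection \<open>Self-dual Weyl tensor\<close>

text \<open>In an adapted frame the self-dual bivectors are spanned by \<open>e 2 \<and> e 3\<close>, \<open>e 4 \<and> e 1\<close> and
  \<open>e 2 \<and> e 1 - e 4 \<and> e 3\<close>; \<open>self_dual_free\<close> says that a 2-form vanishes on them.\<close>

definition bivec :: "4 \<Rightarrow> 4 \<Rightarrow> 4 \<Rightarrow> 4 \<Rightarrow> real" where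
  "bivec m n k l = (if k = m \<and> l = n then 1 else if k = n \<and> l = m then - 1 else 0)"

text \<open>Together with \<open>bivec 2 4\<close> and \<open>bivec 1 3\<close> this is a basis of
  the 2-forms that vanish on all self-dual bivectors.\<close>

definition omega :: "4 \<Rightarrow> 4 \<Rightarrow> real" where
  "omega k l = bivec 2 1 k l + bivec 4 3 k l"

lemma bivec_weight: "bivec m n k l \<noteq> 0 \<Longrightarrow> index_weight k + index_weight l = index_weight m + index_weight n"
  by (auto simp: bivec_def split: if_splits)

lemma omega_weight: "omega k l \<noteq> 0 \<Longrightarrow> index_weight k + index_weight l = 0"
  using bivec_weight[of 2 1 k l] bivec_weight[of 4 3 k l] by (cases "bivec 2 1 k l = 0") (simp_all add: omega_def)

definition self_dual_free :: "(4 \<Rightarrow> 4 \<Rightarrow> real) \<Rightarrow> bool" where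
  "self_dual_free \<beta> \<longleftrightarrow> (\<forall>k l. \<beta> k l + \<beta> l k = 0) \<and> \<beta> 2 3 = 0 \<and> \<beta> 4 1 = 0 \<and> \<beta> 2 1 = \<beta> 4 3"

lemma self_dual_free_expand:
  assumes "self_dual_free \<beta>"
  shows "\<beta> k l = \<beta> 2 4 * bivec 2 4 k l + \<beta> 1 3 * bivec 1 3 k l + \<beta> 2 1 * omega k l"
proof -
  have anti: "\<beta> l k = - \<beta> k l" for k l
  proof -
    have "\<beta> k l + \<beta> l k = 0"
      using assms unfolding self_dual_free_def by blast
    then show ?thesis by linarith
  qed
  have zero: "\<beta> k k = 0" for k
    using anti[of k k] by simp
  have "\<beta> 2 3 = 0" "\<beta> 4 1 = 0" "\<beta> 2 1 = \<beta> 4 3"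
    using assms unfolding self_dual_free_def by blast+
  then show ?thesis
    using exhaust_4[of k] exhaust_4[of l] anti[of 2 1] anti[of 1 3] anti[of 4 1] anti[of 2 3] anti[of 2 4] anti[of 4 3]
    by (elim disjE) (simp_all add: zero bivec_def omega_def)
qed

text \<open>A general isometry may exchange self-dual and anti-self-dual forms. Preserving the null
  plane, which is \<open>Q0\<close>, excludes this, as the bivector of the plane is of only one of
  the two types.\<close>

lemma self_dual_free_transform:
  assumes \<beta>: "self_dual_free \<beta>"
    and Q: "\<And>i j. (\<Sum>m\<in>UNIV. \<Sum>n\<in>UNIV. eta m n * Q i m * Q j n) = eta i j"
    and Q0: "Q 2 1 = 0" "Q 2 3 = 0" "Q 4 1 = 0" "Q 4 3 = 0"
  shows "self_dual_free (\<lambda>k l. \<Sum>m\<in>UNIV. \<Sum>n\<in>UNIV. Q k m * Q l n * \<beta> m n)"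
proof -
  define \<beta>' where "\<beta>' k l = (\<Sum>m\<in>UNIV. \<Sum>n\<in>UNIV. Q k m * Q l n * \<beta> m n)" for k l
  have \<beta>': "\<beta>' k l = \<beta> 2 4 * (Q k 2 * Q l 4 - Q k 4 * Q l 2) + \<beta> 1 3 * (Q k 1 * Q l 3 - Q k 3 * Q l 1)
     + \<beta> 2 1 * (Q k 2 * Q l 1 - Q k 1 * Q l 2 + Q k 4 * Q l 3 - Q k 3 * Q l 4)" for k l
  proof -
    define p q r where "p = \<beta> 2 4" "q = \<beta> 1 3" "r = \<beta> 2 1"
    have "\<beta> m n = p * bivec 2 4 m n + q * bivec 1 3 m n + r * omega m n" for m n
      unfolding p_q_r_def by (rule self_dual_free_expand[OF \<beta>])
    then have "\<beta> = (\<lambda>m n. p * bivec 2 4 m n + q * bivec 1 3 m n + r * omega m n)"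
      by blast
    then show ?thesis
      unfolding \<beta>'_def p_q_r_def[symmetric]
      by (simp add: sum_4 bivec_def omega_def) (simp add: algebra_simps)
  qed
  have g: "Q i 1 * Q j 2 + Q i 2 * Q j 1 + Q i 3 * Q j 4 + Q i 4 * Q j 3 = eta i j" for i j
    using Q[of i j] by (simp add: sum_4)
  have g23: "Q 2 2 * Q 3 1 = - (Q 2 4 * Q 3 3)" and g43: "Q 4 2 * Q 3 1 = 1 - Q 4 4 * Q 3 3"
    and g21: "Q 2 2 * Q 1 1 = 1 - Q 2 4 * Q 1 3" and g41: "Q 4 2 * Q 1 1 = - (Q 4 4 * Q 1 3)"
    and g33: "Q 3 1 * Q 3 2 = - (Q 3 3 * Q 3 4)" and g11: "Q 1 1 * Q 1 2 = - (Q 1 3 * Q 1 4)"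
    and g13: "Q 1 1 * Q 3 2 + Q 1 2 * Q 3 1 + Q 1 3 * Q 3 4 + Q 1 4 * Q 3 3 = 0"
    using g[of 2 3] g[of 4 3] g[of 2 1] g[of 4 1] g[of 3 3] g[of 1 1] g[of 1 3] Q0 by simp_all
  \<comment> \<open>X, Y, Z concern the coefficients of \<open>\<beta> 2 4\<close> in the components
    2 3, 4 1 and in the difference of 2 1 and 4 3. \<open>Q0\<close> removes the terms with
    \<open>\<beta> 1 3\<close>, and the pairings settle those with
    \<open>\<beta> 2 1\<close>.\<close>
  have X: "Q 2 2 * Q 3 4 - Q 2 4 * Q 3 2 = 0"
    using g23 g43 g33 by algebra
  have Y: "Q 4 2 * Q 1 4 - Q 4 4 * Q 1 2 = 0"
    using g21 g41 g11 by algebra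
  have Z: "Q 2 2 * Q 1 4 - Q 2 4 * Q 1 2 = Q 4 2 * Q 3 4 - Q 4 4 * Q 3 2"
    using g23 g43 g21 g41 g13 by algebra
  have "\<beta>' k l + \<beta>' l k = 0" for k l
    unfolding \<beta>' by (simp add: algebra_simps)
  moreover have "\<beta>' 2 3 = 0"
    unfolding \<beta>' using X g23 Q0 by simp
  moreover have "\<beta>' 4 1 = 0"
    unfolding \<beta>' using Y g41 Q0 by simp
  moreover have "\<beta>' 2 1 = \<beta>' 4 3"
    unfolding \<beta>' using Z g21 g43 Q0 by simp
  ultimately show ?thesis
    unfolding self_dual_free_def \<beta>'_def[symmetric] by blast
qed

text \<open>A trace-free tensor with these symmetries does not mix self-dual with anti-self-dual
  bivectors, and its self-dual block is given by the five components assumed to vanish.\<close>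

lemma weyl_self_dual_free:
  fixes w :: "4 \<Rightarrow> 4 \<Rightarrow> 4 \<Rightarrow> 4 \<Rightarrow> real"
  assumes anti: "\<And>a b c d. w b a c d = - w a b c d" "\<And>a b c d. w a b d c = - w a b c d"
    and pair: "\<And>a b c d. w c d a b = w a b c d"
    and bianchi: "\<And>a b c d. w a b c d + w a c d b + w a d b c = 0"
    and trace: "\<And>c d. (\<Sum>p\<in>UNIV. \<Sum>q\<in>UNIV. eta p q * w p c q d) = 0"
    and Psi: "w 2 3 2 3 = 0" "w 2 3 2 1 = 0" "w 2 3 4 1 = 0" "w 2 1 4 1 = 0" "w 1 4 1 4 = 0"
  shows "self_dual_free (w a b)"
proof -
  have t: "w 1 c 2 d + w 2 c 1 d + w 3 c 4 d + w 4 c 3 d = 0" for c d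
    using trace[of c d] by (simp add: sum_4)
  have z: "w a a c d = 0" "w a b c c = 0" for a b c d
    using anti(1)[of a a c d] anti(2)[of a b c c] by simp_all
  \<comment> \<open>Instances that bring every component into one normal form, with increasing
    indices in each pair and the pairs in order.\<close>
  note rev = anti(1)[of 2 1] anti(1)[of 3 1] anti(1)[of 4 1] anti(1)[of 3 2] anti(1)[of 4 2] anti(1)[of 4 3]
    anti(2)[of _ _ 2 1] anti(2)[of _ _ 3 1] anti(2)[of _ _ 4 1] anti(2)[of _ _ 3 2] anti(2)[of _ _ 4 2] anti(2)[of _ _ 4 3]
  note srt = pair[of 1 3 1 2] pair[of 1 4 1 2] pair[of 2 3 1 2] pair[of 2 4 1 2] pair[of 3 4 1 2]
    pair[of 1 4 1 3] pair[of 2 3 1 3] pair[of 2 4 1 3] pair[of 3 4 1 3]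
    pair[of 2 3 1 4] pair[of 2 4 1 4] pair[of 3 4 1 4] pair[of 2 4 2 3] pair[of 3 4 2 3] pair[of 3 4 2 4]
  have psi: "w 2 3 2 3 = 0" "w 1 2 2 3 = 0" "w 1 4 2 3 = 0" "w 1 2 1 4 = 0" "w 1 4 1 4 = 0"
    using Psi by (simp_all add: rev srt)
  have 1: "w 1 3 1 4 = 0" "w 2 3 2 4 = 0" "w 1 3 2 3 = 0" "w 1 4 2 4 = 0"
    using t[of 1 1] t[of 2 2] t[of 3 3] t[of 4 4] by (simp_all add: z rev srt)
  have 2: "w 1 2 1 2 = w 1 3 2 4" "w 3 4 3 4 = w 1 3 2 4" "w 1 3 3 4 = w 1 2 1 3" "w 2 4 3 4 = w 1 2 2 4"
      "w 1 4 3 4 = 0" "w 2 3 3 4 = 0"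
    using t[of 1 2] t[of 3 4] t[of 1 3] t[of 2 4] t[of 1 4] t[of 2 3] psi by (simp_all add: z rev srt)
  have 3: "w 1 2 3 4 = w 1 3 2 4"
    using bianchi[of 1 2 3 4] psi by (simp add: z rev srt)
  have "w a b 2 3 = 0 \<and> w a b 4 1 = 0 \<and> w a b 2 1 = w a b 4 3"
    using exhaust_4[of a] exhaust_4[of b]
    by (elim disjE) (simp_all add: z rev srt psi 1 2 3)
  moreover have "w a b k l + w a b l k = 0" for k l
    using anti(2)[of a b k l] by linarith
  ultimately show ?thesis
    unfolding self_dual_free_def by blast
qed

lemma self_dual_free_scale: "self_dual_free \<beta> \<Longrightarrow> self_dual_free (\<lambda>k l. c * \<beta> k l)"
  unfolding self_dual_free_def by (simp flip: distrib_left)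

lemma self_dual_free_sum:
  "(\<And>i. i \<in> I \<Longrightarrow> self_dual_free (\<beta> i)) \<Longrightarrow> self_dual_free (\<lambda>k l. \<Sum>i\<in>I. \<beta> i k l)"
  unfolding self_dual_free_def by (simp flip: sum.distrib)

lemma permute_list_explicit4:
  "permute_list (Transposition.transpose 0 1) [a, b, c, d] = [b, a, c, d]"
  "permute_list (Transposition.transpose 1 2) [a, b, c, d] = [a, c, b, d]"
  "permute_list (Transposition.transpose 2 3) [a, b, c, d] = [a, b, d, c]"
  "permute_list (Transposition.transpose 1 2 \<circ> Transposition.transpose 2 3) [a, b, c, d] = [a, c, d, b]"
  "permute_list (Transposition.transpose 2 3 \<circ> Transposition.transpose 1 2) [a, b, c, d] = [a, d, b, c]"
  by (simp_all add: permute_list_def Transposition.transpose_def numeral_eq_Suc)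

context null_plane_metric
begin

lemma ip_sum [simp]:
  "ip x (\<Sum>p\<in>P. v p) w = (\<Sum>p\<in>P. ip x (v p) w)" "ip x w (\<Sum>p\<in>P. v p) = (\<Sum>p\<in>P. ip x w (v p))"
  by (induction P rule: infinite_finite_induct) (simp_all add: ip_eq[of _ 0] ip_eq[of _ _ 0])

text \<open>For Einstein metrics in dimension 4 this is the Weyl tensor.\<close>

definition weyl_form :: "real \<Rightarrow> real^4 \<Rightarrow> real^4 \<Rightarrow> real^4 \<Rightarrow> real^4 \<Rightarrow> real^4 \<Rightarrow> real" where
  "weyl_form lam x X Y Z W = mev (riemann_tensor g x) [X, Y, Z, W]
     - lam / 3 * (ip x X Z * ip x Y W - ip x X W * ip x Y Z)"

lemma weyl_form_sum:
  "weyl_form lam x (\<Sum>p\<in>P. c p *\<^sub>R v p) Y Z W = (\<Sum>p\<in>P. c p * weyl_form lam x (v p) Y Z W)"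
  "weyl_form lam x X (\<Sum>p\<in>P. c p *\<^sub>R v p) Z W = (\<Sum>p\<in>P. c p * weyl_form lam x X (v p) Z W)"
  "weyl_form lam x X Y (\<Sum>p\<in>P. c p *\<^sub>R v p) W = (\<Sum>p\<in>P. c p * weyl_form lam x X Y (v p) W)"
  "weyl_form lam x X Y Z (\<Sum>p\<in>P. c p *\<^sub>R v p) = (\<Sum>p\<in>P. c p * weyl_form lam x X Y Z (v p))"
proof -
  let ?s = "\<Sum>p\<in>P. c p *\<^sub>R v p" and ?R = "mev (riemann_tensor g x)"
  have "?R [?s, Y, Z, W] = (\<Sum>p\<in>P. c p * ?R [v p, Y, Z, W])"
    using mev_update_sum[of 0 "[0, Y, Z, W]" "riemann_tensor g x" c v P] by (simp del: mev.simps)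
  then show "weyl_form lam x ?s Y Z W = (\<Sum>p\<in>P. c p * weyl_form lam x (v p) Y Z W)"
    by (simp add: weyl_form_def sum_distrib_left sum_distrib_right algebra_simps sum.distrib sum_subtractf del: mev.simps)
  have "?R [X, ?s, Z, W] = (\<Sum>p\<in>P. c p * ?R [X, v p, Z, W])"
    using mev_update_sum[of 1 "[X, 0, Z, W]" "riemann_tensor g x" c v P] by (simp del: mev.simps)
  then show "weyl_form lam x X ?s Z W = (\<Sum>p\<in>P. c p * weyl_form lam x X (v p) Z W)"
    by (simp add: weyl_form_def sum_distrib_left sum_distrib_right algebra_simps sum.distrib sum_subtractf del: mev.simps)
  have "?R [X, Y, ?s, W] = (\<Sum>p\<in>P. c p * ?R [X, Y, v p, W])"
    using mev_update_sum[of 2 "[X, Y, 0, W]" "riemann_tensor g x" c v P] by (simp add: numeral_2_eq_2 del: mev.simps)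
  then show "weyl_form lam x X Y ?s W = (\<Sum>p\<in>P. c p * weyl_form lam x X Y (v p) W)"
    by (simp add: weyl_form_def sum_distrib_left sum_distrib_right algebra_simps sum.distrib sum_subtractf del: mev.simps)
  have "?R [X, Y, Z, ?s] = (\<Sum>p\<in>P. c p * ?R [X, Y, Z, v p])"
    using mev_update_sum[of 3 "[X, Y, Z, 0]" "riemann_tensor g x" c v P] by (simp add: numeral_3_eq_3 del: mev.simps)
  then show "weyl_form lam x X Y Z ?s = (\<Sum>p\<in>P. c p * weyl_form lam x X Y Z (v p))"
    by (simp add: weyl_form_def sum_distrib_left sum_distrib_right algebra_simps sum.distrib sum_subtractf del: mev.simps)
qed

lemma mev4_permute:
  assumes "\<pi> permutes {..<4}"
  shows "mev (\<lambda>is. T (permute_list \<pi> is)) [X, Y, Z, W] = mev T (permute_list \<pi> [X, Y, Z, W])"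
  using mev_permute[of \<pi> "[X, Y, Z, W]" T] assms by (simp add: lessThan_Suc numeral_eq_Suc)

lemma permutes4:
  "Transposition.transpose 0 1 permutes {..<4::nat}" "Transposition.transpose 1 2 permutes {..<4::nat}"
  "Transposition.transpose 2 3 permutes {..<4::nat}"
  "Transposition.transpose 1 2 \<circ> Transposition.transpose 2 3 permutes {..<4::nat}"
  "Transposition.transpose 2 3 \<circ> Transposition.transpose 1 2 permutes {..<4::nat}"
  by (intro permutes_compose transpose_permutes; simp)+

lemma mev4_eqI:
  fixes T U :: "4 list \<Rightarrow> real"
  assumes "\<And>a b c d. T [a, b, c, d] = U [a, b, c, d]"
  shows "mev T [X, Y, Z, W] = mev U [X, Y, Z, W]"
proof (rule mev_cong)
  fix "is" :: "4 list" assume "length is = length [X, Y, Z, W]"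
  then obtain a b c d where "is = [a, b, c, d]"
    by (auto simp: length_Suc_conv)
  with assms show "T is = U is" by simp
qed

lemma mev_riemann_symmetries:
  assumes x: "x \<in> S"
  shows "mev (riemann_tensor g x) [Y, X, Z, W] = - mev (riemann_tensor g x) [X, Y, Z, W]"
    and "mev (riemann_tensor g x) [X, Y, W, Z] = - mev (riemann_tensor g x) [X, Y, Z, W]"
    and "mev (riemann_tensor g x) [Z, W, X, Y] = mev (riemann_tensor g x) [X, Y, Z, W]"
    and "mev (riemann_tensor g x) [X, Y, Z, W] + mev (riemann_tensor g x) [X, Z, W, Y] + mev (riemann_tensor g x) [X, W, Y, Z] = 0"
proof -
  let ?R = "riemann_tensor g x"
  have R4: "riemann_tensor g x [a, b, c, d] = riemann g x a b c d" for a b c d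
    by (simp add: riemann_tensor_def)
  have "mev (\<lambda>is. ?R (permute_list (Transposition.transpose 0 1) is)) [X, Y, Z, W] = mev (\<lambda>is. - ?R is) [X, Y, Z, W]"
    by (rule mev4_eqI) (simp only: permute_list_explicit4 R4, rule riemann_antisym_left[OF x])
  then show "mev ?R [Y, X, Z, W] = - mev ?R [X, Y, Z, W]"
    by (simp only: mev4_permute[OF permutes4(1)] permute_list_explicit4 mev_minus)
  have "mev (\<lambda>is. ?R (permute_list (Transposition.transpose 2 3) is)) [X, Y, Z, W] = mev (\<lambda>is. - ?R is) [X, Y, Z, W]"
    by (rule mev4_eqI) (simp only: permute_list_explicit4 R4, rule riemann_antisym_right)
  then show "mev ?R [X, Y, W, Z] = - mev ?R [X, Y, Z, W]"
    by (simp only: mev4_permute[OF permutes4(3)] permute_list_explicit4 mev_minus)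
  show "mev ?R [Z, W, X, Y] = mev ?R [X, Y, Z, W]"
    using curv_pair_sym[OF x, of "\<lambda>i. if i = 1 then X else if i = 2 then Y else if i = 3 then Z else W" 3 4 1 2]
    by (simp add: frame_comp_def del: mev.simps)
  have "mev (\<lambda>is. ?R is + ?R (permute_list (Transposition.transpose 1 2 \<circ> Transposition.transpose 2 3) is)
      + ?R (permute_list (Transposition.transpose 2 3 \<circ> Transposition.transpose 1 2) is)) [X, Y, Z, W] = mev (\<lambda>is. 0) [X, Y, Z, W]"
    by (rule mev4_eqI) (simp only: permute_list_explicit4 R4, rule riemann_bianchi[OF x])
  then show "mev ?R [X, Y, Z, W] + mev ?R [X, Z, W, Y] + mev ?R [X, W, Y, Z] = 0"
    by (simp only: mev_add mev4_permute[OF permutes4(4)] mev4_permute[OF permutes4(5)] permute_list_explicit4 mev_zero)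
qed

lemma weyl_form_symmetries:
  assumes x: "x \<in> S"
  shows "weyl_form lam x Y X Z W = - weyl_form lam x X Y Z W"
    and "weyl_form lam x X Y W Z = - weyl_form lam x X Y Z W"
    and "weyl_form lam x Z W X Y = weyl_form lam x X Y Z W"
    and "weyl_form lam x X Y Z W + weyl_form lam x X Z W Y + weyl_form lam x X W Y Z = 0"
  using mev_riemann_symmetries[OF x, of X Y Z W]
  by (simp_all add: weyl_form_def ip_sym[OF x, of Z X] ip_sym[OF x, of Z Y] ip_sym[OF x, of W X] ip_sym[OF x, of W Y]
      ip_sym[OF x, of W Z] ip_sym[OF x, of Y X] algebra_simps del: mev.simps)

lemma einstein_frame_trace:
  assumes x: "x \<in> S" and e: "adapted x e" and ein: "\<And>a b. ricci g x a b = lam * g x $ a $ b"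
  shows "(\<Sum>p\<in>UNIV. \<Sum>q\<in>UNIV. eta p q * mev (riemann_tensor g x) [e p, e c, e q, e d]) = lam * eta c d"
proof -
  \<comment> \<open>The Ricci tensor contracts the first and third slots,
    \<open>frame_comp_contract\<close> the first two.\<close>
  let ?T = "\<lambda>x is. riemann_tensor g x (permute_list (Transposition.transpose 1 2) is)"
  let ?C = "\<lambda>x is. \<Sum>a\<in>UNIV. \<Sum>b\<in>UNIV. ginv g x a b * ?T x (a # b # is)"
  have "?C x [c, d] = lam * metric_tensor g x [c, d]" for c d
  proof -
    have "?C x [c, d] = (\<Sum>a\<in>UNIV. \<Sum>b\<in>UNIV. ginv g x a b * riemann g x a c b d)"
      unfolding permute_list_explicit4 by (simp add: riemann_tensor_def)
    also have "\<dots> = (\<Sum>b\<in>UNIV. \<Sum>a\<in>UNIV. ginv g x b a * riemann g x a c b d)"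
      by (subst sum.swap, intro sum.cong refl, subst ginv_sym[OF x]) (rule refl)
    also have "\<dots> = ricci g x c d"
      by (simp add: ricci_def riemann_up_eq[OF x])
    finally show ?thesis
      using ein by (simp add: metric_tensor_def)
  qed
  then have "frame_comp ?C x e [c, d] = lam * ip x (e c) (e d)"
    by (simp add: frame_comp_def ip_def sum_distrib_left mult_ac)
  then have "frame_comp ?C x e [c, d] = lam * eta c d"
    using e by (simp add: adapted_def)
  moreover have "frame_comp ?T x e [p, q, c, d] = mev (riemann_tensor g x) [e p, e c, e q, e d]" for p q
    by (simp only: frame_comp_def list.map mev4_permute[OF permutes4(2)] permute_list_explicit4)
  ultimately show ?thesis
    using frame_comp_contract[OF x e, of ?T "[c, d]"] by (simp only:)
qed


text \<open>Extends the condition from the single frame \<open>b\<close> to all adapted frames. Both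
  frames have their second and fourth vectors in the plane, so the coefficients of one in the other
  satisfy the hypotheses of \<open>self_dual_free_transform\<close>.\<close>

lemma self_dual_free_frame:
  assumes x: "x \<in> S" and b: "adapted x b" and e: "adapted x e"
    and sd: "\<And>i j. self_dual_free (\<lambda>k l. weyl_form lam x (b i) (b j) (b k) (b l))"
  shows "self_dual_free (\<lambda>k l. weyl_form lam x X Y (e k) (e l))"
proof -
  define q where "q v i = (\<Sum>j\<in>UNIV. eta i j * ip x (b j) v)" for v i
  have span: "v = (\<Sum>i\<in>UNIV. q v i *\<^sub>R b i)" for v
    unfolding q_def by (rule adapted_spans[OF x b])
  have "weyl_form lam x X Y Z W = (\<Sum>j\<in>UNIV. q Y j * (\<Sum>i\<in>UNIV. q X i * weyl_form lam x (b i) (b j) Z W))" for Z W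
    by (subst span[of X], subst span[of Y]) (simp only: weyl_form_sum)
  then have XY: "self_dual_free (\<lambda>k l. weyl_form lam x X Y (b k) (b l))"
    by (simp add: self_dual_free_sum self_dual_free_scale sd)
  have W: "weyl_form lam x X Y (e k) (e l)
      = (\<Sum>m\<in>UNIV. \<Sum>n\<in>UNIV. q (e k) m * q (e l) n * weyl_form lam x X Y (b m) (b n))" for k l
    by (subst span[of "e k"], subst span[of "e l"]) (simp only: weyl_form_sum sum_distrib_left, subst sum.swap, simp only: mult_ac)
  have gram: "(\<Sum>m\<in>UNIV. \<Sum>n\<in>UNIV. eta m n * q (e i) m * q (e j) n) = eta i j" for i j
  proof -
    have "eta i j = ip x (\<Sum>m\<in>UNIV. q (e i) m *\<^sub>R b m) (\<Sum>n\<in>UNIV. q (e j) n *\<^sub>R b n)"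
      using e span[of "e i"] span[of "e j"] by (simp add: adapted_def)
    also have "\<dots> = (\<Sum>m\<in>UNIV. \<Sum>n\<in>UNIV. eta m n * q (e i) m * q (e j) n)"
      using b by (simp add: adapted_def sum_distrib_left mult_ac) (rule sum.swap)
    finally show ?thesis ..
  qed
  have "q (e 2) 1 = 0" "q (e 2) 3 = 0" "q (e 4) 1 = 0" "q (e 4) 3 = 0"
    using b e plane_null[OF x] by (simp_all add: q_def sum_4 adapted_def)
  from self_dual_free_transform[OF XY, of "\<lambda>i. q (e i)", OF gram this] show ?thesis
    by (simp only: W)
qed

text \<open>The plane condition determines all components with 2 4 in one pair, and the first
  Bianchi identity then gives w 2 1 2 1. What stays free are w 1 3 1 3 and w 2 1 1 3, in the basic
  frame \<Psi>-tilde 4 and 3, and these multiply forms of positive weight.\<close>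

lemma einstein_self_dual_free_riemann_const_leading:
  assumes plane: "\<And>x X Y v w. x \<in> S \<Longrightarrow> v \<in> plane \<Longrightarrow> w \<in> plane \<Longrightarrow> mev (riemann_tensor g x) [X, Y, v, w] = 0"
    and sd: "\<And>x X Y e. x \<in> S \<Longrightarrow> adapted x e \<Longrightarrow> self_dual_free (\<lambda>k l. weyl_form lam x X Y (e k) (e l))"
  shows "const_leading 4 (frame_comp (riemann_tensor g))"
proof -
  \<comment> \<open>What remains of the Riemann tensor without the two free components: the first
    two terms come from the scalar curvature, the others are the part of the Weyl tensor forced by
    lam.\<close>
  define K where "K i j k l = lam / 3 * (eta i k * eta j l - eta i l * eta j k
    - bivec 1 3 i j * bivec 2 4 k l - bivec 2 4 i j * bivec 1 3 k l - omega i j * omega k l)" for i j k l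
  have key: "frame_comp (riemann_tensor g) x e [i, j, k, l] = K i j k l"
    if x: "x \<in> S" and e: "adapted x e" and wt: "index_weight i + index_weight j + index_weight k + index_weight l \<le> 0" for x e i j k l
  proof -
    define w where "w i j k l = weyl_form lam x (e i) (e j) (e k) (e l)" for i j k l
    have ip: "ip x (e i) (e j) = eta i j" for i j
      using e by (simp add: adapted_def)
    have R: "frame_comp (riemann_tensor g) x e [i, j, k, l] = w i j k l + lam / 3 * (eta i k * eta j l - eta i l * eta j k)"
      for i j k l
      by (simp add: w_def weyl_form_def frame_comp_def ip del: mev.simps)
    have wsd: "self_dual_free (w i j)" for i j
      unfolding w_def by (rule sd[OF x e])
    have pair: "w i j k l = w k l i j" for i j k l
      unfolding w_def by (rule weyl_form_symmetries(3)[OF x])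
    have "mev (riemann_tensor g x) [e i, e j, e 2, e 4] = 0" for i j
      using plane[OF x] e by (simp add: adapted_def del: mev.simps)
    \<comment> \<open>With the Riemann term gone, only the metric part of \<open>weyl_form\<close>
      is left, and \<open>eta\<close> pairs 2, 4 with 1, 3.\<close>
    then have w24: "w i j 2 4 = - lam / 3 * bivec 1 3 i j" for i j
      unfolding w_def weyl_form_def ip
      using exhaust_4[of i] exhaust_4[of j] by (elim disjE) (simp_all add: bivec_def del: mev.simps)
    have "w 2 1 4 3 + w 2 4 3 1 + w 2 3 1 4 = 0"
      unfolding w_def by (rule weyl_form_symmetries(4)[OF x])
    moreover have "w 2 3 1 4 = 0" "w 2 1 4 3 = w 2 1 2 1"
      using wsd[of 1 4] wsd[of 2 1] pair[of 2 3 1 4] unfolding self_dual_free_def by simp_all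
    moreover have "w 2 4 3 1 = lam / 3"
      using w24[of 3 1] pair[of 2 4 3 1] by (simp add: bivec_def)
    ultimately have w2121: "w 2 1 2 1 = - lam / 3"
      by simp
    have w13: "w i j 1 3 = - lam / 3 * bivec 2 4 i j + w 1 3 1 3 * bivec 1 3 i j + w 1 3 2 1 * omega i j" for i j
      using self_dual_free_expand[OF wsd[of 1 3], of i j] w24[of 1 3] pair[of i j 1 3] by (simp add: bivec_def)
    have w21: "w i j 2 1 = w 2 1 1 3 * bivec 1 3 i j - lam / 3 * omega i j" for i j
      using self_dual_free_expand[OF wsd[of 2 1], of i j] w24[of 2 1] pair[of i j 2 1] w2121 by (simp add: bivec_def)
    have "w i j k l = w i j 2 4 * bivec 2 4 k l + w i j 1 3 * bivec 1 3 k l + w i j 2 1 * omega k l"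
      by (rule self_dual_free_expand[OF wsd])
    also have "\<dots> = - lam / 3 * (bivec 1 3 i j * bivec 2 4 k l + bivec 2 4 i j * bivec 1 3 k l + omega i j * omega k l)
      + w 1 3 1 3 * (bivec 1 3 i j * bivec 1 3 k l) + w 1 3 2 1 * (omega i j * bivec 1 3 k l)
      + w 2 1 1 3 * (bivec 1 3 i j * omega k l)"
      unfolding w24 w13[of i j] w21[of i j] by (simp add: algebra_simps)
    also have "bivec 1 3 i j * bivec 1 3 k l = 0"
      using bivec_weight[of 1 3 i j] bivec_weight[of 1 3 k l] wt by (cases "bivec 1 3 i j = 0") auto
    also have "omega i j * bivec 1 3 k l = 0"
      using omega_weight[of i j] bivec_weight[of 1 3 k l] wt by (cases "omega i j = 0") auto
    also have "bivec 1 3 i j * omega k l = 0"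
      using omega_weight[of k l] bivec_weight[of 1 3 i j] wt by (cases "omega k l = 0") auto
    finally show ?thesis
      unfolding R K_def by (simp add: algebra_simps)
  qed
  have eta_weight: "index_weight i + index_weight j = 0" if "eta i j \<noteq> 0" for i j
    using that by (auto simp: eta_def split: if_splits)
  have K0: "K i j k l = 0" if "index_weight i + index_weight j + index_weight k + index_weight l < 0" for i j k l
  proof -
    have "eta i k * eta j l = 0"
      using eta_weight[of i k] eta_weight[of j l] that by (cases "eta i k = 0") auto
    moreover have "eta i l * eta j k = 0"
      using eta_weight[of i l] eta_weight[of j k] that by (cases "eta i l = 0") auto
    moreover have "bivec 1 3 i j * bivec 2 4 k l = 0"
      using bivec_weight[of 1 3 i j] bivec_weight[of 2 4 k l] that by (cases "bivec 1 3 i j = 0") auto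
    moreover have "bivec 2 4 i j * bivec 1 3 k l = 0"
      using bivec_weight[of 2 4 i j] bivec_weight[of 1 3 k l] that by (cases "bivec 2 4 i j = 0") auto
    moreover have "omega i j * omega k l = 0"
      using omega_weight[of i j] omega_weight[of k l] that by (cases "omega i j = 0") auto
    ultimately show ?thesis
      by (simp only: K_def diff_self mult_zero_right)
  qed
  show ?thesis
    unfolding const_leading_def
  proof (intro exI ballI allI impI)
    fix x e and I :: "4 list"
    assume *: "x \<in> S" "adapted x e" "length I = 4"
    then have "length I = Suc (Suc (Suc (Suc 0)))"
      by simp
    then obtain i j k l where I: "I = [i, j, k, l]"
      unfolding length_Suc_conv length_0_conv by blast
    show "(weight I < 0 \<longrightarrow> frame_comp (riemann_tensor g) x e I = 0)
      \<and> (weight I = 0 \<longrightarrow> frame_comp (riemann_tensor g) x e I = K (I ! 0) (I ! 1) (I ! 2) (I ! 3))"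
      using key[OF *(1,2), of i j k l] K0[of i j k l] by (simp add: I numeral_2_eq_2 numeral_3_eq_3)
  qed
qed

end

context null_plane_metric
begin

text \<open>In dimension 4 the Ricci terms contribute -lam and the scalar curvature 4 lam / 6 to the
  coefficient of the metric part, together -lam / 3.\<close>

lemma einstein_weyl_at:
  assumes x: "x \<in> S" and ein: "\<And>a b. ricci g x a b = lam * g x $ a $ b"
  shows "weyl_at g x X Y Z W = weyl_form lam x X Y Z W"
proof -
  have "scalar_curvature g x = (\<Sum>a\<in>UNIV. lam * (\<Sum>b\<in>UNIV. ginv g x a b * g x $ b $ a))"
    unfolding scalar_curvature_def ein sum_distrib_left
    by (intro sum.cong refl) (subst g_sym[OF x], simp)
  then have scal: "scalar_curvature g x = 4 * lam"
    by (simp add: ginv_g[OF x])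
  let ?g = "metric_tensor g x"
  \<comment> \<open>Both quadratic terms in the metric are permutations of this one product
    tensor.\<close>
  let ?P = "\<lambda>is. ?g (take 2 is) * ?g (drop 2 is)"
  let ?\<pi> = "Transposition.transpose 1 (2::nat)"
  let ?\<rho> = "Transposition.transpose 2 3 \<circ> Transposition.transpose 1 (2::nat)"
  have P: "mev ?P [X, Y, Z, W] = ip x X Y * ip x Z W" for X Y Z W
    using mev_append[of ?g "[X, Y]" ?g "[Z, W]"] by (simp add: ip_def numeral_2_eq_2 del: mev.simps)
  have "weyl_at g x X Y Z W = mev (\<lambda>is. weyl g x (is ! 0) (is ! 1) (is ! 2) (is ! 3)) [X, Y, Z, W]"
    by (simp add: weyl_at_def sum_distrib_left mult_ac)
  also have "\<dots> = mev (\<lambda>is. riemann_tensor g x is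
      - lam / 3 * (?P (permute_list ?\<pi> is) - ?P (permute_list ?\<rho> is))) [X, Y, Z, W]"
  proof (rule mev4_eqI)
    fix a b c d
    show "weyl g x ([a, b, c, d] ! 0) ([a, b, c, d] ! 1) ([a, b, c, d] ! 2) ([a, b, c, d] ! 3) =
      riemann_tensor g x [a, b, c, d] - lam / 3 * (?P (permute_list ?\<pi> [a, b, c, d]) - ?P (permute_list ?\<rho> [a, b, c, d]))"
      unfolding permute_list_explicit4
      by (simp add: weyl_def Let_def scal ein riemann_tensor_def metric_tensor_def numeral_2_eq_2 numeral_3_eq_3)
        (simp add: field_simps)
  qed
  also have "\<dots> = weyl_form lam x X Y Z W"
    by (simp only: mev_diff mev_scale mev4_permute[OF permutes4(2), of ?P] mev4_permute[OF permutes4(5), of ?P]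
        permute_list_explicit4 P weyl_form_def)
  finally show ?thesis .
qed

lemma weyl_form_minus:
  "weyl_form lam x (- X) Y Z W = - weyl_form lam x X Y Z W" "weyl_form lam x X (- Y) Z W = - weyl_form lam x X Y Z W"
  "weyl_form lam x X Y (- Z) W = - weyl_form lam x X Y Z W" "weyl_form lam x X Y Z (- W) = - weyl_form lam x X Y Z W"
  using weyl_form_sum[where P = "{()}" and c = "\<lambda>_. - 1"] by simp_all

end

subsection \<open>Walker metrics\<close>

context
  fixes S :: "(real^4) set" and A B C :: "real^4 \<Rightarrow> real"
  assumes S: "open S" and A: "smooth_on S A" and B: "smooth_on S B" and C: "smooth_on S C"
begin

lemma walker_entries:
  "walker_metric A B C x $ 1 $ 1 = 2 * A x" "walker_metric A B C x $ 1 $ 2 = 1" "walker_metric A B C x $ 1 $ 3 = C x"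
  "walker_metric A B C x $ 1 $ 4 = 0"
  "walker_metric A B C x $ 2 $ 1 = 1" "walker_metric A B C x $ 2 $ 2 = 0" "walker_metric A B C x $ 2 $ 3 = 0"
  "walker_metric A B C x $ 2 $ 4 = 0"
  "walker_metric A B C x $ 3 $ 1 = C x" "walker_metric A B C x $ 3 $ 2 = 0" "walker_metric A B C x $ 3 $ 3 = 2 * B x"
  "walker_metric A B C x $ 3 $ 4 = 1"
  "walker_metric A B C x $ 4 $ 1 = 0" "walker_metric A B C x $ 4 $ 2 = 0" "walker_metric A B C x $ 4 $ 3 = 1"
  "walker_metric A B C x $ 4 $ 4 = 0"
  by (simp_all add: walker_metric_def vector_4_nth)

lemma ginv_walker:
  "ginv (walker_metric A B C) x a b = (vector
     [vector [0, 1,         0, 0],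
      vector [1, - 2 * A x, 0, - C x],
      vector [0, 0,         0, 1],
      vector [0, - C x,     1, - 2 * B x]] :: real^4^4) $ a $ b"
proof -
  let ?H = "vector [vector [0, 1, 0, 0], vector [1, - 2 * A x, 0, - C x], vector [0, 0, 0, 1], vector [0, - C x, 1, - 2 * B x]] :: real^4^4"
  have "walker_metric A B C x ** ?H = mat 1"
    by (simp add: matrix_matrix_mult_def mat_def vec_eq_iff forall_4 sum_4 walker_entries vector_4_nth)
  then show ?thesis
    by (simp add: ginv_def matrix_inv_unique)
qed

lemma ginv_walker_entries:
  "ginv (walker_metric A B C) x 1 1 = 0" "ginv (walker_metric A B C) x 1 2 = 1" "ginv (walker_metric A B C) x 1 3 = 0"
  "ginv (walker_metric A B C) x 1 4 = 0"
  "ginv (walker_metric A B C) x 2 1 = 1" "ginv (walker_metric A B C) x 2 2 = - 2 * A x" "ginv (walker_metric A B C) x 2 3 = 0"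
  "ginv (walker_metric A B C) x 2 4 = - C x"
  "ginv (walker_metric A B C) x 3 1 = 0" "ginv (walker_metric A B C) x 3 2 = 0" "ginv (walker_metric A B C) x 3 3 = 0"
  "ginv (walker_metric A B C) x 3 4 = 1"
  "ginv (walker_metric A B C) x 4 1 = 0" "ginv (walker_metric A B C) x 4 2 = - C x" "ginv (walker_metric A B C) x 4 3 = 1"
  "ginv (walker_metric A B C) x 4 4 = - 2 * B x"
  by (simp_all add: ginv_walker vector_4_nth)

lemma walker_smooth_metric: "smooth_metric S (walker_metric A B C)"
proof
  fix x and a b :: 4
  show "open S" by (rule S)
  show "smooth_on S (\<lambda>x. walker_metric A B C x $ a $ b)"
    using exhaust_4[of a] exhaust_4[of b] A B C S
    by (elim disjE) (auto simp: walker_entries)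
  show "smooth_on S (\<lambda>x. ginv (walker_metric A B C) x a b)"
    using exhaust_4[of a] exhaust_4[of b] A B C S smooth_on_mult[of S "\<lambda>_. - 2" A] smooth_on_mult[of S "\<lambda>_. - 2" B]
    by (elim disjE) (auto simp: ginv_walker_entries)
  show "walker_metric A B C x $ a $ b = walker_metric A B C x $ b $ a"
    using exhaust_4[of a] exhaust_4[of b] by (elim disjE) (simp_all add: walker_entries)
  show "ginv (walker_metric A B C) x a b = ginv (walker_metric A B C) x b a"
    using exhaust_4[of a] exhaust_4[of b] by (elim disjE) (simp_all add: ginv_walker_entries)
  show "(\<Sum>e\<in>UNIV. ginv (walker_metric A B C) x a e * walker_metric A B C x $ e $ b) = (if a = b then 1 else 0)"
    using exhaust_4[of a] exhaust_4[of b] by (elim disjE) (simp_all add: sum_4 ginv_walker_entries walker_entries)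
qed

text \<open>This is the parallelism of the plane. Rows 1 and 3 of the inverse metric select
  derivatives of metric entries with an index 2 or 4, and those entries are constant.\<close>

lemma walker_christoffel_zero:
  assumes "a \<in> {1, 3}" "b \<in> {2, 4}"
  shows "christoffel (walker_metric A B C) x a c b = 0"
  using assms exhaust_4[of c]
  by (elim insertE emptyE disjE) (simp_all add: christoffel_def sum_4 ginv_walker_entries walker_entries)

lemma walker_null_plane_metric: "null_plane_metric S (walker_metric A B C)"
proof -
  interpret smooth_metric S "walker_metric A B C"
    by (rule walker_smooth_metric)
  show ?thesis
  proof
    fix x X v w assume "v \<in> plane" "w \<in> plane"
    then show "ip x v w = 0"
      by (simp add: ip_eq sum_4 walker_entries plane_def)
  next
    fix x X v assume "v \<in> plane"
    then show "parallel_velocity x X v \<in> plane"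
      by (simp add: plane_def parallel_velocity_def sum_4 walker_christoffel_zero)
  qed
qed

text \<open>The plane is parallel, so the curvature endomorphisms map it to itself, and being null
  it is orthogonal to the image. Pair symmetry carries this over to the last two slots.\<close>

lemma walker_riemann_zero:
  assumes "x \<in> S" "c \<in> {2, 4}" "d \<in> {2, 4}"
  shows "riemann (walker_metric A B C) x a b c d = 0"
proof -
  interpret smooth_metric S "walker_metric A B C"
    by (rule walker_smooth_metric)
  have up: "riemann_up (walker_metric A B C) x e d a b = 0" if "e \<in> {1, 3}" for e a b
  proof -
    \<comment> \<open>If i is 2 or 4 the first factor vanishes, otherwise the second.\<close>
    have prod: "christoffel (walker_metric A B C) x e a i * christoffel (walker_metric A B C) x i b d = 0" for a b i
      using exhaust_4[of i] that assms(3) by (auto simp: walker_christoffel_zero)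
    show ?thesis
      unfolding riemann_up_def prod using that assms(3) by (simp add: walker_christoffel_zero)
  qed
  have "riemann (walker_metric A B C) x c d a b = 0"
    using assms(2) up by (auto simp: riemann_def sum_4 walker_entries)
  then show ?thesis
    using riemann_pair_sym[OF assms(1)] by simp
qed

lemma walker_universal:
  assumes ein: "einstein_on S (walker_metric A B C) lam" and sd: "self_dual_weyl_vanishes_on S A B C"
  shows "universal_on S (walker_metric A B C)"
proof -
  interpret null_plane_metric S "walker_metric A B C"
    by (rule walker_null_plane_metric)
  \<comment> \<open>The minus sign turns the product -1 of m and mt into the 1 that
    \<open>eta\<close> prescribes.\<close>
  define b where "b x i = (if i = 1 then frame_n A C x else if i = 2 then frame_l
    else if i = 3 then - frame_m B C x else frame_mt)" for x and i :: 4
  have b: "adapted x (b x)" for x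
  proof -
    have "ip x (b x i) (b x j) = eta i j" for i j
      using exhaust_4[of i] exhaust_4[of j]
      by (elim disjE) (simp_all add: b_def ip_eq sum_4 walker_entries frame_n_def frame_l_def frame_m_def frame_mt_def
          vector_4_nth)
    then show ?thesis
      by (simp add: adapted_def b_def plane_def frame_l_def frame_mt_def vector_4_nth)
  qed
  have plane: "mev (riemann_tensor (walker_metric A B C) x) [X, Y, v, w] = 0"
    if "x \<in> S" "v \<in> plane" "w \<in> plane" for x X Y v w
  proof -
    have zero: "v $ c * (w $ d * riemann (walker_metric A B C) x a b c d) = 0" for a b c d
      using that walker_riemann_zero[OF that(1), of c d a b] exhaust_4[of c] exhaust_4[of d] by (auto simp: plane_def)
    have "mev (riemann_tensor (walker_metric A B C) x) [X, Y, v, w] = (\<Sum>a\<in>UNIV. \<Sum>b\<in>UNIV. \<Sum>c\<in>UNIV. \<Sum>d\<in>UNIV.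
        X $ a * (Y $ b * (v $ c * (w $ d * riemann (walker_metric A B C) x a b c d))))"
      by (simp add: riemann_tensor_def sum_distrib_left)
    also have "\<dots> = 0"
      unfolding zero by simp
    finally show ?thesis .
  qed
  have ric: "ricci (walker_metric A B C) x a b = lam * walker_metric A B C x $ a $ b" if "x \<in> S" for x a b
    using ein that by (simp add: einstein_on_def)
  have sdb: "self_dual_free (\<lambda>k l. weyl_form lam x (b x i) (b x j) (b x k) (b x l))" if x: "x \<in> S" for x i j
  proof -
    let ?w = "\<lambda>i j k l. weyl_form lam x (b x i) (b x j) (b x k) (b x l)"
    have Psi: "weyl_form lam x frame_l (frame_m B C x) frame_l (frame_m B C x) = 0"
      "weyl_form lam x frame_l (frame_m B C x) frame_l (frame_n A C x) = 0"
      "weyl_form lam x frame_l (frame_m B C x) frame_mt (frame_n A C x) = 0"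
      "weyl_form lam x frame_l (frame_n A C x) frame_mt (frame_n A C x) = 0"
      "weyl_form lam x (frame_n A C x) frame_mt (frame_n A C x) frame_mt = 0"
      using sd x unfolding einstein_weyl_at[OF x ric[OF x], symmetric]
      by (simp_all add: self_dual_weyl_vanishes_on_def Psi0_def Psi1_def Psi2_def Psi3_def Psi4_def)
    have ip: "ip x (b x i) (b x j) = eta i j" for i j
      using b by (simp add: adapted_def)
    have tr: "(\<Sum>p\<in>UNIV. \<Sum>q\<in>UNIV. eta p q * ?w p c q d) = 0" for c d
    proof -
      have "(\<Sum>p\<in>UNIV. \<Sum>q\<in>UNIV. eta p q * ?w p c q d)
        = lam * eta c d - lam / 3 * (\<Sum>p\<in>UNIV. \<Sum>q\<in>UNIV. eta p q * (eta p q * eta c d - eta p d * eta c q))"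
        unfolding einstein_frame_trace[OF x b ric[OF x], symmetric] weyl_form_def ip
        by (simp add: right_diff_distrib sum_subtractf sum_distrib_left mult_ac del: mev.simps)
      \<comment> \<open>The trace of the metric part is 4 - 1 = 3 times \<open>eta c d\<close>,
        which the factor 1/3 cancels.\<close>
      also have "(\<Sum>p\<in>UNIV. \<Sum>q\<in>UNIV. eta p q * (eta p q * eta c d - eta p d * eta c q)) = 3 * eta c d"
        using exhaust_4[of c] exhaust_4[of d] by (elim disjE) (simp_all add: sum_4)
      finally show ?thesis by simp
    qed
    have "self_dual_free (?w i j)"
      by (rule weyl_self_dual_free; (rule weyl_form_symmetries[OF x] tr)?)
        (simp_all add: b_def weyl_form_minus Psi)
    then show ?thesis .
  qed
  have "const_leading 4 (frame_comp (riemann_tensor (walker_metric A B C)))"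
    using plane self_dual_free_frame[OF _ b _ sdb] by (rule einstein_self_dual_free_riemann_const_leading)
  then interpret constant_leading_curvature S "walker_metric A B C"
    by unfold_locales (use plane in auto)
  show ?thesis
    using b by (intro universal) blast
qed

end

theorem proposition2:
  fixes S :: "(real^4) set" and A B C :: "real^4 \<Rightarrow> real" and lam :: real
  assumes "open S"
    and "smooth_on S A" and "smooth_on S B" and "smooth_on S C"
    and "einstein_on S (walker_metric A B C) lam"
    and "self_dual_weyl_vanishes_on S A B C"
  shows "universal_on S (walker_metric A B C)"
  using assms by (rule walker_universal)

end
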